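(* Let $s\in(0,1)$, let $(a,b)$ be a bounded interval, and let $r\ge0$. Then the weighted fractional Laplacian operator $(-\Delta)^s_\omega$ can be extended uniquely to a continuous linear map from $H^{r+2s}_s(a,b)$ into $H^r_s(a,b)$. The extended operator is bijective and bicontinuous.
   Context: Weighted operator: let $\omega^s(y)=(y-a)^s(b-y)^s$. For $\phi\in C^2(a,b)\cap C^1[a,b]$ (a class containing all polynomials) and $x\in(a,b)$ define $$(-\Delta)^s_\omega[\phi](x)=C_s\frac{d}{dx}\int_a^b|x-y|^{1-2s}\frac{d}{dy}\big(\omega^s(y)\phi(y)\big)\,dy\quad (s\neq 1/2),$$ $$(-\Delta)^{1/2}_\omega[\phi](x)=\frac1\pi\frac{d}{dx}\int_a^b\ln|x-y|\,\frac{d}{dy}\big(\omega^{1/2}(y)\phi(y)\big)\,dy\quad (s=1/2),$$ where $C_s=-\Gamma(2s-1)\sin(\pi s)/\pi$ for $s\neq1/2$. Weighted spaces: $L^2_s(a,b)=\{\phi:\int_a^b|\phi|^2\omega^s<\infty\}$ with norm $\|\phi\|_{L^2_s}=(\int_a^b|\phi|^2\omega^s)^{1/2}$. On $(-1,1)$ (weight $(1-x^2)^s$) let $C_j^{(s+1/2)}$ be the Gegenbauer polynomials ($C_0^{(\alpha)}=1$, $C_1^{(\alpha)}(x)=2\alpha x$, $C_n^{(\alpha)}(x)=\frac1n[2x(n+\alpha-1)C_{n-1}^{(\alpha)}(x)-(n+2\alpha-2)C_{n-2}^{(\alpha)}(x)]$), and $\tilde C_j^{(s+1/2)}=C_j^{(s+1/2)}/\|C_j^{(s+1/2)}\|_{L^2_s(-1,1)}$.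 For $v\in L^2_s(-1,1)$ put $v_j=\int_{-1}^1v(x)\tilde C_j^{(s+1/2)}(x)(1-x^2)^s\,dx$. For $r\ge0$, $H^r_s(-1,1)=\{v\in L^2_s(-1,1):\sum_{j\ge0}(1+j^2)^r|v_j|^2<\infty\}$ is a Hilbert space with norm $\|v\|_{H^r_s}=\big(\sum_{j\ge0}(1+j^2)^r|v_j|^2\big)^{1/2}$. The space $H^r_s(a,b)$ is obtained by the affine change of variables: $v\in H^r_s(a,b)$ iff $\xi\mapsto v\big(a+\frac{(b-a)(\xi+1)}{2}\big)$ belongs to $H^r_s(-1,1)$, with the transported norm. *)

theory Defs
  imports "HOL-Analysis.Analysis"
begin

section \<open>The weighted operator\<close>

definition omega :: "real \<Rightarrow> real \<Rightarrow> real \<Rightarrow> real \<Rightarrow> real" where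
  "omega s a b y = (y - a) powr s * (b - y) powr s"

definition frac_const :: "real \<Rightarrow> real" where
  "frac_const s = - Gamma (2 * s - 1) * sin (pi * s) / pi"

text \<open>Only used at points \<open>x\<close> of the open interval \<open>(a,b)\<close>. The totalised values of the
  kernels at \<open>y = x\<close> concern a null set.\<close>

definition weighted_frac_lap ::
  "real \<Rightarrow> real \<Rightarrow> real \<Rightarrow> (real \<Rightarrow> real) \<Rightarrow> real \<Rightarrow> real" where
  "weighted_frac_lap s a b \<phi> x =
     (if s = 1 / 2
      then 1 / pi * deriv (\<lambda>x. LINT y|lebesgue_on {a<..<b}.
             ln \<bar>x - y\<bar> * deriv (\<lambda>y. omega (1 / 2) a b y * \<phi> y) y) x
      else frac_const s * deriv (\<lambda>x. LINT y|lebesgue_on {a<..<b}.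
             \<bar>x - y\<bar> powr (1 - 2 * s) * deriv (\<lambda>y. omega s a b y * \<phi> y) y) x)"

text \<open>The class \<open>C\<^sup>2(a,b) \<inter> C\<^sup>1[a,b]\<close>; derivatives at the endpoints are one-sided.\<close>

definition C2_C1 :: "real \<Rightarrow> real \<Rightarrow> (real \<Rightarrow> real) set" where
  "C2_C1 a b = {\<phi>. \<exists>\<phi>' \<phi>''.
      (\<forall>x\<in>{a..b}. (\<phi> has_real_derivative \<phi>' x) (at x within {a..b})) \<and>
      continuous_on {a..b} \<phi>' \<and>
      (\<forall>x\<in>{a<..<b}. (\<phi>' has_real_derivative \<phi>'' x) (at x)) \<and>
      continuous_on {a<..<b} \<phi>''}"


section \<open>Weighted spaces: functions\<close>

definition L2s :: "real \<Rightarrow> real \<Rightarrow> real \<Rightarrow> (real \<Rightarrow> real) set" where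
  "L2s s a b = {\<phi> \<in> borel_measurable (lebesgue_on {a<..<b}).
      integrable (lebesgue_on {a<..<b}) (\<lambda>x. \<bar>\<phi> x\<bar>\<^sup>2 * omega s a b x)}"

definition L2s_norm :: "real \<Rightarrow> real \<Rightarrow> real \<Rightarrow> (real \<Rightarrow> real) \<Rightarrow> real" where
  "L2s_norm s a b \<phi> = sqrt (LINT x|lebesgue_on {a<..<b}. \<bar>\<phi> x\<bar>\<^sup>2 * omega s a b x)"

fun gegenbauer :: "real \<Rightarrow> nat \<Rightarrow> real \<Rightarrow> real" where
  "gegenbauer \<alpha> 0 x = 1"
| "gegenbauer \<alpha> (Suc 0) x = 2 * \<alpha> * x"
| "gegenbauer \<alpha> (Suc (Suc n)) x =
     1 / real (n + 2) *
       (2 * x * (real (n + 2) + \<alpha> - 1) * gegenbauer \<alpha> (Suc n) x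
        - (real (n + 2) + 2 * \<alpha> - 2) * gegenbauer \<alpha> n x)"

definition gegenbauer_normalized :: "real \<Rightarrow> nat \<Rightarrow> real \<Rightarrow> real" where
  "gegenbauer_normalized s j x =
     gegenbauer (s + 1 / 2) j x / L2s_norm s (-1) 1 (gegenbauer (s + 1 / 2) j)"

definition gegenbauer_coeff :: "real \<Rightarrow> (real \<Rightarrow> real) \<Rightarrow> nat \<Rightarrow> real" where
  "gegenbauer_coeff s v j =
     (LINT x|lebesgue_on {-1<..<1}. v x * gegenbauer_normalized s j x * omega s (-1) 1 x)"

definition Hs_ref :: "real \<Rightarrow> real \<Rightarrow> (real \<Rightarrow> real) set" where
  "Hs_ref s r = {v \<in> L2s s (-1) 1.
      summable (\<lambda>j. (1 + (real j)\<^sup>2) powr r * \<bar>gegenbauer_coeff s v j\<bar>\<^sup>2)}"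

definition Hs_ref_norm :: "real \<Rightarrow> real \<Rightarrow> (real \<Rightarrow> real) \<Rightarrow> real" where
  "Hs_ref_norm s r v =
     sqrt (\<Sum>j. (1 + (real j)\<^sup>2) powr r * \<bar>gegenbauer_coeff s v j\<bar>\<^sup>2)"

definition from_ref :: "real \<Rightarrow> real \<Rightarrow> real \<Rightarrow> real" where
  "from_ref a b \<xi> = a + (b - a) * (\<xi> + 1) / 2"

definition Hs_fun :: "real \<Rightarrow> real \<Rightarrow> real \<Rightarrow> real \<Rightarrow> (real \<Rightarrow> real) set" where
  "Hs_fun s r a b = {v. v \<circ> from_ref a b \<in> Hs_ref s r}"

definition Hs_fun_norm :: "real \<Rightarrow> real \<Rightarrow> real \<Rightarrow> real \<Rightarrow> (real \<Rightarrow> real) \<Rightarrow> real" where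
  "Hs_fun_norm s r a b v = Hs_ref_norm s r (v \<circ> from_ref a b)"


section \<open>Weighted spaces: classes modulo equality almost everywhere\<close>

text \<open>As usual, elements of the spaces are functions on \<open>(a,b)\<close> up to equality almost everywhere,
  so the spaces are represented by equivalence classes. A member of a class may take arbitrary
  values outside \<open>(a,b)\<close>.\<close>

definition ae_class :: "real \<Rightarrow> real \<Rightarrow> (real \<Rightarrow> real) \<Rightarrow> (real \<Rightarrow> real) set" where
  "ae_class a b f = {g \<in> borel_measurable (lebesgue_on {a<..<b}).
      AE x in lebesgue_on {a<..<b}. g x = f x}"

definition class_add ::
  "real \<Rightarrow> real \<Rightarrow> (real \<Rightarrow> real) set \<Rightarrow> (real \<Rightarrow> real) set \<Rightarrow> (real \<Rightarrow> real) set" where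
  "class_add a b F G = (\<Union>f\<in>F. \<Union>g\<in>G. ae_class a b (\<lambda>x. f x + g x))"

definition class_scale ::
  "real \<Rightarrow> real \<Rightarrow> real \<Rightarrow> (real \<Rightarrow> real) set \<Rightarrow> (real \<Rightarrow> real) set" where
  "class_scale a b c F = (\<Union>f\<in>F. ae_class a b (\<lambda>x. c * f x))"

definition Hs :: "real \<Rightarrow> real \<Rightarrow> real \<Rightarrow> real \<Rightarrow> (real \<Rightarrow> real) set set" where
  "Hs s r a b = ae_class a b ` Hs_fun s r a b"

text \<open>All members of a class have the same norm.\<close>

definition Hs_norm :: "real \<Rightarrow> real \<Rightarrow> real \<Rightarrow> real \<Rightarrow> (real \<Rightarrow> real) set \<Rightarrow> real" where
  "Hs_norm s r a b F = the_elem (Hs_fun_norm s r a b ` F)"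

text \<open>The library's metric spaces require symmetry and nonnegativity of the distance function also
  outside the carrier, hence the case distinction.\<close>

definition Hs_dist ::
  "real \<Rightarrow> real \<Rightarrow> real \<Rightarrow> real \<Rightarrow> (real \<Rightarrow> real) set \<Rightarrow> (real \<Rightarrow> real) set \<Rightarrow> real" where
  "Hs_dist s r a b F G =
     (if F \<in> Hs s r a b \<and> G \<in> Hs s r a b
      then Hs_norm s r a b (class_add a b F (class_scale a b (-1) G)) else 0)"

definition Hs_top :: "real \<Rightarrow> real \<Rightarrow> real \<Rightarrow> real \<Rightarrow> (real \<Rightarrow> real) set topology" where
  "Hs_top s r a b = Metric_space.mtopology (Hs s r a b) (Hs_dist s r a b)"

definition class_linear_on ::
  "real \<Rightarrow> real \<Rightarrow> (real \<Rightarrow> real) set set \<Rightarrow>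
     ((real \<Rightarrow> real) set \<Rightarrow> (real \<Rightarrow> real) set) \<Rightarrow> bool" where
  "class_linear_on a b V T \<longleftrightarrow>
     (\<forall>F\<in>V. \<forall>G\<in>V. T (class_add a b F G) = class_add a b (T F) (T G)) \<and>
     (\<forall>c. \<forall>F\<in>V. T (class_scale a b c F) = class_scale a b c (T F))"

definition continuous_linear_extension ::
  "real \<Rightarrow> real \<Rightarrow> real \<Rightarrow> real \<Rightarrow> ((real \<Rightarrow> real) set \<Rightarrow> (real \<Rightarrow> real) set) \<Rightarrow> bool" where
  "continuous_linear_extension s r a b T \<longleftrightarrow>
     T \<in> Hs s (r + 2 * s) a b \<rightarrow> Hs s r a b \<and>
     class_linear_on a b (Hs s (r + 2 * s) a b) T \<and>
     continuous_map (Hs_top s (r + 2 * s) a b) (Hs_top s r a b) T \<and>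
     (\<forall>\<phi> \<in> C2_C1 a b \<inter> Hs_fun s (r + 2 * s) a b.
        T (ae_class a b \<phi>) = ae_class a b (weighted_frac_lap s a b \<phi>))"


section \<open>Well-definedness on classes\<close>

lemma ae_class_self:
  "f \<in> borel_measurable (lebesgue_on {a<..<b}) \<Longrightarrow> f \<in> ae_class a b f"
  by (simp add: ae_class_def)

lemma ae_class_cong:
  assumes "AE x in lebesgue_on {a<..<b}. f x = g x"
  shows "ae_class a b f = ae_class a b g"
  unfolding ae_class_def using assms by (auto elim: AE_mp)

lemma ae_class_eq_iff:
  assumes "f \<in> borel_measurable (lebesgue_on {a<..<b})"
  shows "ae_class a b f = ae_class a b g \<longleftrightarrow> (AE x in lebesgue_on {a<..<b}. f x = g x)"
  using ae_class_self[OF assms] ae_class_cong by (auto simp: ae_class_def)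

lemma class_add_ae_class:
  assumes "f \<in> borel_measurable (lebesgue_on {a<..<b})"
    and "g \<in> borel_measurable (lebesgue_on {a<..<b})"
  shows "class_add a b (ae_class a b f) (ae_class a b g) = ae_class a b (\<lambda>x. f x + g x)"
proof -
  have *: "ae_class a b (\<lambda>x. f' x + g' x) = ae_class a b (\<lambda>x. f x + g x)"
    if "f' \<in> ae_class a b f" "g' \<in> ae_class a b g" for f' g'
  proof (rule ae_class_cong)
    have "AE x in lebesgue_on {a<..<b}. f' x = f x" "AE x in lebesgue_on {a<..<b}. g' x = g x"
      using that by (auto simp: ae_class_def)
    then show "AE x in lebesgue_on {a<..<b}. f' x + g' x = f x + g x"
      by eventually_elim simp
  qed
  show ?thesis
    unfolding class_add_def
    using * ae_class_self[OF assms(1)] ae_class_self[OF assms(2)] by blast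
qed

lemma class_scale_ae_class:
  assumes "f \<in> borel_measurable (lebesgue_on {a<..<b})"
  shows "class_scale a b c (ae_class a b f) = ae_class a b (\<lambda>x. c * f x)"
proof -
  have *: "ae_class a b (\<lambda>x. c * f' x) = ae_class a b (\<lambda>x. c * f x)"
    if "f' \<in> ae_class a b f" for f'
  proof (rule ae_class_cong)
    have "AE x in lebesgue_on {a<..<b}. f' x = f x"
      using that by (auto simp: ae_class_def)
    then show "AE x in lebesgue_on {a<..<b}. c * f' x = c * f x"
      by eventually_elim simp
  qed
  show ?thesis
    unfolding class_scale_def using * ae_class_self[OF assms] by blast
qed

lemma from_ref_alt: "from_ref a b \<xi> = (a + b) / 2 + (b - a) / 2 * \<xi>"
  by (simp add: from_ref_def field_simps)

lemma from_ref_mem_iff: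
  assumes "a < b"
  shows "from_ref a b \<xi> \<in> {a<..<b} \<longleftrightarrow> \<xi> \<in> {-1<..<1}"
proof -
  have "0 < b - a" using assms by simp
  have "a < from_ref a b \<xi> \<longleftrightarrow> 0 < (b - a) * (\<xi> + 1)" by (simp add: from_ref_def)
  moreover have "from_ref a b \<xi> < b \<longleftrightarrow> 0 < (b - a) * (1 - \<xi>)"
    by (simp add: from_ref_def field_simps)
  ultimately show ?thesis using \<open>0 < b - a\<close> by (auto simp: zero_less_mult_iff)
qed

lemma from_ref_measurable:
  assumes "a < b"
  shows "from_ref a b \<in> lebesgue \<rightarrow>\<^sub>M lebesgue"
  using lebesgue_affine_measurable[of "\<lambda>_. (b - a) / 2" "(a + b) / 2"] assms
  by (simp add: from_ref_alt[abs_def])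

lemma measurable_comp_from_ref:
  assumes "a < b" and "v \<in> borel_measurable (lebesgue_on {a<..<b})"
  shows "v \<circ> from_ref a b \<in> borel_measurable (lebesgue_on {-1<..<1})"
proof -
  have "from_ref a b \<in> lebesgue_on {-1<..<1} \<rightarrow>\<^sub>M lebesgue_on {a<..<b}"
    using from_ref_mem_iff[OF assms(1)]
    by (intro measurable_restrict_space3 from_ref_measurable[OF assms(1)]) blast
  then show ?thesis using assms(2) by (rule measurable_comp)
qed

lemma AE_comp_from_ref:
  assumes "a < b" and "AE x in lebesgue_on {a<..<b}. P x"
  shows "AE \<xi> in lebesgue_on {-1<..<1}. P (from_ref a b \<xi>)"
proof -
  let ?c = "(b - a) / 2" and ?t = "(a + b) / 2"
  have "AE x in lebesgue. x \<in> {a<..<b} \<longrightarrow> P x"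
    using assms(2) by (subst (asm) AE_restrict_space_iff) auto
  then obtain N where N: "N \<in> null_sets lebesgue"
      "\<And>x. x \<in> space lebesgue - N \<Longrightarrow> x \<in> {a<..<b} \<longrightarrow> P x"
    by (rule AE_E3) (rule that)
  have c: "?c \<noteq> 0" using assms(1) by simp
  have "N \<in> null_sets (density (distr lebesgue lebesgue (\<lambda>x. ?t + ?c * x)) (\<lambda>_. ennreal \<bar>?c\<bar>))"
    using N(1) by (subst lebesgue_real_affine[OF c, of ?t, symmetric])
  then have "AE x in distr lebesgue lebesgue (\<lambda>x. ?t + ?c * x). x \<in> N \<longrightarrow> ennreal \<bar>?c\<bar> = 0"
    by (subst (asm) null_sets_density_iff) simp_all
  then have "AE x in distr lebesgue lebesgue (from_ref a b). x \<notin> N"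
    unfolding from_ref_alt[abs_def] by (rule eventually_mono) (use c in simp)
  moreover have "{x \<in> space lebesgue. x \<notin> N} \<in> sets lebesgue"
    using N(1) by (intro sets.sets_Collect_neg) auto
  ultimately have "AE \<xi> in lebesgue. from_ref a b \<xi> \<notin> N"
    using AE_distr_iff[OF from_ref_measurable[OF assms(1)], of "\<lambda>x. x \<notin> N"] by simp
  then have "AE \<xi> in lebesgue. \<xi> \<in> {-1<..<1} \<longrightarrow> P (from_ref a b \<xi>)"
  proof eventually_elim
    case (elim \<xi>)
    then show ?case using N(2)[of "from_ref a b \<xi>"] from_ref_mem_iff[OF assms(1), of \<xi>] by auto
  qed
  then show ?thesis by (subst AE_restrict_space_iff) auto
qed

lemma borel_measurable_gegenbauer [measurable]: "gegenbauer \<alpha> n \<in> borel_measurable borel"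
proof (induction n rule: induct_nat_012)
  case 0
  then show ?case by (simp add: gegenbauer.simps(1)[abs_def])
next
  case 1
  then show ?case by (simp add: gegenbauer.simps(2)[abs_def])
next
  case (ge2 n)
  note [measurable] = ge2
  show ?case unfolding gegenbauer.simps(3)[abs_def] by measurable
qed

lemma Hs_norm_ae_class:
  assumes "a < b" and v: "v \<in> borel_measurable (lebesgue_on {a<..<b})"
  shows "Hs_norm s r a b (ae_class a b v) = Hs_fun_norm s r a b v"
proof -
  have "Hs_fun_norm s r a b w = Hs_fun_norm s r a b v" if w: "w \<in> ae_class a b v" for w
  proof -
    have wm: "w \<in> borel_measurable (lebesgue_on {a<..<b})"
      and wv: "AE x in lebesgue_on {a<..<b}. w x = v x"
      using w by (auto simp: ae_class_def)
    note m[measurable] = measurable_comp_from_ref[OF assms(1) wm]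
      measurable_comp_from_ref[OF assms(1) v]
    have g: "(\<lambda>x. gegenbauer_normalized s j x * omega s (-1) 1 x)
        \<in> borel_measurable (lebesgue_on {-1<..<1})" for j
      unfolding gegenbauer_normalized_def omega_def
      by (intro measurable_restrict_space1 measurable_completion) simp
    have "gegenbauer_coeff s (w \<circ> from_ref a b) j = gegenbauer_coeff s (v \<circ> from_ref a b) j" for j
      unfolding gegenbauer_coeff_def mult.assoc
    proof (rule integral_cong_AE)
      show "AE x in lebesgue_on {-1<..<1}.
          (w \<circ> from_ref a b) x * (gegenbauer_normalized s j x * omega s (-1) 1 x) =
          (v \<circ> from_ref a b) x * (gegenbauer_normalized s j x * omega s (-1) 1 x)"
        using AE_comp_from_ref[OF assms(1) wv] by eventually_elim simp
    qed (intro borel_measurable_times m g)+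
    then show ?thesis by (simp add: Hs_fun_norm_def Hs_ref_norm_def)
  qed
  then have "Hs_fun_norm s r a b ` ae_class a b v = {Hs_fun_norm s r a b v}"
    using ae_class_self[OF v] by blast
  then show ?thesis by (simp add: Hs_norm_def)
qed

end

theory Submission
  imports Defs
begin

text \<open>
  The operator is diagonal in the orthonormal basis \<open>e\<^sub>j\<close> of \<open>L\<^sup>2\<^sub>s(-1,1)\<close> formed by the
  normalised Gegenbauer polynomials: it multiplies the \<open>j\<close>-th coefficient by
  \<open>\<lambda>\<^sub>j = \<Gamma>(2s + j + 1) / j!\<close>. The coefficients identify the spaces with weighted sequence spaces
  (\<open>L2s_zero_if_coeff_zero\<close> for injectivity, \<open>Riesz_Fischer_gegenbauer\<close> for surjectivity), and
  \<open>\<lambda>\<^sub>j\<close> is bounded above and below by multiples of \<open>(1 + j\<^sup>2)\<^sup>s\<close> (\<open>eigval_bounds\<close>). So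
  multiplication by \<open>\<lambda>\<^sub>j\<close> maps the sequence space of order \<open>r + 2s\<close> onto that of order \<open>r\<close>,
  bijectively and with bounds in both directions. Polynomials are dense, which makes the
  continuous extension unique. The affine change of variables leaves \<open>\<lambda>\<^sub>j\<close> unchanged, because
  the length factors of the weight and of the kernel cancel.

  The eigenvalue relation needs no evaluation of potentials of Gegenbauer polynomials. Since
  \<open>(\<omega>\<^sup>s p)' = \<omega>\<^bsup>s-1\<^esup> q\<close> with a polynomial \<open>q\<close>, the operator is the derivative of a Riesz
  potential of a density \<open>\<omega>\<^bsup>s-1\<^esup> q\<close>. The potential of \<open>\<omega>\<^bsup>s-1\<^esup>\<close> itself is constant on the
  interval: two substitutions of Moebius type turn it into a Beta integral that does not depend
  on the point (\<open>riesz_potential_nn_integral\<close>). Multiplying the density by \<open>y\<close> changes the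
  potential by an elementary recursion (\<open>riesz_pot_mult_var_diff\<close>), so potentials of polynomials
  are polynomials with known leading coefficients, and the operator acts on polynomials
  triangularly with diagonal entries \<open>\<lambda>\<^sub>n\<close> (\<open>frac_lap_poly_triangular\<close>). It is also symmetric
  for the weight \<open>\<omega>\<^sup>s\<close>, because the kernel is even; a symmetric triangular operator has the
  orthogonal polynomials as eigenvectors (\<open>frac_lap_poly_gbasis\<close>).

  The operator is defined pointwise on \<open>C\<^sup>2(a,b) \<inter> C\<^sup>1[a,b]\<close>, whereas the diagonal map yields a
  class \<open>g\<close> in the target space. To compare them, let \<open>F\<close> be the potential whose derivative is
  the operator, and let \<open>G\<close> be a primitive of \<open>g\<close>. By symmetry and integration by parts, \<open>F\<close> and
  \<open>G\<close> have the same integral against \<open>(\<omega>\<^sup>s q)'\<close> for every polynomial \<open>q\<close>. These functions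
  together with \<open>\<omega>\<^bsup>s-1\<^esup>\<close> span all products of \<open>\<omega>\<^bsup>s-1\<^esup>\<close> with polynomials, and an integrable
  function is determined by its moments; hence \<open>F - G\<close> is constant, and Lebesgue's
  differentiation theorem gives \<open>F' = g\<close> almost everywhere (\<open>frac_lap_C1_AE\<close>).

  The kernel \<open>k(t) = (\<bar>t\<bar>\<^bsup>1-2s\<^esup> - 1) / (1 - 2s)\<close>, with \<open>ln \<bar>t\<bar>\<close> as its limit at \<open>s = 1/2\<close>,
  treats both cases of the definition alike: the added constant disappears under the outer
  derivative.
\<close>

section \<open>Lebesgue differentiation on the line\<close>

text \<open>
  At a point where the difference quotients fail to converge to \<open>f x\<close>, there are arbitrarily short
  intervals with end point \<open>x\<close> whose increment of the primitive deviates from \<open>f x\<close> times the length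
  by more than \<open>\<mu>\<close> times the length. These intervals form a Vitali cover. Finitely many disjoint
  ones that are fine for a Henstock gauge form a tagged partial division, so Henstock's lemma
  bounds their total length by an arbitrary \<open>e\<close>.
\<close>

lemma lebesgue_differentiation_real:
  fixes f :: "real \<Rightarrow> real"
  assumes f: "f integrable_on {a..b}"
  shows "negligible {x \<in> {a<..<b}.
    \<not> ((\<lambda>x. integral {a..x} f) has_real_derivative f x) (at x)}"
proof -
  define \<Phi> where "\<Phi> = (\<lambda>x. integral {a..x} f)"
  define E where "E \<mu> = {x \<in> {a<..<b}. \<forall>d>0. \<exists>y\<in>{a<..<b}. y \<noteq> x \<and> \<bar>y - x\<bar> < d \<and>
      \<mu> * \<bar>y - x\<bar> < \<bar>\<Phi> y - \<Phi> x - f x * (y - x)\<bar>}" for \<mu> :: real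
  define J where "J i = {min (fst i) (snd i)..max (fst i) (snd i)}" for i :: "real \<times> real"
  have J_cball: "J i = cball ((fst i + snd i) / 2) (\<bar>snd i - fst i\<bar> / 2)" for i
    by (auto simp: J_def cball_eq_atLeastAtMost min_def max_def field_simps)
  have \<Phi>_diff: "integral {x..y} f = \<Phi> y - \<Phi> x" if "a \<le> x" "x \<le> y" "y \<le> b" for x y
  proof -
    have "f integrable_on {a..y}"
      by (rule integrable_on_subinterval[OF f]) (use that in auto)
    from Henstock_Kurzweil_Integration.integral_combine[OF that(1,2) this] show ?thesis
      by (simp add: \<Phi>_def)
  qed
  \<comment> \<open>The points with a deviation of relative size more than \<open>\<mu>\<close> at every scale form a null set.\<close>
  have negE: "negligible (E \<mu>)" if "\<mu> > 0" for \<mu>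
    unfolding negligible_outer_le
  proof (intro allI impI)
    fix e :: real assume "e > 0"
    then have "e * \<mu> > 0" using that by simp
    have f': "f integrable_on cbox a b" using f by simp
    from Henstock_lemma[OF f' \<open>e * \<mu> > 0\<close>] obtain \<gamma> where \<gamma>: "gauge \<gamma>"
      and hen: "\<And>p. p tagged_partial_division_of (cbox a b) \<Longrightarrow> \<gamma> fine p \<Longrightarrow>
         (\<Sum>(x,k)\<in>p. norm (measure lborel k *\<^sub>R f x - integral k f)) < e * \<mu>"
      by blast
    \<comment> \<open>Pairs of a bad point and a second end point; the interval between them lies in the gauge of
        the bad point.\<close>
    define K where "K = {i. fst i \<in> {a<..<b} \<and> snd i \<in> {a<..<b} \<and> snd i \<noteq> fst i \<and> J i \<subseteq> \<gamma> (fst i) \<and>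
      \<mu> * \<bar>snd i - fst i\<bar> < \<bar>\<Phi> (snd i) - \<Phi> (fst i) - f (fst i) * (snd i - fst i)\<bar>}"
    have cover: "\<exists>i. i \<in> K \<and> x \<in> cball ((fst i + snd i) / 2) (\<bar>snd i - fst i\<bar> / 2)
        \<and> \<bar>snd i - fst i\<bar> / 2 < d" if x: "x \<in> E \<mu>" and "d > 0" for x d
    proof -
      have "open (\<gamma> x)" "x \<in> \<gamma> x" using \<gamma> by (auto simp: gauge_def)
      then obtain h where h: "h > 0" "ball x h \<subseteq> \<gamma> x" by (meson openE)
      have "min d h > 0" using h \<open>d > 0\<close> by simp
      with x obtain y where y: "y \<in> {a<..<b}" "y \<noteq> x" "\<bar>y - x\<bar> < min d h"
          "\<mu> * \<bar>y - x\<bar> < \<bar>\<Phi> y - \<Phi> x - f x * (y - x)\<bar>" and xab: "x \<in> {a<..<b}"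
        unfolding E_def by blast
      have "J (x, y) \<subseteq> ball x h"
        using y(3) by (auto simp: J_def ball_eq_greaterThanLessThan)
      then have "(x, y) \<in> K" using y xab h by (auto simp: K_def)
      moreover have "x \<in> J (x, y)" by (auto simp: J_def)
      ultimately show ?thesis using y(3) unfolding J_cball
        by (intro exI[of _ "(x, y)"]) auto
    qed
    obtain C where C: "countable C" "C \<subseteq> K"
      and disj: "pairwise (\<lambda>i j. disjnt (J i) (J j)) C"
      and neg: "negligible (E \<mu> - (\<Union>i\<in>C. J i))"
      by (rule Vitali_covering_theorem_cballs[of K "\<lambda>i. \<bar>snd i - fst i\<bar> / 2" "E \<mu>"
          "\<lambda>i. (fst i + snd i) / 2", OF _ cover]) (auto simp: K_def J_cball)
    have fin: "measure lebesgue (\<Union>i\<in>F. J i) \<le> e" if F: "F \<subseteq> C" "finite F" for F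
    proof -
      let ?p = "(\<lambda>i. (fst i, J i)) ` F"
      have FK: "i \<in> K" if "i \<in> F" for i using F C that by blast
      have Jne: "fst i \<in> J i" "J i \<noteq> {}" for i by (auto simp: J_def)
      have inj: "inj_on (\<lambda>i. (fst i, J i)) F"
      proof (rule inj_onI)
        fix i j assume ij: "i \<in> F" "j \<in> F" "(fst i, J i) = (fst j, J j)"
        show "i = j"
        proof (rule ccontr)
          assume "i \<noteq> j"
          then have "disjnt (J i) (J j)" using disj ij F unfolding pairwise_def by blast
          then show False using ij(3) Jne(1)[of i] unfolding disjnt_def by auto
        qed
      qed
      have tag: "?p tagged_partial_division_of (cbox a b)"
        unfolding tagged_partial_division_of_def
      proof (intro conjI allI impI)
        show "finite ?p" using F by simp
        fix x k assume "(x, k) \<in> ?p"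
        then obtain i where i: "i \<in> F" "x = fst i" "k = J i" by auto
        show "x \<in> k" using i Jne by simp
        show "k \<subseteq> cbox a b" using i FK[OF i(1)] by (auto simp: K_def J_def)
        show "\<exists>a b. k = cbox a b" using i by (auto simp: J_def)
      next
        fix x1 k1 x2 k2 assume A: "(x1, k1) \<in> ?p \<and> (x2, k2) \<in> ?p \<and> (x1, k1) \<noteq> (x2, k2)"
        then obtain i j where i: "i \<in> F" "x1 = fst i" "k1 = J i"
            and j: "j \<in> F" "x2 = fst j" "k2 = J j" by auto
        then have "i \<noteq> j" using A by auto
        then have "disjnt (J i) (J j)" using disj i j F unfolding pairwise_def by blast
        then show "interior k1 \<inter> interior k2 = {}"
          using i j interior_subset unfolding disjnt_def by blast
      qed
      have fine: "\<gamma> fine ?p" using FK by (auto simp: fine_def K_def)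
      have "measure lebesgue (\<Union>i\<in>F. J i) \<le> (\<Sum>i\<in>F. measure lebesgue (J i))"
        using F by (intro measure_UNION_le) (auto simp: J_def)
      also have "\<mu> * \<dots> \<le> (\<Sum>i\<in>F. norm (measure lborel (J i) *\<^sub>R f (fst i) - integral (J i) f))"
        unfolding sum_distrib_left
      proof (rule sum_mono)
        fix i assume "i \<in> F"
        from FK[OF this] have i: "fst i \<in> {a<..<b}" "snd i \<in> {a<..<b}"
          "\<mu> * \<bar>snd i - fst i\<bar> < \<bar>\<Phi> (snd i) - \<Phi> (fst i) - f (fst i) * (snd i - fst i)\<bar>"
          by (auto simp: K_def)
        show "\<mu> * measure lebesgue (J i) \<le> norm (measure lborel (J i) *\<^sub>R f (fst i)
            - integral (J i) f)"
        proof (cases "fst i \<le> snd i")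
          case True
          then show ?thesis using i \<Phi>_diff[of "fst i" "snd i"]
            by (auto simp: J_def min_def max_def algebra_simps abs_minus_commute)
        next
          case False
          then show ?thesis using i \<Phi>_diff[of "snd i" "fst i"]
            by (auto simp: J_def min_def max_def algebra_simps abs_minus_commute)
        qed
      qed
      also have "\<dots> = (\<Sum>(x,k)\<in>?p. norm (measure lborel k *\<^sub>R f x - integral k f))"
        by (subst sum.reindex[OF inj]) (auto simp: o_def)
      also have "\<dots> < e * \<mu>" by (rule hen[OF tag fine])
      finally show ?thesis using \<open>\<mu> > 0\<close> by (simp add: mult.commute)
    qed
    have meas: "(\<Union>i\<in>C. J i) \<in> lmeasurable \<and> measure lebesgue (\<Union>i\<in>C. J i) \<le> e"
    proof (cases "C = {}")
      case False
      have ran: "range (from_nat_into C) = C" using False C(1) by simp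
      have fin': "measure lebesgue (\<Union>n\<le>N. J (from_nat_into C n)) \<le> e" for N
        using fin[of "from_nat_into C ` {..N}"] from_nat_into[OF False] by (auto simp: image_image)
      have "(\<Union>n. J (from_nat_into C n)) \<in> lmeasurable"
        by (rule fmeasurable_countable_Union[OF _ fin']) (auto simp: J_def)
      moreover have "measure lebesgue (\<Union>n. J (from_nat_into C n)) \<le> e"
        by (rule measure_countable_Union_le[OF _ fin']) (auto simp: J_def)
      moreover have "(\<Union>n. J (from_nat_into C n)) = (\<Union>i\<in>C. J i)"
        using ran by (metis image_image)
      ultimately show ?thesis by simp
    qed (use \<open>e > 0\<close> in auto)
    let ?N = "E \<mu> - (\<Union>i\<in>C. J i)"
    have N: "?N \<in> lmeasurable" "measure lebesgue ?N = 0"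
      using neg negligible_imp_measurable negligible_imp_measure0 by auto
    show "\<exists>T. E \<mu> \<subseteq> T \<and> T \<in> lmeasurable \<and> measure lebesgue T \<le> e"
    proof (intro exI conjI)
      show "E \<mu> \<subseteq> ?N \<union> (\<Union>i\<in>C. J i)" by blast
      show "?N \<union> (\<Union>i\<in>C. J i) \<in> lmeasurable" using N meas by blast
      have "measure lebesgue (?N \<union> (\<Union>i\<in>C. J i)) \<le> measure lebesgue ?N + measure lebesgue (\<Union>i\<in>C. J
          i)"
        using N meas by (intro measure_Un_le) (auto intro: fmeasurableD)
      then show "measure lebesgue (?N \<union> (\<Union>i\<in>C. J i)) \<le> e" using N meas by simp
    qed
  qed
  have "negligible (\<Union>n. E (inverse (real (Suc n))))"
    by (intro negligible_countable_Union) (auto intro!: negE)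
  moreover have "(\<Phi> has_real_derivative f x) (at x)"
    if x: "x \<in> {a<..<b}" "x \<notin> (\<Union>n. E (inverse (real (Suc n))))" for x
    unfolding has_field_derivative_def has_derivative_at_alt
  proof (intro conjI allI impI)
    show "bounded_linear ((*) (f x))" by (rule bounded_linear_mult_right)
    fix e :: real assume "e > 0"
    then obtain n where n: "inverse (real (Suc n)) < e" using reals_Archimedean by blast
    let ?\<mu> = "inverse (real (Suc n))"
    from x have "x \<notin> E ?\<mu>" by blast
    then obtain d where d: "d > 0" "\<And>y. y \<in> {a<..<b} \<Longrightarrow> y \<noteq> x \<Longrightarrow> \<bar>y - x\<bar> < d \<Longrightarrow>
        \<bar>\<Phi> y - \<Phi> x - f x * (y - x)\<bar> \<le> ?\<mu> * \<bar>y - x\<bar>"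
      using x(1) unfolding E_def by (force simp: not_less)
    let ?d = "min d (min (x - a) (b - x))"
    show "\<exists>d>0. \<forall>y. norm (y - x) < d \<longrightarrow> norm (\<Phi> y - \<Phi> x - f x * (y - x)) \<le> e * norm (y - x)"
    proof (intro exI[of _ ?d] conjI allI impI)
      show "?d > 0" using d x by auto
      fix y assume y: "norm (y - x) < ?d"
      then have "y \<in> {a<..<b}" by (auto simp: abs_if split: if_splits)
      show "norm (\<Phi> y - \<Phi> x - f x * (y - x)) \<le> e * norm (y - x)"
      proof (cases "y = x")
        case False
        have "\<bar>\<Phi> y - \<Phi> x - f x * (y - x)\<bar> \<le> ?\<mu> * \<bar>y - x\<bar>"
          using d(2)[OF \<open>y \<in> _\<close> False] y by simp
        also have "\<dots> \<le> e * \<bar>y - x\<bar>" using n by (intro mult_right_mono) auto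
        finally show ?thesis by simp
      qed simp
    qed
  qed
  ultimately show ?thesis unfolding \<Phi>_def by (elim negligible_subset) auto
qed

section \<open>Primitives and moments on the reference interval\<close>

lemma weierstrass_real_poly:
  fixes f :: "real \<Rightarrow> real"
  assumes "continuous_on {a..b} f" and "e > 0"
  shows "\<exists>p. \<forall>x\<in>{a..b}. \<bar>f x - poly p x\<bar> < e"
proof -
  obtain g where g: "real_polynomial_function g" "\<And>x. x \<in> {a..b} \<Longrightarrow> \<bar>f x - g x\<bar> < e"
    using Stone_Weierstrass_real_polynomial_function[of "{a..b}" f e] assms by (metis compact_Icc)
  then obtain c n where c: "g = (\<lambda>x. \<Sum>i\<le>n::nat. c i * x ^ i)"
    using real_polynomial_function_imp_sum by blast
  have "poly (\<Sum>i\<le>n. monom (c i) i) x = g x" for x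
    by (simp add: c poly_sum poly_monom)
  then show ?thesis using g(2) by (intro exI[of _ "\<Sum>i\<le>n. monom (c i) i"]) simp
qed

lemma AE_lebesgue_on_iff_negligible:
  assumes "S \<in> sets lebesgue"
  shows "(AE x in lebesgue_on S. P x) \<longleftrightarrow> negligible {x \<in> S. \<not> P x}"
proof -
  have "(AE x in lebesgue_on S. P x) \<longleftrightarrow> (AE x in lebesgue. x \<in> S \<longrightarrow> P x)"
    using assms by (subst AE_restrict_space_iff) auto
  also have "\<dots> \<longleftrightarrow> {x \<in> S. \<not> P x} \<in> null_sets lebesgue"
  proof
    assume "AE x in lebesgue. x \<in> S \<longrightarrow> P x"
    then have "\<exists>N\<in>null_sets lebesgue. {x \<in> S. \<not> P x} \<subseteq> N"
      unfolding eventually_ae_filter by simp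
    then obtain N where "N \<in> null_sets lebesgue" "{x \<in> S. \<not> P x} \<subseteq> N" ..
    then show "{x \<in> S. \<not> P x} \<in> null_sets lebesgue"
      using null_sets_completion_subset by blast
  next
    assume "{x \<in> S. \<not> P x} \<in> null_sets lebesgue"
    then show "AE x in lebesgue. x \<in> S \<longrightarrow> P x" unfolding eventually_ae_filter by auto
  qed
  finally show ?thesis by (simp add: negligible_iff_null_sets)
qed

abbreviation I1 :: "real measure" where "I1 \<equiv> lebesgue_on {-1<..<1}"

lemma AE_I1_mem: "AE x in I1. x \<in> {-1<..<1}"
  by (rule AE_I2) (simp add: space_restrict_space)

lemma finite_measure_I1: "finite_measure I1"
  by (intro finite_measure_lebesgue_on) simp

lemma pair_sigma_finite_I1: "pair_sigma_finite I1 I1"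
proof -
  interpret finite_measure I1 by (rule finite_measure_I1)
  show ?thesis by unfold_locales
qed

lemma borel_measurable_I1: "f \<in> borel_measurable borel \<Longrightarrow> f \<in> borel_measurable I1"
  by (intro measurable_restrict_space1 measurable_completion) simp

lemma continuous_on_measurable_I1:
  "continuous_on {-1<..<1} f \<Longrightarrow> f \<in> borel_measurable I1" for f :: "real \<Rightarrow> real"
  by (rule continuous_imp_measurable_on_sets_lebesgue) auto

lemma measurable_I1_pair_fst_snd:
  shows "fst \<in> borel_measurable (I1 \<Otimes>\<^sub>M I1)" "snd \<in> borel_measurable (I1 \<Otimes>\<^sub>M I1)"
proof -
  have "(\<lambda>x. x) \<in> borel_measurable I1" by (rule borel_measurable_I1) simp
  from measurable_compose[OF measurable_fst this] measurable_compose[OF measurable_snd this]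
  show "fst \<in> borel_measurable (I1 \<Otimes>\<^sub>M I1)" "snd \<in> borel_measurable (I1 \<Otimes>\<^sub>M I1)" by blast+
qed

lemma integrable_I1_bounded_mult:
  fixes f g :: "real \<Rightarrow> real"
  assumes "integrable I1 f" "g \<in> borel_measurable I1" "\<And>x. x \<in> {-1<..<1} \<Longrightarrow> \<bar>g x\<bar> \<le> B"
  shows "integrable I1 (\<lambda>x. f x * g x)"
proof (rule Bochner_Integration.integrable_bound)
  show "integrable I1 (\<lambda>x. B * f x)" using assms by simp
  show "AE x in I1. norm (f x * g x) \<le> norm (B * f x)"
  proof (rule AE_I2)
    fix x assume "x \<in> space I1"
    then have "\<bar>g x\<bar> \<le> B" using assms(3) by (simp add: space_restrict_space)
    then have "\<bar>g x\<bar> * \<bar>f x\<bar> \<le> \<bar>B\<bar> * \<bar>f x\<bar>" by (intro mult_right_mono) auto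
    then show "norm (f x * g x) \<le> norm (B * f x)"
      by (simp add: abs_mult mult.commute)
  qed
qed (use assms in measurable)

lemma integrable_I1_bounded:
  fixes g :: "real \<Rightarrow> real"
  assumes "g \<in> borel_measurable I1" "\<And>x. x \<in> {-1<..<1} \<Longrightarrow> \<bar>g x\<bar> \<le> B"
  shows "integrable I1 g"
proof -
  interpret finite_measure I1 by (rule finite_measure_I1)
  show ?thesis using integrable_I1_bounded_mult[of "\<lambda>_. 1" g B] assms by simp
qed

lemma poly_bounded_I1: "\<exists>B. \<forall>x\<in>{-1..1}. \<bar>poly p x\<bar> \<le> B" for p :: "real poly"
proof -
  have "bounded (poly p ` {-1..1})"
    by (intro compact_imp_bounded compact_continuous_image continuous_intros) auto
  then show ?thesis by (auto simp: bounded_iff)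
qed

lemma integrable_I1_mult_poly:
  fixes p :: "real poly"
  assumes "integrable I1 f"
  shows "integrable I1 (\<lambda>x. f x * poly p x)"
proof -
  obtain B where "\<forall>x\<in>{-1..1}. \<bar>poly p x\<bar> \<le> B" using poly_bounded_I1 by blast
  then show ?thesis
    by (intro integrable_I1_bounded_mult[OF assms, of _ B] borel_measurable_I1
        borel_measurable_continuous_onI continuous_intros) auto
qed

lemma integrable_I1_poly: "integrable I1 (poly p)" for p :: "real poly"
proof -
  obtain B where B: "\<forall>x\<in>{-1..1}. \<bar>poly p x\<bar> \<le> B" using poly_bounded_I1 by blast
  show ?thesis
    by (rule integrable_I1_bounded[of _ B])
       (use B in \<open>auto intro!: borel_measurable_I1 borel_measurable_continuous_onI
           continuous_intros\<close>)
qed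

definition primitive :: "(real \<Rightarrow> real) \<Rightarrow> real \<Rightarrow> real" where
  "primitive g x = (LINT t|I1. indicator {..<x} t * g t)"

text \<open>
  Fubini's theorem on the triangle \<open>t < x\<close>: integration by parts for a primitive that is only
  absolutely continuous, without derivatives.
\<close>

lemma integral_primitive_mult:
  assumes g: "integrable I1 g" and v: "integrable I1 v"
  shows "(LINT x|I1. primitive g x * v x) = (LINT t|I1. g t * (LINT x|I1. indicator {t<..} x
      * v x))"
proof -
  interpret P: pair_sigma_finite I1 I1 by (rule pair_sigma_finite_I1)
  note [measurable] = measurable_I1_pair_fst_snd
  have [measurable]: "g \<in> borel_measurable I1" "v \<in> borel_measurable I1" using g v by auto
  have [measurable]: "(\<lambda>z. if snd z < fst z then 1 else 0 :: real) \<in> borel_measurable (I1 \<Otimes>\<^sub>M I1)"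
    by measurable
  have ind: "indicator {..<x} t = (if t < x then 1 else 0 :: real)"
    "indicator {t<..} x = (if t < x then 1 else 0 :: real)" for x t :: real
    by (auto simp: indicator_def)
  let ?f = "\<lambda>x t. (if t < x then 1 else 0) * g t * v x"
  have int: "integrable (I1 \<Otimes>\<^sub>M I1) (case_prod ?f)"
  proof (rule Bochner_Integration.integrable_bound)
    show "integrable (I1 \<Otimes>\<^sub>M I1) (\<lambda>(x, t). g t * v x)"
      by (rule P.Fubini_integrable) (use g v in \<open>auto simp: abs_mult\<close>)
    show "AE z in I1 \<Otimes>\<^sub>M I1. norm (case_prod ?f z) \<le> norm (case z of (x, t) \<Rightarrow> g t * v x)"
      by (rule AE_I2) (auto simp: split_beta)
  qed (simp add: split_beta')
  have "(LINT x|I1. primitive g x * v x) = (LINT x|I1. LINT t|I1. ?f x t)"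
    by (simp add: primitive_def ind)
  also have "\<dots> = (LINT t|I1. LINT x|I1. ?f x t)"
    by (rule P.Fubini_integral[OF int, symmetric])
  also have "\<dots> = (LINT t|I1. g t * (LINT x|I1. indicator {t<..} x * v x))"
  proof (intro Bochner_Integration.integral_cong refl)
    fix t
    have "(\<lambda>x. ?f x t) = (\<lambda>x. g t * (indicator {t<..} x * v x))" by (auto simp: ind)
    then show "(LINT x|I1. ?f x t) = g t * (LINT x|I1. indicator {t<..} x * v x)"
      by (simp only: Bochner_Integration.integral_mult_right_zero)
  qed
  finally show ?thesis .
qed

lemma primitive_eq_integral:
  assumes g: "integrable I1 g" and x: "x \<in> {-1..1}"
  shows "primitive g x = integral {-1..x} (\<lambda>t. if t \<in> {-1<..<1} then g t else 0)"
    and "(\<lambda>t. if t \<in> {-1<..<1} then g t else 0) integrable_on {-1..1}"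
proof -
  have "integrable I1 (\<lambda>t. g t * indicator {..<x} t)"
    by (rule integrable_I1_bounded_mult[OF g, where B = 1])
       (auto intro!: borel_measurable_I1 simp: indicator_def)
  then have "integrable I1 (\<lambda>t. indicator {..<x} t * g t)" by (simp add: mult.commute)
  then have "primitive g x = integral {-1<..<1} (\<lambda>t. indicator {..<x} t * g t)"
    unfolding primitive_def by (rule lebesgue_integral_eq_integral) simp
  also have "\<dots> = integral UNIV (\<lambda>t. if t \<in> {-1<..<1} then indicator {..<x} t * g t else 0)"
    by (simp only: integral_restrict_UNIV)
  also have "\<dots> = integral UNIV (\<lambda>t. if t \<in> {-1..x} then (if t \<in> {-1<..<1} then g t else 0) else 0)"
    by (rule integral_spike[of "{x}"]) (use x in auto)
  also have "\<dots> = integral {-1..x} (\<lambda>t. if t \<in> {-1<..<1} then g t else 0)"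
    by (simp only: integral_restrict_UNIV)
  finally show "primitive g x = integral {-1..x} (\<lambda>t. if t \<in> {-1<..<1} then g t else 0)" .
  have "g integrable_on {-1<..<1}" using g by (rule integrable_on_lebesgue_on) simp
  then show "(\<lambda>t. if t \<in> {-1<..<1} then g t else 0) integrable_on {-1..1}"
    by (subst integrable_restrict_Int) (simp add: Int_absorb2
        greaterThanLessThan_subseteq_atLeastAtMost_iff)
qed

lemma continuous_on_primitive:
  assumes "integrable I1 g"
  shows "continuous_on {-1..1} (primitive g)"
proof -
  have "continuous_on {-1..1} (\<lambda>x. integral {-1..x} (\<lambda>t. if t \<in> {-1<..<1} then g t else 0))"
    by (rule indefinite_integral_continuous_1) (rule primitive_eq_integral(2)[OF assms, of 0], simp)
  then show ?thesis
    by (rule continuous_on_eq) (simp add: primitive_eq_integral[OF assms])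
qed

lemma AE_DERIV_primitive:
  assumes g: "integrable I1 g"
  shows "AE x in I1. (primitive g has_real_derivative g x) (at x)"
proof -
  let ?g = "\<lambda>t. if t \<in> {-1<..<1} then g t else 0"
  have "negligible {x \<in> {-1<..<1}. \<not> ((\<lambda>x. integral {-1..x} ?g) has_real_derivative ?g x) (at x)}"
    by (rule lebesgue_differentiation_real) (rule primitive_eq_integral(2)[OF g, of 0], simp)
  then have "AE x in I1. ((\<lambda>x. integral {-1..x} ?g) has_real_derivative ?g x) (at x)"
    by (subst AE_lebesgue_on_iff_negligible) simp_all
  moreover have "AE x in I1. x \<in> {-1<..<1}" by (rule AE_I1_mem)
  ultimately show ?thesis
  proof eventually_elim
    case (elim x)
    show ?case
      by (rule has_field_derivative_transform_within_open[of "\<lambda>x. integral {-1..x} ?g" _ _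
          "{-1<..<1}"])
         (use elim in \<open>auto simp: primitive_eq_integral[OF g]\<close>)
  qed
qed

lemma AE_zero_imp_zero_I1:
  fixes h :: "real \<Rightarrow> real"
  assumes "AE x in I1. h x = 0" "continuous_on {-1<..<1} h" "x \<in> {-1<..<1}"
  shows "h x = 0"
proof -
  have "negligible {x \<in> {-1<..<1}. h x \<noteq> 0}"
    using assms(1) by (subst (asm) AE_lebesgue_on_iff_negligible) simp_all
  moreover have "open ({-1<..<1} \<inter> h -` (- {0}))"
    by (rule continuous_open_preimage[OF assms(2)]) auto
  moreover have "{-1<..<1} \<inter> h -` (- {0}) = {x \<in> {-1<..<1}. h x \<noteq> 0}" by auto
  ultimately have "{x \<in> {-1<..<1}. h x \<noteq> 0} = {}" using open_not_negligible by metis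
  then show ?thesis using assms(3) by auto
qed

lemma poly_antiderivative: "\<exists>P. pderiv P = (p :: real poly)"
proof -
  let ?c = "\<lambda>i. monom (coeff p i / real (Suc i)) (Suc i)"
  have "pderiv (\<Sum>i\<le>n. ?c i) = (\<Sum>i\<le>n. pderiv (?c i))" for n
    by (induction n) (simp_all add: pderiv_add)
  then have "pderiv (\<Sum>i\<le>degree p. ?c i) = (\<Sum>i\<le>degree p. monom (coeff p i) i)"
    by (simp add: pderiv_monom del: of_nat_Suc)
  then show ?thesis by (metis poly_as_sum_of_monoms)
qed

text \<open>
  A primitive \<open>F\<close> of \<open>f\<close> again has vanishing moments and is continuous, so it can be approximated
  uniformly by polynomials. Hence \<open>F\<close> is orthogonal to itself and vanishes, and \<open>f\<close> is almost
  everywhere its derivative.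
\<close>

lemma AE_zero_if_moments_zero:
  assumes f: "integrable I1 f"
    and mom: "\<And>p :: real poly. (LINT x|I1. f x * poly p x) = 0"
  shows "AE x in I1. f x = 0"
proof -
  let ?F = "primitive f"
  have F_cont: "continuous_on {-1..1} ?F" by (rule continuous_on_primitive[OF f])
  then have F_meas: "?F \<in> borel_measurable I1"
    by (intro continuous_on_measurable_I1) (rule continuous_on_subset, auto)
  have "bounded (?F ` {-1..1})"
    by (intro compact_imp_bounded compact_continuous_image F_cont) auto
  then have "\<exists>M. \<forall>x\<in>{-1..1}. \<bar>?F x\<bar> \<le> M" by (simp add: bounded_iff)
  then obtain M where "\<forall>x\<in>{-1..1}. \<bar>?F x\<bar> \<le> M" ..
  then have M: "\<bar>?F x\<bar> \<le> M" if "x \<in> {-1..1}" for x using that by blast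
  have F_int: "integrable I1 ?F" by (rule integrable_I1_bounded[OF F_meas, of M]) (use M in auto)
  have F_mom: "(LINT x|I1. ?F x * poly p x) = 0" for p :: "real poly"
  proof -
    obtain P where P: "pderiv P = p" using poly_antiderivative by blast
    have int_p: "integrable I1 (poly p)" by (rule integrable_I1_poly)
    have tail: "(LINT x|I1. indicator {t<..} x * poly p x) = poly P 1 - poly P t"
        if t: "t \<in> {-1<..<1}" for t
    proof -
      have "(LINT x|I1. indicator {t<..} x * poly p x) = integral {-1<..<1} (\<lambda>x. indicator {t<..} x
          * poly p x)"
      proof (rule lebesgue_integral_eq_integral)
        have "integrable I1 (\<lambda>x. poly p x * indicator {t<..} x)"
          by (rule integrable_I1_bounded_mult[OF int_p, where B = 1])
             (auto intro!: borel_measurable_I1 simp: indicator_def)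
        then show "integrable I1 (\<lambda>x. indicator {t<..} x * poly p x)" by (simp add: mult.commute)
      qed simp
      also have "\<dots> = integral UNIV (\<lambda>x. if x \<in> {-1<..<1} then indicator {t<..} x * poly p x else 0)"
        by (simp only: integral_restrict_UNIV)
      also have "\<dots> = integral UNIV (\<lambda>x. if x \<in> {t..1} then poly p x else 0)"
        by (rule integral_spike[of "{t, 1}"]) (use t in auto)
      also have "\<dots> = integral {t..1} (poly p)" by (simp only: integral_restrict_UNIV)
      also have "\<dots> = poly P 1 - poly P t"
        by (intro integral_unique fundamental_theorem_of_calculus)
           (use t P in \<open>auto intro!: has_field_derivative_at_within poly_DERIV
              simp flip: has_real_derivative_iff_has_vector_derivative\<close>)
      finally show ?thesis .
    qed
    have "(LINT x|I1. ?F x * poly p x) = (LINT t|I1. f t * (poly P 1 - poly P t))"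
      unfolding integral_primitive_mult[OF f int_p]
      by (intro Bochner_Integration.integral_cong refl) (simp add: tail space_restrict_space)
    also have "\<dots> = (LINT t|I1. f t * poly ([:poly P 1:] - P) t)" by simp
    also have "\<dots> = 0" by (rule mom)
    finally show ?thesis .
  qed
  have FF_int: "integrable I1 (\<lambda>x. ?F x * ?F x)"
    by (rule integrable_I1_bounded_mult[OF F_int F_meas, of M]) (use M in auto)
  have "(LINT x|I1. ?F x * ?F x) \<le> 0"
  proof (rule field_le_epsilon)
    fix e :: real assume "e > 0"
    define C where "C = (LINT x|I1. \<bar>?F x\<bar>) + 1"
    have "C > 0" unfolding C_def by (simp add: add_nonneg_pos)
    with \<open>e > 0\<close> have "e / C > 0" by simp
    then obtain p where p: "\<And>x. x \<in> {-1..1} \<Longrightarrow> \<bar>?F x - poly p x\<bar> < e / C"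
      using weierstrass_real_poly[OF F_cont] by blast
    note int_Fp = integrable_I1_mult_poly[OF F_int, of p]
    have "(LINT x|I1. ?F x * ?F x) = (LINT x|I1. ?F x * ?F x) - (LINT x|I1. ?F x * poly p x)"
      by (simp add: F_mom)
    also have "\<dots> = (LINT x|I1. ?F x * ?F x - ?F x * poly p x)"
      by (rule Bochner_Integration.integral_diff[symmetric, OF FF_int int_Fp])
    also have "\<dots> \<le> (LINT x|I1. e / C * \<bar>?F x\<bar>)"
    proof (rule integral_mono)
      fix x assume "x \<in> space I1"
      then have x: "x \<in> {-1..1}" by (auto simp: space_restrict_space)
      have "?F x * ?F x - ?F x * poly p x \<le> \<bar>?F x\<bar> * \<bar>?F x - poly p x\<bar>"
        by (simp add: abs_mult[symmetric] right_diff_distrib)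
      also have "\<dots> \<le> \<bar>?F x\<bar> * (e / C)" using p[OF x] by (intro mult_left_mono) auto
      finally show "?F x * ?F x - ?F x * poly p x \<le> e / C * \<bar>?F x\<bar>" by (simp add: mult.commute)
    qed (use F_int FF_int int_Fp in \<open>auto intro!: Bochner_Integration.integrable_diff\<close>)
    also have "\<dots> = e / C * (LINT x|I1. \<bar>?F x\<bar>)" by simp
    also have "\<dots> \<le> e / C * C" using \<open>e / C > 0\<close> by (intro mult_left_mono) (auto simp: C_def)
    also have "\<dots> = e" using \<open>C > 0\<close> by simp
    finally show "(LINT x|I1. ?F x * ?F x) \<le> 0 + e" by simp
  qed
  then have "(LINT x|I1. ?F x * ?F x) = 0"
    by (intro antisym Bochner_Integration.integral_nonneg) auto
  then have "AE x in I1. ?F x * ?F x = 0"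
    by (subst (asm) integral_nonneg_eq_0_iff_AE[OF FF_int]) auto
  then have "AE x in I1. ?F x = 0" by simp
  then have F0: "?F x = 0" if "x \<in> {-1<..<1}" for x
    by (rule AE_zero_imp_zero_I1) (use that F_cont in \<open>auto elim: continuous_on_subset\<close>)
  have "AE x in I1. x \<in> {-1<..<1}" by (rule AE_I1_mem)
  with AE_DERIV_primitive[OF f] show ?thesis
  proof eventually_elim
    case (elim x)
    have "((\<lambda>_. 0) has_real_derivative f x) (at x)"
      by (rule has_field_derivative_transform_within_open[OF elim(1), of "{-1<..<1}"])
         (use elim F0 in auto)
    then show ?case using DERIV_const DERIV_unique by blast
  qed
qed

section \<open>The potential of the weight under the power kernel\<close>

abbreviation om :: "real \<Rightarrow> real \<Rightarrow> real" where
  "om t \<equiv> omega t (-1) 1"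

lemma om_alt: "om s y = (1 + y) powr s * (1 - y) powr s"
  by (simp add: omega_def add.commute)

lemma om_nonneg: "omega s a b y \<ge> 0"
  by (simp add: omega_def)

lemma om_borel [measurable]: "omega s a b \<in> borel_measurable borel"
  unfolding omega_def by measurable

text \<open>
  Bookkeeping of exponents for \<open>moebius_pullback\<close>: the denominator \<open>q\<close> occurs to the total power
  \<open>-(1 - 2s) - 2(s - 1) - 2 = -1\<close>.
\<close>

lemma moebius_exponents:
  fixes Z p q E F A B s :: real
  assumes "Z > 0" "q > 0" "E > 0" "F > 0" "A > 0" "B > 0"
  shows "(Z * (E * F) / q) powr (1 - 2 * s) * ((A * E / q) powr (s - 1) * (B * F / q) powr (s - 1))
      * ((E * F) / q\<^sup>2)
     = (E * F) powr (1 - s) * (Z powr (1 - 2 * s) * (A powr (s - 1) * B powr (s - 1)) / q)"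
proof -
  define z e f a b r where "z = ln Z" "e = ln E" "f = ln F" "a = ln A" "b = ln B" "r = ln q"
  then have *: "Z = exp z" "E = exp e" "F = exp f" "A = exp a" "B = exp b" "q = exp r"
    using assms by simp_all
  have "q\<^sup>2 = exp (2 * r)" by (simp add: * power2_eq_square flip: exp_add)
  then show ?thesis
    by (simp add: * powr_def flip: exp_add exp_diff) (simp add: algebra_simps)
qed

text \<open>
  The substitution \<open>y = g z\<close> is the Moebius map of the interval onto itself that sends \<open>0\<close> to \<open>x\<close>.
      It
  moves the singularity of the kernel to the origin, and the dependence on \<open>x\<close> is left in the
  factor \<open>1 / (1 + x z)\<close> and a constant.
\<close>

lemma moebius_pullback:
  fixes x z s :: real
  assumes x: "x \<in> {-1<..<1}" and z: "z \<in> {-1..1}"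
  defines "g \<equiv> \<lambda>z. (z + x) / (1 + x * z)"
  shows "\<bar>x - g z\<bar> powr (1 - 2 * s) * om (s - 1) (g z) * ((1 - x\<^sup>2) / (1 + x * z)\<^sup>2)
     = (1 - x\<^sup>2) powr (1 - s) * (\<bar>z\<bar> powr (1 - 2 * s) * om (s - 1) z / (1 + x * z))"
proof -
  have "\<bar>x * z\<bar> \<le> \<bar>x\<bar> * 1" unfolding abs_mult using z by (intro mult_left_mono) auto
  also have "\<dots> < 1" using x by auto
  finally have "\<bar>x * z\<bar> < 1" .
  then have q: "1 + x * z > 0" by linarith
  have e: "1 - x\<^sup>2 = (1 + x) * (1 - x)" by (simp add: power2_eq_square algebra_simps)
  have pos: "1 + x > 0" "1 - x > 0" using x by auto
  have g1: "1 + g z = (1 + z) * (1 + x) / (1 + x * z)" "1 - g z = (1 - z) * (1 - x) / (1 + x * z)"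
    "x - g z = - (z * ((1 + x) * (1 - x)) / (1 + x * z))"
    using q by (simp_all add: g_def field_simps)
  have absg: "\<bar>x - g z\<bar> = \<bar>z\<bar> * ((1 + x) * (1 - x)) / (1 + x * z)"
    unfolding g1 using q pos by (simp add: abs_mult)
  show ?thesis
  proof (cases "z = 0 \<or> z = 1 \<or> z = -1")
    case True
    then show ?thesis unfolding om_alt absg g1 by auto
  next
    case False
    then have "\<bar>z\<bar> > 0" "1 + z > 0" "1 - z > 0" using z by auto
    then show ?thesis unfolding om_alt absg g1(1,2) e
      using moebius_exponents[OF _ q pos, of "\<bar>z\<bar>" "1 + z" "1 - z" s] by (simp add: mult_ac)
  qed
qed

text \<open>
  The second substitution, \<open>v = z\<^sup>2 (1 - x\<^sup>2) / (1 - (x z)\<^sup>2)\<close>, is a Moebius map in \<open>z\<^sup>2\<close>. It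
  absorbs the even part \<open>1 / (1 - (x z)\<^sup>2)\<close> of the factor left by \<open>moebius_pullback\<close>.
\<close>

lemma beta_pullback:
  fixes x z s :: real
  assumes x: "x \<in> {-1<..<1}" and z: "z \<in> {0..1}"
  defines "v \<equiv> \<lambda>z. z\<^sup>2 * (1 - x\<^sup>2) / (1 - (x * z)\<^sup>2)"
  shows "v z powr (- s) * (1 - v z) powr (s - 1) * ((1 - x\<^sup>2) * (2 * z) / (1 - (x * z)\<^sup>2)\<^sup>2)
     = (1 - x\<^sup>2) powr (1 - s) * (z powr (1 - 2 * s) * om (s - 1) z * (2 / (1 - (x * z)\<^sup>2)))"
proof -
  have "x\<^sup>2 < 1" using x by (auto simp: abs_square_less_1)
  moreover have "z\<^sup>2 \<le> 1" using z by (simp add: abs_square_le_1)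
  ultimately have "x\<^sup>2 * z\<^sup>2 < 1"
    using mult_left_mono[of "z\<^sup>2" 1 "x\<^sup>2"] by simp
  then have p: "1 - (x * z)\<^sup>2 > 0" by (simp add: power_mult_distrib)
  have D: "1 - x\<^sup>2 > 0" using \<open>x\<^sup>2 < 1\<close> by simp
  have v1: "1 - v z = (1 + z) * (1 - z) / (1 - (x * z)\<^sup>2)"
    using p by (simp add: v_def field_simps power2_eq_square)
  show ?thesis
  proof (cases "z = 0 \<or> z = 1")
    case True
    then show ?thesis unfolding om_alt v1 by auto
  next
    case False
    then have zz: "z > 0" "1 + z > 0" "1 - z > 0" using z by auto
    define c d a b r where "c = ln z" "d = ln (1 - x\<^sup>2)" "a = ln (1 + z)" "b = ln (1 - z)" "r
        = ln (1 - (x * z)\<^sup>2)"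
    then have *: "z = exp c" "1 - x\<^sup>2 = exp d" "1 + z = exp a" "1 - z = exp b" "1 - (x * z)\<^sup>2
        = exp r"
      using zz D p by simp_all
    have sq: "z\<^sup>2 = exp (2 * c)" "(exp r)\<^sup>2 = exp (2 * r)"
      by (simp_all add: * power2_eq_square flip: exp_add)
    have "v z powr (- s) * (1 - v z) powr (s - 1) * ((1 - x\<^sup>2) * (2 * z) / (1 - (x * z)\<^sup>2)\<^sup>2)
      = (exp (2 * c) * exp d / exp r) powr (- s) * (exp a * exp b / exp r) powr (s - 1) * (exp d
          * (2 * exp c) / exp (2 * r))"
      unfolding v1 unfolding v_def *(2-5) sq *(1)[symmetric] by simp
    also have "\<dots> = exp d powr (1 - s) * (exp c powr (1 - 2 * s) * (exp a powr (s - 1)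
        * exp b powr (s - 1)) * (2 / exp r))"
    proof -
      have 1: "(exp (2 * c) * exp d / exp r) powr (- s) = exp (- s * (2 * c + d - r))"
        "(exp a * exp b / exp r) powr (s - 1) = exp ((s - 1) * (a + b - r))"
        by (simp_all add: powr_def flip: exp_add exp_diff)
      have 2: "exp d * (2 * exp c) / exp (2 * r) = 2 * exp (d + c - 2 * r)" "2 / exp r
          = 2 * exp (- r)"
        by (simp_all add: exp_add exp_diff exp_minus field_simps)
      have 3: "exp u powr v = exp (v * u)" for u v :: real by (simp add: powr_def)
      have "- s * (2 * c + d - r) + (s - 1) * (a + b - r) + (d + c - 2 * r)
          = (1 - s) * d + ((1 - 2 * s) * c + ((s - 1) * a + (s - 1) * b) - r)"
        by (simp add: algebra_simps)
      then have "exp (- s * (2 * c + d - r)) * exp ((s - 1) * (a + b - r)) * exp (d + c - 2 * r)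
          = exp ((1 - s) * d) * (exp ((1 - 2 * s) * c) * (exp ((s - 1) * a) * exp ((s - 1) * b))
              * exp (- r))"
        by (simp only: exp_add[symmetric] diff_conv_add_uminus)
      then show ?thesis unfolding 1 2 3 by (simp only: mult_ac)
    qed
    also have "\<dots> = (1 - x\<^sup>2) powr (1 - s) * (z powr (1 - 2 * s) * om (s - 1) z * (2 / (1 - (x
        * z)\<^sup>2)))"
      unfolding om_alt *(2-5) *(1)[symmetric] by simp
    finally show ?thesis .
  qed
qed

lemma nn_integral_Beta:
  assumes "a > 0" "b > 0"
  shows "(\<integral>\<^sup>+t. ennreal (t powr (a - 1) * (1 - t) powr (b - 1) * indicator {0..1} t) \<partial>lborel)
      = ennreal (Beta a b)"
proof (rule nn_integral_has_integral_lborel)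
  have "((\<lambda>t. if t \<in> {0..1} then t powr (a - 1) * (1 - t) powr (b - 1) else 0)
      has_integral Beta a b) UNIV"
    using has_integral_Beta_real[OF assms] by (simp only: has_integral_restrict_UNIV)
  then show "((\<lambda>t. t powr (a - 1) * (1 - t) powr (b - 1) * indicator {0..1} t)
      has_integral Beta a b) UNIV"
    by (rule has_integral_eq[rotated]) auto
qed auto

text \<open>
  The weight \<open>\<omega>\<^bsup>s-1\<^esup>\<close> is the equilibrium density of the interval for this kernel. All integrands
  are nonnegative, so both substitutions are made without any discussion of convergence.
\<close>

lemma riesz_potential_nn_integral:
  assumes s: "0 < s" "s < 1" and x: "x \<in> {-1<..<1}"
  shows "(\<integral>\<^sup>+y. ennreal (\<bar>x - y\<bar> powr (1 - 2 * s) * om (s - 1) y * indicator {-1..1} y) \<partial>lborel)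
     = ennreal (Beta (1 - s) s)"
proof -
  have x2: "x\<^sup>2 < 1" using x by (auto simp: abs_square_less_1)
  define h where "h z = (1 - x\<^sup>2) powr (1 - s) * (\<bar>z\<bar> powr (1 - 2 * s) * om (s - 1) z / (1 + x
      * z))" for z
  have qpos: "1 + x * z > 0" if "z \<in> {-1..1}" for z
  proof -
    have "\<bar>x * z\<bar> \<le> \<bar>x\<bar> * 1" unfolding abs_mult using that by (intro mult_left_mono) auto
    also have "\<dots> < 1" using x by auto
    finally show ?thesis by linarith
  qed
  have h_nonneg: "h z \<ge> 0" if "z \<in> {-1..1}" for z
    unfolding h_def using qpos[OF that] om_nonneg by (intro mult_nonneg_nonneg divide_nonneg_pos)
        auto
  have h_meas [measurable]: "h \<in> borel_measurable borel" unfolding h_def by measurable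
  let ?g = "\<lambda>z. (z + x) / (1 + x * z)"
  have gends: "?g (-1) = -1" "?g 1 = 1" using x by (auto simp: field_simps)
  have "(\<integral>\<^sup>+y. ennreal (\<bar>x - y\<bar> powr (1 - 2 * s) * om (s - 1) y * indicator {?g (-1)..?g 1} y)
      \<partial>lborel)
     = (\<integral>\<^sup>+z. ennreal (\<bar>x - ?g z\<bar> powr (1 - 2 * s) * om (s - 1) (?g z) * ((1 - x\<^sup>2) / (1 + x * z)\<^sup>2)
         * indicator {-1..1} z) \<partial>lborel)"
  proof (rule nn_integral_substitution)
    show "set_borel_measurable borel {?g (-1)..?g 1} (\<lambda>y. \<bar>x - y\<bar> powr (1 - 2 * s) * om (s - 1) y)"
      unfolding set_borel_measurable_def by measurable
    fix z :: real assume z: "z \<in> {-1..1}"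
    show "(?g has_real_derivative (1 - x\<^sup>2) / (1 + x * z)\<^sup>2) (at z)"
      using qpos[OF z] by (auto intro!: derivative_eq_intros simp: field_simps power2_eq_square)
    show "(1 - x\<^sup>2) / (1 + x * z)\<^sup>2 \<ge> 0" using x2 by simp
  next
    show "continuous_on {-1..1} (\<lambda>z. (1 - x\<^sup>2) / (1 + x * z)\<^sup>2)"
      using qpos by (intro continuous_intros) force
  qed simp
  also have "\<dots> = (\<integral>\<^sup>+z. ennreal (h z) * indicator {-1..1} z \<partial>lborel)"
  proof (intro nn_integral_cong)
    fix z :: real
    show "ennreal (\<bar>x - ?g z\<bar> powr (1 - 2 * s) * om (s - 1) (?g z) * ((1 - x\<^sup>2) / (1 + x * z)\<^sup>2)
        * indicator {-1..1} z)
        = ennreal (h z) * indicator {-1..1} z"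
      using moebius_pullback[OF x, of z s] by (cases "z \<in> {-1..1}") (simp_all add: h_def)
  qed
  \<comment> \<open>Folding the interval at the origin leaves the even part of \<open>1 / (1 + x z)\<close>.\<close>
  also have "\<dots> = (\<integral>\<^sup>+z. ennreal (h z) * indicator {-1..0} z + ennreal (h z) * indicator {0..1} z
      \<partial>lborel)"
  proof (rule nn_integral_cong_AE)
    show "AE z in lborel. ennreal (h z) * indicator {-1..1} z = ennreal (h z) * indicator {-1..0} z
        + ennreal (h z) * indicator {0..1} z"
      using AE_lborel_singleton[of 0] by eventually_elim (auto simp: indicator_def)
  qed
  also have "\<dots> = (\<integral>\<^sup>+z. ennreal (h z) * indicator {-1..0} z \<partial>lborel) + (\<integral>\<^sup>+z. ennreal (h z)
      * indicator {0..1} z \<partial>lborel)"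
    by (rule nn_integral_add) auto
  also have "(\<integral>\<^sup>+z. ennreal (h z) * indicator {-1..0} z \<partial>lborel) = (\<integral>\<^sup>+z. ennreal (h (-z))
      * indicator {0..1} z \<partial>lborel)"
    by (subst nn_integral_real_affine[of _ "-1" 0]) (auto intro!: nn_integral_cong simp:
        indicator_def)
  also have "\<dots> + (\<integral>\<^sup>+z. ennreal (h z) * indicator {0..1} z \<partial>lborel) = (\<integral>\<^sup>+z. ennreal (h (-z))
      * indicator {0..1} z + ennreal (h z) * indicator {0..1} z \<partial>lborel)"
    by (rule nn_integral_add[symmetric]) auto
  also have "\<dots> = (\<integral>\<^sup>+z. ennreal (((z\<^sup>2 * (1 - x\<^sup>2) / (1 - (x * z)\<^sup>2)) powr (- s) * (1 - z\<^sup>2 * (1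
      - x\<^sup>2) / (1 - (x * z)\<^sup>2)) powr (s - 1)
       * ((1 - x\<^sup>2) * (2 * z) / (1 - (x * z)\<^sup>2)\<^sup>2)) * indicator {0..1} z) \<partial>lborel)"
  proof (intro nn_integral_cong)
    fix z :: real
    show "ennreal (h (-z)) * indicator {0..1} z + ennreal (h z) * indicator {0..1} z =
      ennreal (((z\<^sup>2 * (1 - x\<^sup>2) / (1 - (x * z)\<^sup>2)) powr (- s) * (1 - z\<^sup>2 * (1 - x\<^sup>2) / (1 - (x
          * z)\<^sup>2)) powr (s - 1)
       * ((1 - x\<^sup>2) * (2 * z) / (1 - (x * z)\<^sup>2)\<^sup>2)) * indicator {0..1} z)"
    proof (cases "z \<in> {0..1}")
      case True
      have q: "1 + x * z > 0" "1 - x * z > 0" using qpos[of z] qpos[of "-z"] True by auto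
      have pf: "1 / (1 + x * z) + 1 / (1 - x * z) = 2 / (1 - (x * z)\<^sup>2)"
        using q by (simp add: field_simps power2_eq_square)
      have "h (-z) + h z = (1 - x\<^sup>2) powr (1 - s) * (z powr (1 - 2 * s) * om (s - 1) z * (2 / (1
          - (x * z)\<^sup>2)))"
      proof -
        define K c where "K = (1 - x\<^sup>2) powr (1 - s)" and "c = z powr (1 - 2 * s) * om (s - 1) z"
        have "om (s - 1) (- z) = om (s - 1) z" by (simp add: om_alt mult.commute)
        then have "h (-z) = K * (c / (1 - x * z))" "h z = K * (c / (1 + x * z))"
          using True by (simp_all add: h_def K_def c_def)
        then have "h (-z) + h z = K * (c * (1 / (1 + x * z) + 1 / (1 - x * z)))"
          by (simp add: distrib_left add.commute)
        then show ?thesis by (simp only: pf K_def c_def)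
      qed
      then show ?thesis
        using beta_pullback[OF x True, of s] True h_nonneg[of z] h_nonneg[of "-z"]
        by (simp flip: ennreal_plus)
    qed simp
  qed
  also have "\<dots> = (\<integral>\<^sup>+t. ennreal ((t powr (- s) * (1 - t) powr (s - 1)) * indicator {0\<^sup>2 * (1
      - x\<^sup>2) / (1 - (x * 0)\<^sup>2)..1\<^sup>2 * (1 - x\<^sup>2) / (1 - (x * 1)\<^sup>2)} t) \<partial>lborel)"
  proof (rule nn_integral_substitution[symmetric])
    have pp: "1 - (x * z)\<^sup>2 > 0" if "z \<in> {0..1}" for z
    proof -
      have "1 - (x * z)\<^sup>2 = (1 + x * z) * (1 + x * (-z))"
          by (simp add: power2_eq_square algebra_simps)
      then show ?thesis using qpos[of z] qpos[of "-z"] that by simp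
    qed
    show "set_borel_measurable borel {0\<^sup>2 * (1 - x\<^sup>2) / (1 - (x * 0)\<^sup>2)..1\<^sup>2 * (1 - x\<^sup>2) / (1 - (x
        * 1)\<^sup>2)} (\<lambda>t. t powr (- s) * (1 - t) powr (s - 1))"
      unfolding set_borel_measurable_def by measurable
    fix z :: real assume z: "z \<in> {0..1}"
    show "((\<lambda>z. z\<^sup>2 * (1 - x\<^sup>2) / (1 - (x * z)\<^sup>2)) has_real_derivative (1 - x\<^sup>2) * (2 * z) / (1 - (x
        * z)\<^sup>2)\<^sup>2) (at z)"
      using pp[OF z] by (auto intro!: derivative_eq_intros simp: field_simps power2_eq_square)
    show "(1 - x\<^sup>2) * (2 * z) / (1 - (x * z)\<^sup>2)\<^sup>2 \<ge> 0" using x2 z by simp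
  next
    have "1 - (x * z)\<^sup>2 \<noteq> 0" if "z \<in> {0..1}" for z
    proof -
      have "1 - (x * z)\<^sup>2 = (1 + x * z) * (1 + x * (-z))"
          by (simp add: power2_eq_square algebra_simps)
      then show ?thesis using qpos[of z] qpos[of "-z"] that by simp
    qed
    then show "continuous_on {0..1} (\<lambda>z. (1 - x\<^sup>2) * (2 * z) / (1 - (x * z)\<^sup>2)\<^sup>2)"
      by (intro continuous_intros) simp
  qed simp
  also have "\<dots> = ennreal (Beta (1 - s) s)"
    using nn_integral_Beta[of "1 - s" s] s x2 by simp
  finally show ?thesis by (simp only: gends)
qed

lemma integral_I1_of_nn_integral:
  assumes f: "f \<in> borel_measurable borel" "\<And>y. f y \<ge> 0"
    and nn: "(\<integral>\<^sup>+y. ennreal (f y * indicator {-1..1} y) \<partial>lborel) = ennreal c" and "c \<ge> 0"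
  shows "integrable I1 f" "(LINT y|I1. f y) = c"
proof -
  have fm: "f \<in> borel_measurable I1" by (rule borel_measurable_I1[OF f(1)])
  have "(\<integral>\<^sup>+y. ennreal (f y) \<partial>I1) = (\<integral>\<^sup>+y. ennreal (f y) * indicator {-1<..<1} y \<partial>lebesgue)"
    by (subst nn_integral_restrict_space) auto
  also have "\<dots> = (\<integral>\<^sup>+y. ennreal (f y) * indicator {-1<..<1} y \<partial>lborel)"
    by (rule nn_integral_completion)
  also have "\<dots> = (\<integral>\<^sup>+y. ennreal (f y * indicator {-1..1} y) \<partial>lborel)"
  proof (rule nn_integral_cong_AE)
    show "AE y in lborel. ennreal (f y) * indicator {-1<..<1} y = ennreal (f y * indicator {-1..1}
        y)"
      using AE_lborel_singleton[of 1] AE_lborel_singleton[of "-1"]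
      by eventually_elim (auto simp: indicator_def)
  qed
  finally have *: "(\<integral>\<^sup>+y. ennreal (f y) \<partial>I1) = ennreal c" using nn by simp
  show int: "integrable I1 f"
    by (rule integrableI_nn_integral_finite[OF fm _ *]) (use f in auto)
  show "(LINT y|I1. f y) = c"
    using * f(2) nn_integral_eq_integral[OF int] \<open>c \<ge> 0\<close>
    by (simp add: Bochner_Integration.integral_nonneg)
qed

lemma Beta_nonneg_real: "a > 0 \<Longrightarrow> b > 0 \<Longrightarrow> Beta a b \<ge> (0 :: real)"
  by (simp add: Beta_def less_imp_le)

lemma riesz_potential_const:
  assumes "0 < s" "s < 1" "x \<in> {-1<..<1}"
  shows "integrable I1 (\<lambda>y. \<bar>x - y\<bar> powr (1 - 2 * s) * om (s - 1) y)"
    and "(LINT y|I1. \<bar>x - y\<bar> powr (1 - 2 * s) * om (s - 1) y) = Beta (1 - s) s"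
proof -
  have "0 \<le> Beta (1 - s) s" using assms by (intro Beta_nonneg_real) auto
  then show "integrable I1 (\<lambda>y. \<bar>x - y\<bar> powr (1 - 2 * s) * om (s - 1) y)"
    "(LINT y|I1. \<bar>x - y\<bar> powr (1 - 2 * s) * om (s - 1) y) = Beta (1 - s) s"
    using integral_I1_of_nn_integral[OF _ _ riesz_potential_nn_integral[OF assms]] om_nonneg by auto
qed

lemma Beta_reflection: 
  fixes s :: real
  assumes "0 < s" "s < 1" 
  shows "Beta (1 - s) s = pi / sin (pi * s)"
proof -
  have "complex_of_real (Gamma s * Gamma (1 - s)) = complex_of_real (pi / sin (pi * s))"
    using Gamma_reflection_complex[of "complex_of_real s"] Gamma_complex_of_real[of s]
      Gamma_complex_of_real[of "1 - s"] sin_of_real[of "pi * s", where 'a = complex] by simp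
  then have "Gamma s * Gamma (1 - s) = pi / sin (pi * s)" by (simp only: of_real_eq_iff)
  then show ?thesis by (simp add: Beta_def mult.commute)
qed

lemma integrable_om:
  assumes "t > 0"
  shows "integrable I1 (om (t - 1))"
proof -
  have "(\<integral>\<^sup>+y. ennreal (om (t - 1) y * indicator {2 * 0 - 1..2 * 1 - 1} y) \<partial>lborel)
     = (\<integral>\<^sup>+u. ennreal (om (t - 1) (2 * u - 1) * 2 * indicator {0..1} u) \<partial>lborel)"
  proof (rule nn_integral_substitution)
    show "set_borel_measurable borel {2 * 0 - 1..2 * 1 - 1} (om (t - 1))"
      unfolding set_borel_measurable_def by measurable
  qed (auto intro!: derivative_eq_intros)
  also have "\<dots> = (\<integral>\<^sup>+u. ennreal (2 powr (2 * t - 1)) * ennreal (u powr (t - 1) * (1 - u) powr (t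
      - 1) * indicator {0..1} u) \<partial>lborel)"
  proof (intro nn_integral_cong)
    fix u :: real
    have "om (t - 1) (2 * u - 1) * 2 = 2 powr (2 * t - 1) * (u powr (t - 1) * (1 - u) powr (t - 1))"
        if "u \<in> {0..1}"
    proof -
      have "om (t - 1) (2 * u - 1) = (2 * u) powr (t - 1) * (2 * (1 - u)) powr (t - 1)"
        by (simp add: omega_def)
      also have "\<dots> = 2 powr (t - 1) * 2 powr (t - 1) * (u powr (t - 1) * (1 - u) powr (t - 1))"
        unfolding powr_mult by (simp add: mult_ac)
      also have "2 powr (t - 1) * 2 powr (t - 1) = (2 powr (2 * t - 2) :: real)"
        by (simp flip: powr_add)
      finally have 1: "om (t - 1) (2 * u - 1)
          = 2 powr (2 * t - 2) * (u powr (t - 1) * (1 - u) powr (t - 1))" .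
      have 2: "2 powr (2 * t - 1) = (2 powr (2 * t - 2) * 2 :: real)"
        using powr_add[of 2 "2 * t - 2" 1] by simp
      show ?thesis unfolding 1 2 by (simp only: mult_ac)
    qed
    then show "ennreal (om (t - 1) (2 * u - 1) * 2 * indicator {0..1} u) =
      ennreal (2 powr (2 * t - 1)) * ennreal (u powr (t - 1) * (1 - u) powr (t - 1)
          * indicator {0..1} u)"
      by (cases "u \<in> {0..1}") (simp_all flip: ennreal_mult)
  qed
  also have "\<dots> = ennreal (2 powr (2 * t - 1)) * ennreal (Beta t t)"
    by (subst nn_integral_cmult) (simp_all add: nn_integral_Beta assms)
  also have "\<dots> = ennreal (2 powr (2 * t - 1) * Beta t t)"
    using assms by (intro ennreal_mult[symmetric] Beta_nonneg_real) auto
  finally show ?thesis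
    using integral_I1_of_nn_integral(1)[of "om (t - 1)"] assms om_nonneg
    by (simp add: Beta_nonneg_real)
qed

section \<open>The kernel with its logarithmic limit case\<close>

text \<open>
  Apart from a factor and an additive constant this is the kernel \<open>\<bar>t\<bar>\<^bsup>1-2s\<^esup>\<close>. The normalisation
  makes \<open>ln \<bar>t\<bar>\<close> the limit at \<open>s = 1/2\<close>, and it gives \<open>riesz_kernel_power\<close> for every \<open>s\<close>.
\<close>

definition riesz_kernel :: "real \<Rightarrow> real \<Rightarrow> real" where
  "riesz_kernel s t = (if s = 1 / 2 then ln \<bar>t\<bar> else (\<bar>t\<bar> powr (1 - 2 * s) - 1) / (1 - 2 * s))"

lemma riesz_kernel_even: "riesz_kernel s (- t) = riesz_kernel s t"
  by (simp add: riesz_kernel_def)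

lemma riesz_kernel_commute: "riesz_kernel s (x - y) = riesz_kernel s (y - x)"
  using riesz_kernel_even[of s "x - y"] by simp

text \<open>
  The identity through which every later computation treats the power and the logarithm alike.
\<close>

lemma riesz_kernel_power: "t \<noteq> 0 \<Longrightarrow> 1 + (1 - 2 * s) * riesz_kernel s t = \<bar>t\<bar> powr (1 - 2 * s)"
  by (cases "s = 1 / 2", hypsubst) (simp_all add: riesz_kernel_def)

lemma riesz_kernel_borel [measurable]: "riesz_kernel s \<in> borel_measurable borel"
proof (cases "s = 1 / 2")
  case True
  then show ?thesis by (simp add: riesz_kernel_def[abs_def])
next
  case False
  have "(\<lambda>t. (\<bar>t\<bar> powr (1 - 2 * s) - 1) / (1 - 2 * s)) \<in> borel_measurable borel" by measurable
  then show ?thesis using False by (simp add: riesz_kernel_def[abs_def])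
qed

lemma AE_I1_neq: "AE y in I1. y \<noteq> c"
proof -
  have "{y \<in> {-1<..<1}. \<not> y \<noteq> c} \<subseteq> {c}" by auto
  then have "negligible {y \<in> {-1<..<1}. \<not> y \<noteq> c}" by (rule negligible_subset[rotated]) simp
  then show ?thesis by (subst AE_lebesgue_on_iff_negligible) simp_all
qed

lemma abs_exp_minus_one_le: "\<bar>exp z - 1\<bar> \<le> \<bar>z\<bar> * exp \<bar>z\<bar>" for z :: real
proof (cases "z \<ge> 0")
  case True
  have "(1 - z) * exp z \<le> exp (- z) * exp z"
    using exp_ge_add_one_self[of "- z"] by (intro mult_right_mono) auto
  then show ?thesis using True by (simp add: exp_minus left_diff_distrib)
next
  case False
  then have "1 - exp z \<le> \<bar>z\<bar> * 1" using exp_ge_add_one_self[of z] by linarith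
  also have "\<dots> \<le> \<bar>z\<bar> * exp \<bar>z\<bar>" by (intro mult_left_mono) auto
  finally show ?thesis using False by simp
qed

text \<open>
  A majorant of the kernels that does not depend on \<open>s\<close> is needed to let \<open>s\<close> tend to \<open>1/2\<close>. With
  \<open>L = ln \<bar>t\<bar>\<close> the kernel is a difference quotient of the exponential function, hence at most
  \<open>\<bar>L\<bar> exp(\<bar>L\<bar> / 8)\<close>, and \<open>\<bar>L\<bar> \<le> 8 exp(\<bar>L\<bar> / 8)\<close>.
\<close>

lemma riesz_kernel_bound_near_half:
  assumes s: "1 / 2 \<le> s" "s \<le> 9 / 16" and t: "0 < \<bar>t\<bar>" "\<bar>t\<bar> < 2"
  shows "\<bar>riesz_kernel s t\<bar> \<le> 8 * \<bar>t\<bar> powr (- (1 / 4)) + 2"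
proof -
  define L where "L = ln \<bar>t\<bar>"
  have "\<bar>riesz_kernel s t\<bar> \<le> \<bar>L\<bar> * exp (\<bar>L\<bar> / 8)"
  proof (cases "s = 1 / 2")
    case True
    have "\<bar>L\<bar> * 1 \<le> \<bar>L\<bar> * exp (\<bar>L\<bar> / 8)" by (intro mult_left_mono) auto
    then show ?thesis using True by (simp add: riesz_kernel_def L_def)
  next
    case False
    define \<eta> where "\<eta> = 2 * s - 1"
    have \<eta>: "\<eta> > 0" "\<eta> \<le> 1 / 8" using False s by (auto simp: \<eta>_def)
    have "riesz_kernel s t = (exp (- \<eta> * L) - 1) / (- \<eta>)"
      using False t by (simp add: riesz_kernel_def powr_def L_def \<eta>_def)
    then have "\<bar>riesz_kernel s t\<bar> = \<bar>exp (- \<eta> * L) - 1\<bar> / \<eta>" using \<eta> by (simp add: abs_divide)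
    also have "\<dots> \<le> (\<bar>- \<eta> * L\<bar> * exp \<bar>- \<eta> * L\<bar>) / \<eta>"
      using \<eta> by (intro divide_right_mono abs_exp_minus_one_le) auto
    also have "\<dots> = \<bar>L\<bar> * exp (\<eta> * \<bar>L\<bar>)" using \<eta> by (simp add: abs_mult)
    also have "\<dots> \<le> \<bar>L\<bar> * exp (\<bar>L\<bar> / 8)"
      using mult_right_mono[OF \<eta>(2), of "\<bar>L\<bar>"] by (intro mult_left_mono) auto
    finally show ?thesis .
  qed
  also have "\<dots> \<le> 8 * \<bar>t\<bar> powr (- (1 / 4)) + 2"
  proof (cases "L < 0")
    case True
    have "\<bar>L\<bar> / 8 \<le> exp (\<bar>L\<bar> / 8)" using exp_ge_add_one_self[of "\<bar>L\<bar> / 8"] by linarith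
    then have "\<bar>L\<bar> * exp (\<bar>L\<bar> / 8) \<le> (8 * exp (\<bar>L\<bar> / 8)) * exp (\<bar>L\<bar> / 8)"
      by (intro mult_right_mono) auto
    also have "\<dots> = 8 * exp (\<bar>L\<bar> / 4)" by (simp flip: exp_add)
    also have "exp (\<bar>L\<bar> / 4) = \<bar>t\<bar> powr (- (1 / 4))"
      using True t by (simp add: powr_def L_def)
    finally show ?thesis by simp
  next
    case False
    have "L \<le> ln 2" unfolding L_def using t by simp
    also have "ln 2 \<le> (1 :: real)" using ln_2_less_1 by simp
    finally have "L \<le> 1" .
    moreover have "exp (1 / 8 :: real) \<le> 2" using exp_bound[of "1 / 8"]
        by (simp add: power2_eq_square)
    ultimately have "exp (L / 8) \<le> 2" using order_trans[of "exp (L / 8)" "exp (1 / 8)" 2] by simp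
    with \<open>L \<le> 1\<close> have "L * exp (L / 8) \<le> 1 * 2" using False by (intro mult_mono) auto
    then show ?thesis using False by simp (smt (verit) powr_ge_zero)
  qed
  finally show ?thesis .
qed

lemma om_mult: "om p y * om q y = om (p + q) y"
  by (simp add: omega_def powr_add mult_ac)

lemma om_ge_1:
  assumes "t \<le> 0" "y \<in> {-1<..<1}"
  shows "om t y \<ge> 1"
proof -
  have "om t y = ((1 + y) * (1 - y)) powr t" using assms by (simp add: om_alt powr_mult)
  also have "\<dots> \<ge> 1 powr t"
  proof (rule powr_mono2')
    show "0 < (1 + y) * (1 - y)" using assms(2) by (intro mult_pos_pos) auto
    show "(1 + y) * (1 - y) \<le> 1" by (simp add: algebra_simps)
  qed (rule assms)
  finally show ?thesis by simp
qed

lemma om_pos: "y \<in> {-1<..<1} \<Longrightarrow> om t y > 0"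
  by (simp add: om_alt)

lemma om_antimono:
  assumes "p \<le> q" "y \<in> {-1<..<1}"
  shows "om q y \<le> om p y"
proof -
  have "om q y * 1 \<le> om q y * om (p - q) y"
    using om_ge_1[of "p - q" y] assms om_nonneg by (intro mult_left_mono) auto
  then show ?thesis by (simp add: om_mult)
qed

text \<open>
  The product \<open>\<bar>x - y\<bar>\<^bsup>-1/4\<^esup> \<omega>\<^bsup>-1/2\<^esup>\<close> is the geometric mean of \<open>\<bar>x - y\<bar>\<^bsup>-1/2\<^esup> \<omega>\<^bsup>-1/4\<^esup>\<close>
      and \<open>\<omega>\<^bsup>-3/4\<^esup>\<close>.
  The integral of the first over \<open>y\<close> is independent of \<open>x\<close>,
      by \<open>riesz_potential_const\<close> at the exponent
  \<open>3/4\<close>, so the arithmetic mean yields a majorant whose integral is the same for all \<open>x\<close>.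
\<close>

definition log_majorant :: "real \<Rightarrow> real \<Rightarrow> real" where
  "log_majorant x y = 4 * (\<bar>x - y\<bar> powr (1 - 2 * (3 / 4)) * om (3 / 4 - 1) y + om (1 / 4 - 1) y)
     + 2 * om (1 / 2 - 1) y"

lemma log_majorant_bound:
  assumes "1 / 2 \<le> s" "s \<le> 9 / 16" "x \<in> {-1<..<1}" "y \<in> {-1<..<1}" "x \<noteq> y"
  shows "\<bar>riesz_kernel s (x - y) * om (s - 1) y\<bar> \<le> log_majorant x y"
proof -
  define p q where "p = \<bar>x - y\<bar> powr (- (1 / 4)) * om (- (1 / 8)) y" and "q = om (- (3 / 8)) y"
  have "\<bar>riesz_kernel s (x - y)\<bar> \<le> 8 * \<bar>x - y\<bar> powr (- (1 / 4)) + 2"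
    using assms by (intro riesz_kernel_bound_near_half) auto
  moreover have "om (s - 1) y \<le> om (- (1 / 2)) y"
    using assms by (intro om_antimono) auto
  ultimately have "\<bar>riesz_kernel s (x - y)\<bar> * om (s - 1) y \<le> (8 * \<bar>x - y\<bar> powr (- (1 / 4)) + 2)
      * om (- (1 / 2)) y"
    by (intro mult_mono om_nonneg) auto
  also have "\<dots> = 4 * (2 * p * q) + 2 * om (- (1 / 2)) y"
    using om_mult[of "- (1 / 8)" y "- (3 / 8)"] by (simp add: p_def q_def algebra_simps)
  also have "\<dots> \<le> 4 * (p\<^sup>2 + q\<^sup>2) + 2 * om (- (1 / 2)) y"
    using sum_squares_bound[of p q] by simp
  also have "p\<^sup>2 + q\<^sup>2 = \<bar>x - y\<bar> powr (- (1 / 2)) * om (- (1 / 4)) y + om (- (3 / 4)) y"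
  proof -
    have "p\<^sup>2 = (\<bar>x - y\<bar> powr (- (1 / 4)) * \<bar>x - y\<bar> powr (- (1 / 4))) * (om (- (1 / 8)) y
        * om (- (1 / 8)) y)"
      by (simp add: p_def power2_eq_square mult_ac)
    then show ?thesis by (simp add: om_mult q_def power2_eq_square flip: powr_add)
  qed
  finally show ?thesis using om_nonneg[of "s - 1" "-1" 1 y] by (simp add: log_majorant_def abs_mult)
qed

lemma log_majorant_integral:
  assumes "x \<in> {-1<..<1}"
  shows "integrable I1 (log_majorant x)"
    and "(LINT y|I1. log_majorant x y) = 4 * (Beta (1 - 3 / 4) (3 / 4) + (LINT y|I1. om (1 / 4
        - 1) y))
     + 2 * (LINT y|I1. om (1 / 2 - 1) y)"
proof -
  note i = riesz_potential_const[of "3 / 4" x] integrable_om[of "1 / 4"] integrable_om[of "1 / 2"]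
  show "integrable I1 (log_majorant x)" unfolding log_majorant_def[abs_def]
    by (intro Bochner_Integration.integrable_add integrable_mult_right i) (use assms in auto)
  show "(LINT y|I1. log_majorant x y) = 4 * (Beta (1 - 3 / 4) (3 / 4) + (LINT y|I1. om (1 / 4
      - 1) y))
     + 2 * (LINT y|I1. om (1 / 2 - 1) y)"
    unfolding log_majorant_def
    using i assms by (subst Bochner_Integration.integral_add
        Bochner_Integration.integral_mult_right_zero | simp)+
qed

lemma riesz_kernel_shift_measurable: "(\<lambda>y. riesz_kernel s (x - y) * om (s - 1) y) \<in> borel_measurable
    I1"
  by (rule borel_measurable_I1) measurable

lemma riesz_kernel_om_eq:
  assumes "s \<noteq> 1 / 2" "x \<noteq> y"
  shows "riesz_kernel s (x - y) * om (s - 1) y =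
    (\<bar>x - y\<bar> powr (1 - 2 * s) * om (s - 1) y - om (s - 1) y) / (1 - 2 * s)"
  using assms by (simp add: riesz_kernel_def field_simps)

lemma riesz_kernel_integrable:
  assumes s: "0 < s" "s < 1" and x: "x \<in> {-1<..<1}"
  shows "integrable I1 (\<lambda>y. riesz_kernel s (x - y) * om (s - 1) y)"
proof (cases "s = 1 / 2")
  case True
  then have s2: "1 / 2 \<le> s" "s \<le> 9 / 16" by auto
  show ?thesis
  proof (rule Bochner_Integration.integrable_bound[OF log_majorant_integral(1)[OF x]
      riesz_kernel_shift_measurable])
    have "AE y in I1. y \<in> {-1<..<1}" by (rule AE_I1_mem)
    then show "AE y in I1. norm (riesz_kernel s (x - y) * om (s - 1) y) \<le> norm (log_majorant x y)"
      using AE_I1_neq[of x]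
    proof eventually_elim
      case (elim y)
      then show ?case using log_majorant_bound[OF s2 x, of y] by auto
    qed
  qed
next
  case False
  have "integrable I1 (\<lambda>y. (\<bar>x - y\<bar> powr (1 - 2 * s) * om (s - 1) y - om (s - 1) y) / (1 - 2 * s))"
    using riesz_potential_const(1)[OF s x] integrable_om[OF s(1)] by simp
  then show ?thesis
  proof (rule integrable_cong_AE_imp[OF _ riesz_kernel_shift_measurable])
    show "AE y in I1. (\<bar>x - y\<bar> powr (1 - 2 * s) * om (s - 1) y - om (s - 1) y) / (1 - 2 * s)
        = riesz_kernel s (x - y) * om (s - 1) y"
      using AE_I1_neq[of x] by eventually_elim (rule riesz_kernel_om_eq[OF False, symmetric], simp)
  qed
qed

text \<open>
  The bound is uniform in \<open>x\<close>. This is what makes the Fubini arguments and the uniform limits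
  below possible.
\<close>

lemma riesz_kernel_abs_integral_bound:
  assumes s: "0 < s" "s < 1"
  obtains M where "\<And>x. x \<in> {-1<..<1} \<Longrightarrow> (LINT y|I1. \<bar>riesz_kernel s (x - y) * om (s - 1) y\<bar>) \<le> M"
proof (cases "s = 1 / 2")
  case True
  then have s2: "1 / 2 \<le> s" "s \<le> 9 / 16" by auto
  show ?thesis
  proof (rule that)
    fix x :: real assume x: "x \<in> {-1<..<1}"
    have "AE y in I1. y \<in> {-1<..<1}" by (rule AE_I1_mem)
    then have "AE y in I1. \<bar>riesz_kernel s (x - y) * om (s - 1) y\<bar> \<le> log_majorant x y"
      using AE_I1_neq[of x]
    proof eventually_elim
      case (elim y)
      then show ?case using log_majorant_bound[OF s2 x, of y] by auto
    qed
    then have "(LINT y|I1. \<bar>riesz_kernel s (x - y) * om (s - 1) y\<bar>) \<le> (LINT y|I1. log_majorant x y)"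
      using riesz_kernel_integrable[OF s x] log_majorant_integral(1)[OF x]
          by (intro integral_mono_AE) auto
    then show "(LINT y|I1. \<bar>riesz_kernel s (x - y) * om (s - 1) y\<bar>) \<le> 4 * (Beta (1 - 3 / 4) (3 / 4)
        + (LINT y|I1. om (1 / 4 - 1) y))
     + 2 * (LINT y|I1. om (1 / 2 - 1) y)"
      unfolding log_majorant_integral(2)[OF x] .
  qed
next
  case False
  show ?thesis
  proof (rule that)
    fix x :: real assume x: "x \<in> {-1<..<1}"
    let ?k = "\<lambda>y. \<bar>x - y\<bar> powr (1 - 2 * s) * om (s - 1) y"
    note int = riesz_potential_const(1)[OF s x] integrable_om[OF s(1)]
    have "(LINT y|I1. \<bar>riesz_kernel s (x - y) * om (s - 1) y\<bar>) \<le> (LINT y|I1. (?k y + om (s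
        - 1) y) / \<bar>1 - 2 * s\<bar>)"
    proof (intro integral_mono_AE)
      show "AE y in I1. \<bar>riesz_kernel s (x - y) * om (s - 1) y\<bar> \<le> (?k y + om (s - 1) y) / \<bar>1 - 2
          * s\<bar>"
        using AE_I1_neq[of x]
      proof eventually_elim
        case (elim y)
        have "?k y \<ge> 0" "om (s - 1) y \<ge> 0" using om_nonneg by auto
        then have "\<bar>?k y - om (s - 1) y\<bar> \<le> ?k y + om (s - 1) y" by linarith
        then show ?case
          unfolding riesz_kernel_om_eq[OF False elim(1)[symmetric]] abs_divide
              by (intro divide_right_mono) auto
      qed
    qed (use int riesz_kernel_integrable[OF s x] in auto)
    also have "\<dots> = (Beta (1 - s) s + (LINT y|I1. om (s - 1) y)) / \<bar>1 - 2 * s\<bar>"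
      using riesz_potential_const[OF s x] integrable_om[OF s(1)] by simp
    finally show "(LINT y|I1. \<bar>riesz_kernel s (x - y) * om (s - 1) y\<bar>) \<le> (Beta (1 - s) s
        + (LINT y|I1. om (s - 1) y)) / \<bar>1 - 2 * s\<bar>" .
  qed
qed

text \<open>
  The density \<open>h\<close> is taken relative to the weight \<open>\<omega>\<^bsup>s-1\<^esup>\<close>.
\<close>

definition riesz_pot :: "real \<Rightarrow> (real \<Rightarrow> real) \<Rightarrow> real \<Rightarrow> real" where
  "riesz_pot s h x = (LINT y|I1. riesz_kernel s (x - y) * om (s - 1) y * h y)"

lemma riesz_pot_integrable:
  assumes "0 < s" "s < 1" "x \<in> {-1<..<1}" "h \<in> borel_measurable I1" "\<And>y. y \<in> {-1<..<1} \<Longrightarrow> \<bar>h y\<bar> \<le> B"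
  shows "integrable I1 (\<lambda>y. riesz_kernel s (x - y) * om (s - 1) y * h y)"
  using integrable_I1_bounded_mult[OF riesz_kernel_integrable] assms by blast

lemma riesz_kernel_tendsto_log:
  assumes "\<sigma> \<longlonglongrightarrow> 1 / 2" "\<And>n. \<sigma> n \<noteq> 1 / 2" "t \<noteq> 0"
  shows "(\<lambda>n. riesz_kernel (\<sigma> n) t) \<longlonglongrightarrow> ln \<bar>t\<bar>"
proof -
  have "((\<lambda>h. exp (h * ln \<bar>t\<bar>)) has_real_derivative ln \<bar>t\<bar>) (at 0)"
    by (auto intro!: derivative_eq_intros)
  then have "((\<lambda>h. (exp (h * ln \<bar>t\<bar>) - 1) / h) \<longlongrightarrow> ln \<bar>t\<bar>) (at 0)"
    by (simp add: DERIV_def)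
  moreover have "filterlim (\<lambda>n. 1 - 2 * \<sigma> n) (at 0) sequentially"
  proof (rule filterlim_atI)
    show "(\<lambda>n. 1 - 2 * \<sigma> n) \<longlonglongrightarrow> 0" by (rule tendsto_eq_intros assms refl | simp)+
    show "\<forall>\<^sub>F n in sequentially. 1 - 2 * \<sigma> n \<noteq> 0" using assms(2) by (auto simp: field_simps)
  qed
  ultimately have "(\<lambda>n. (exp ((1 - 2 * \<sigma> n) * ln \<bar>t\<bar>) - 1) / (1 - 2 * \<sigma> n)) \<longlonglongrightarrow> ln \<bar>t\<bar>"
    by (rule filterlim_compose)
  then show ?thesis using assms(2,3) by (simp add: riesz_kernel_def powr_def)
qed

text \<open>
  For \<open>s \<noteq> 1/2\<close> the constancy is \<open>riesz_potential_const\<close>. At \<open>s = 1/2\<close> the power kernel carries no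
  information, and the potential is the limit of those for exponents decreasing to \<open>1/2\<close>, whose
  weights are majorised by \<open>\<omega>\<^bsup>-1/2\<^esup>\<close>. The relation between the constant and the mass of the weight
  fixes all leading coefficients later.
\<close>

lemma riesz_pot_one:
  assumes s: "0 < s" "s < 1"
  obtains \<rho> where "(1 - 2 * s) * \<rho> + (LINT y|I1. om (s - 1) y) = Beta (1 - s) s"
    and "\<And>x. x \<in> {-1<..<1} \<Longrightarrow> riesz_pot s (\<lambda>_. 1) x = \<rho>"
proof -
  have rel: "(1 - 2 * s) * riesz_pot s (\<lambda>_. 1) x + (LINT y|I1. om (s - 1) y) = Beta (1 - s) s"
    if s: "0 < s" "s < 1" and x: "x \<in> {-1<..<1}" for x s
  proof -
    note int = riesz_kernel_integrable[OF s x] integrable_om[OF s(1)]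
    have "(1 - 2 * s) * riesz_pot s (\<lambda>_. 1) x + (LINT y|I1. om (s - 1) y)
      = (LINT y|I1. (1 - 2 * s) * (riesz_kernel s (x - y) * om (s - 1) y) + om (s - 1) y)"
      unfolding riesz_pot_def using int by (subst Bochner_Integration.integral_add) auto
    also have "\<dots> = (LINT y|I1. \<bar>x - y\<bar> powr (1 - 2 * s) * om (s - 1) y)"
    proof (rule integral_cong_AE)
      show "AE y in I1. (1 - 2 * s) * (riesz_kernel s (x - y) * om (s - 1) y) + om (s - 1) y
          = \<bar>x - y\<bar> powr (1 - 2 * s) * om (s - 1) y"
        using AE_I1_neq[of x]
      proof eventually_elim
        case (elim y)
        have "(1 - 2 * s) * (riesz_kernel s (x - y) * om (s - 1) y) + om (s - 1) y
            = (1 + (1 - 2 * s) * riesz_kernel s (x - y)) * om (s - 1) y"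
          by (simp add: algebra_simps)
        then show ?case using riesz_kernel_power[of "x - y" s] elim by simp
      qed
    qed (use int riesz_potential_const[OF s x] in auto)
    finally show ?thesis using riesz_potential_const[OF s x] by simp
  qed
  show ?thesis
  proof (cases "s = 1 / 2")
    case False
    have "riesz_pot s (\<lambda>_. 1) x = (Beta (1 - s) s - (LINT y|I1. om (s - 1) y)) / (1 - 2 * s)"
      if "x \<in> {-1<..<1}" for x
      using rel[OF s that] False by (simp add: field_simps)
    with False show ?thesis by (intro that[of "(Beta (1 - s) s - (LINT y|I1. om (s - 1) y)) / (1 - 2
        * s)"]) auto
  next
    case True
    \<comment> \<open>Exponents in the range of \<open>log_majorant_bound\<close> that avoid the value \<open>1/2\<close>.\<close>
    define \<sigma> where "\<sigma> n = 1 / 2 + (1 / 16) * inverse (real (Suc n))" for n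
    have \<sigma>: "\<sigma> n \<noteq> 1 / 2" "1 / 2 \<le> \<sigma> n" "\<sigma> n \<le> 9 / 16" for n
      by (auto simp: \<sigma>_def field_simps)
    have \<sigma>_lim: "\<sigma> \<longlonglongrightarrow> 1 / 2"
      unfolding \<sigma>_def by (rule tendsto_eq_intros LIMSEQ_inverse_real_of_nat refl | simp)+
    have lim: "(\<lambda>n. riesz_pot (\<sigma> n) (\<lambda>_. 1) x) \<longlonglongrightarrow> riesz_pot s (\<lambda>_. 1) x" if x: "x \<in> {-1<..<1}" for x
      unfolding riesz_pot_def mult_1_right
    proof (rule integral_dominated_convergence[OF _ _ log_majorant_integral(1)[OF x]])
      have inI: "AE y in I1. y \<in> {-1<..<1}" by (rule AE_I1_mem)
      show "AE y in I1. (\<lambda>n. riesz_kernel (\<sigma> n) (x - y) * om (\<sigma> n - 1) y) \<longlonglongrightarrow> riesz_kernel s (x - y)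
          * om (s - 1) y"
        using AE_I1_neq[of x] inI
      proof eventually_elim
        case (elim y)
        have "(\<lambda>n. riesz_kernel (\<sigma> n) (x - y)) \<longlonglongrightarrow> riesz_kernel s (x - y)"
          using riesz_kernel_tendsto_log[OF \<sigma>_lim \<sigma>(1), of "x - y"] elim True
              by (simp add: riesz_kernel_def)
        moreover have "(\<lambda>n. om (\<sigma> n - 1) y) \<longlonglongrightarrow> om (s - 1) y"
          unfolding om_alt True by (intro tendsto_intros \<sigma>_lim) (use elim in auto)
        ultimately show ?case by (rule tendsto_mult)
      qed
      show "AE y in I1. norm (riesz_kernel (\<sigma> n) (x - y) * om (\<sigma> n - 1) y) \<le> log_majorant x y" for n
        using AE_I1_neq[of x] inI
      proof eventually_elim
        case (elim y)
        then show ?case using log_majorant_bound[of "\<sigma> n" x y] \<sigma>[of n] x by auto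
      qed
    qed (rule riesz_kernel_shift_measurable)+
    have eq: "riesz_pot (\<sigma> n) (\<lambda>_. 1) x = riesz_pot (\<sigma> n) (\<lambda>_. 1) 0" if "x \<in> {-1<..<1}" for x n
    proof -
      have \<sigma>01: "0 < \<sigma> n" "\<sigma> n < 1" using \<sigma>[of n] by auto
      have "(0 :: real) \<in> {-1<..<1}" by simp
      from rel[OF \<sigma>01 that] rel[OF \<sigma>01 this]
      have "(1 - 2 * \<sigma> n) * riesz_pot (\<sigma> n) (\<lambda>_. 1) x = (1 - 2 * \<sigma> n) * riesz_pot (\<sigma> n) (\<lambda>_. 1) 0"
        by (metis add_right_cancel)
      then show ?thesis using \<sigma>(1)[of n] by simp
    qed
    have const: "riesz_pot s (\<lambda>_. 1) x = riesz_pot s (\<lambda>_. 1) 0" if x: "x \<in> {-1<..<1}" for x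
      using LIMSEQ_unique[OF lim[OF x, unfolded eq[OF x]] lim[of 0]] by simp
    have "(1 - 2 * s) * riesz_pot s (\<lambda>_. 1) 0 + (LINT y|I1. om (s - 1) y) = Beta (1 - s) s"
      by (rule rel[OF s]) simp
    then show ?thesis using const by (rule that)
  qed
qed

section \<open>Fubini identities for Riesz potentials\<close>

lemma DERIV_riesz_kernel:
  assumes "t \<noteq> 0"
  shows "(riesz_kernel s has_real_derivative sgn t * \<bar>t\<bar> powr (- 2 * s)) (at t)"
proof -
  have pos: "(riesz_kernel s has_real_derivative t powr (- 2 * s)) (at t)" if "t > 0" for t
  proof (cases "s = 1 / 2")
    case True
    have "(ln has_real_derivative t powr (- 2 * s)) (at t)"
      using that True by (auto intro!: derivative_eq_intros simp: powr_minus field_simps)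
    then show ?thesis
      by (rule has_field_derivative_transform_within_open[of _ _ _ "{0<..}"])
         (use that True in \<open>auto simp: riesz_kernel_def\<close>)
  next
    case False
    have "((\<lambda>t. (t powr (1 - 2 * s) - 1) / (1 - 2 * s)) has_real_derivative
        ((1 - 2 * s) * t powr (1 - 2 * s - 1) - 0) / (1 - 2 * s)) (at t)"
      by (intro DERIV_cdivide DERIV_diff DERIV_const has_real_derivative_powr that)
    then have "((\<lambda>t. (t powr (1 - 2 * s) - 1) / (1 - 2 * s)) has_real_derivative t powr (- 2
        * s)) (at t)"
      using False by simp
    then show ?thesis
      by (rule has_field_derivative_transform_within_open[of _ _ _ "{0<..}"])
         (use that False in \<open>auto simp: riesz_kernel_def\<close>)
  qed
  show ?thesis
  proof (cases "t > 0")
    case True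
    then show ?thesis using pos[of t] by simp
  next
    case False
    then have "t < 0" using assms by simp
    have "((\<lambda>t. riesz_kernel s (- t)) has_real_derivative (- t) powr (- 2 * s) * (- 1)) (at t)"
      by (rule DERIV_chain2[OF pos]) (use \<open>t < 0\<close> in \<open>auto intro!: derivative_eq_intros\<close>)
    then show ?thesis using \<open>t < 0\<close> by (simp add: riesz_kernel_even)
  qed
qed

lemma DERIV_id_mult_riesz_kernel:
  assumes "t \<noteq> 0"
  shows "((\<lambda>t. t * riesz_kernel s t) has_real_derivative 1 + (2 - 2 * s) * riesz_kernel s t) (at t)"
proof -
  have "((\<lambda>t. t * riesz_kernel s t) has_real_derivative 1 * riesz_kernel s t + sgn t * \<bar>t\<bar> powr (- 2
      * s) * t) (at t)"
    by (intro DERIV_mult DERIV_ident DERIV_riesz_kernel assms)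
  moreover have "sgn t * \<bar>t\<bar> powr (- 2 * s) * t = \<bar>t\<bar> powr (1 - 2 * s)"
  proof -
    have "sgn t * t = \<bar>t\<bar>" by (simp add: abs_sgn mult.commute)
    then have "sgn t * \<bar>t\<bar> powr (- 2 * s) * t = \<bar>t\<bar> * \<bar>t\<bar> powr (- 2 * s)"
        by (metis mult.assoc mult.commute)
    also have "\<dots> = \<bar>t\<bar> powr (1 + - 2 * s)" unfolding powr_add using assms by simp
    finally show ?thesis by simp
  qed
  moreover have "1 + (2 - 2 * s) * riesz_kernel s t = 1 * riesz_kernel s t + (1 + (1 - 2 * s)
      * riesz_kernel s t)"
    by (simp add: algebra_simps)
  ultimately show ?thesis by (simp only: riesz_kernel_power[OF assms, of s])
qed

lemma abs_powr_tendsto_0: "a > 0 \<Longrightarrow> ((\<lambda>t::real. \<bar>t\<bar> powr a) \<longlongrightarrow> 0) (at 0)"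
proof -
  assume "a > 0"
  then have "continuous_on UNIV (\<lambda>t::real. \<bar>t\<bar> powr a)"
    by (intro continuous_on_powr' continuous_intros) auto
  then have "isCont (\<lambda>t::real. \<bar>t\<bar> powr a) 0" by (simp add: continuous_on_eq_continuous_at)
  then show ?thesis by (simp add: isCont_def)
qed

lemma isCont_id_mult_riesz_kernel:
  assumes s: "0 < s" "s < 1"
  shows "isCont (\<lambda>t. t * riesz_kernel s t) t"
proof (cases "t = 0")
  case False
  then show ?thesis by (intro DERIV_isCont[OF DERIV_id_mult_riesz_kernel])
next
  case True
  have "((\<lambda>t. t * riesz_kernel s t) \<longlongrightarrow> 0) (at 0)"
  proof (cases "s = 1 / 2")
    case True
    have "((\<lambda>t. 8 * \<bar>t\<bar> powr (3 / 4) + 2 * \<bar>t\<bar>) \<longlongrightarrow> 8 * 0 + 2 * \<bar>0\<bar>) (at (0 :: real))"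
      by (intro tendsto_intros abs_powr_tendsto_0) auto
    then have lim: "((\<lambda>t. 8 * \<bar>t\<bar> powr (3 / 4) + 2 * \<bar>t\<bar>) \<longlongrightarrow> 0) (at (0 :: real))" by simp
    show ?thesis
    proof (rule Lim_null_comparison[OF _ lim])
      have "\<forall>\<^sub>F t in at (0 :: real). t \<in> ball 0 2" by (rule eventually_at_in_open') auto
      moreover have "\<forall>\<^sub>F t in at (0 :: real). t \<noteq> 0" by (simp add: eventually_at_filter)
      ultimately show "\<forall>\<^sub>F t in at 0. norm (t * riesz_kernel s t) \<le> 8 * \<bar>t\<bar> powr (3 / 4) + 2 * \<bar>t\<bar>"
      proof eventually_elim
        case (elim t)
        have "\<bar>riesz_kernel s t\<bar> \<le> 8 * \<bar>t\<bar> powr (- (1 / 4)) + 2"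
          by (rule riesz_kernel_bound_near_half) (use elim True in auto)
        then have "\<bar>t\<bar> * \<bar>riesz_kernel s t\<bar> \<le> \<bar>t\<bar> * (8 * \<bar>t\<bar> powr (- (1 / 4)) + 2)"
            by (intro mult_left_mono) auto
        also have "\<dots> = 8 * (\<bar>t\<bar> powr 1 * \<bar>t\<bar> powr (- (1 / 4))) + 2 * \<bar>t\<bar>"
          by (simp add: algebra_simps)
        also have "\<bar>t\<bar> powr 1 * \<bar>t\<bar> powr (- (1 / 4)) = \<bar>t\<bar> powr (3 / 4)"
          unfolding powr_add[symmetric] by simp
        finally show ?case by (simp add: abs_mult)
      qed
    qed
  next
    case False
    have "((\<lambda>t. \<bar>t\<bar> powr (2 - 2 * s)) \<longlongrightarrow> 0) (at 0)"
      by (intro abs_powr_tendsto_0) (use s in auto)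
    then have "((\<lambda>t. t * \<bar>t\<bar> powr (1 - 2 * s)) \<longlongrightarrow> 0) (at 0)"
    proof (rule Lim_null_comparison[rotated])
      have "norm (t * \<bar>t\<bar> powr (1 - 2 * s)) = \<bar>t\<bar> powr (2 - 2 * s)" for t :: real
        using powr_add[of "\<bar>t\<bar>" 1 "1 - 2 * s"] by (simp add: abs_mult)
      then show "\<forall>\<^sub>F t in at 0. norm (t * \<bar>t\<bar> powr (1 - 2 * s)) \<le> \<bar>t\<bar> powr (2 - 2 * s)"
        by simp
    qed
    then have "((\<lambda>t. (t * \<bar>t\<bar> powr (1 - 2 * s) - t) / (1 - 2 * s)) \<longlongrightarrow> (0 - 0) / (1 - 2 * s)) (at 0)"
      by (intro tendsto_intros) (use False in auto)
    then show ?thesis using False by (simp add: riesz_kernel_def right_diff_distrib)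
  qed
  then show ?thesis using True by (simp add: isCont_def)
qed

text \<open>
  The function \<open>t k(t)\<close> is continuous everywhere and has the derivative \<open>1 + (2 - 2s) k(t)\<close> away
  from the origin, so the fundamental theorem of calculus holds across the singularity.
\<close>

lemma riesz_kernel_has_integral:
  assumes s: "0 < s" "s < 1" and "u \<le> v"
  shows "((\<lambda>t. 1 + (2 - 2 * s) * riesz_kernel s (t - y)) has_integral
     ((v - y) * riesz_kernel s (v - y) - (u - y) * riesz_kernel s (u - y))) {u..v}"
proof (rule fundamental_theorem_of_calculus_strong[of "{y}" u v "\<lambda>t. (t - y) * riesz_kernel s (t
    - y)"])
  show "continuous_on {u..v} (\<lambda>t. (t - y) * riesz_kernel s (t - y))"
  proof (intro continuous_at_imp_continuous_on ballI)
    fix t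
    show "isCont (\<lambda>t. (t - y) * riesz_kernel s (t - y)) t"
      by (rule isCont_o2[where f = "\<lambda>t. t - y" and g = "\<lambda>t. t * riesz_kernel s t"]) (auto intro!:
          isCont_id_mult_riesz_kernel[OF s] continuous_intros)
  qed
  fix t assume t: "t \<in> {u..v} - {y}"
  have "((\<lambda>t. (t - y) * riesz_kernel s (t - y)) has_real_derivative (1 + (2 - 2 * s)
      * riesz_kernel s (t - y)) * 1) (at t)"
    by (rule DERIV_chain2[OF DERIV_id_mult_riesz_kernel]) (use t in \<open>auto intro!:
        derivative_eq_intros\<close>)
  then show "((\<lambda>t. (t - y) * riesz_kernel s (t - y)) has_vector_derivative (1 + (2 - 2 * s)
      * riesz_kernel s (t - y))) (at t)"
    by (simp add: has_real_derivative_iff_has_vector_derivative)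
qed (use assms in auto)

lemma LINT_indicator_interval:
  fixes f :: "real \<Rightarrow> real"
  assumes f: "integrable I1 f" and uv: "-1 \<le> u" "u \<le> v" "v \<le> 1" and I: "(f has_integral I) {u..v}"
  shows "(LINT t|I1. indicator {u..v} t * f t) = I"
proof -
  have "integrable I1 (\<lambda>t. f t * indicator {u..v} t)"
    by (rule integrable_I1_bounded_mult[OF f, where B = 1])
       (auto intro!: borel_measurable_I1 simp: indicator_def)
  then have "integrable I1 (\<lambda>t. indicator {u..v} t * f t)" by (simp add: mult.commute)
  then have "(LINT t|I1. indicator {u..v} t * f t) = integral {-1<..<1} (\<lambda>t. indicator {u..v} t
      * f t)"
    by (rule lebesgue_integral_eq_integral) simp
  also have "\<dots> = integral UNIV (\<lambda>t. if t \<in> {-1<..<1} then indicator {u..v} t * f t else 0)"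
    by (simp only: integral_restrict_UNIV)
  also have "\<dots> = integral UNIV (\<lambda>t. if t \<in> {u..v} then f t else 0)"
    by (rule integral_spike[of "{-1, 1}"]) (use uv in auto)
  also have "\<dots> = integral {u..v} f" by (simp only: integral_restrict_UNIV)
  also have "\<dots> = I" using I by (rule integral_unique)
  finally show ?thesis .
qed

text \<open>
  The weight \<open>\<omega>\<^bsup>s-1\<^esup>\<close> is at least \<open>1\<close>, so integrability with the weight implies integrability
  without it.
\<close>

lemma riesz_kernel_section_integrable:
  assumes s: "0 < s" "s < 1" and y: "y \<in> {-1<..<1}"
  shows "integrable I1 (\<lambda>t. riesz_kernel s (t - y))"
proof (rule Bochner_Integration.integrable_bound[OF riesz_kernel_integrable[OF s y]])
  show "AE t in I1. norm (riesz_kernel s (t - y)) \<le> norm (riesz_kernel s (y - t) * om (s - 1) t)"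
  proof (rule AE_I2)
    fix t assume "t \<in> space I1"
    then have "om (s - 1) t \<ge> 1" using s by (intro om_ge_1) (auto simp: space_restrict_space)
    then have "\<bar>riesz_kernel s (t - y)\<bar> * 1 \<le> \<bar>riesz_kernel s (t - y)\<bar> * om (s - 1) t"
      by (intro mult_left_mono) auto
    then show "norm (riesz_kernel s (t - y)) \<le> norm (riesz_kernel s (y - t) * om (s - 1) t)"
      using om_nonneg by (simp add: abs_mult riesz_kernel_commute[of s t y])
  qed
  show "(\<lambda>t. riesz_kernel s (t - y)) \<in> borel_measurable I1" by (rule borel_measurable_I1) measurable
qed

lemma LINT_riesz_kernel_interval:
  assumes s: "0 < s" "s < 1" and y: "y \<in> {-1<..<1}" and uv: "-1 < u" "u \<le> v" "v < 1"
  shows "(LINT t|I1. indicator {u..v} t * (1 + (2 - 2 * s) * riesz_kernel s (t - y)))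
     = (v - y) * riesz_kernel s (v - y) - (u - y) * riesz_kernel s (u - y)"
proof (rule LINT_indicator_interval[OF _ _ _ _ riesz_kernel_has_integral[OF s]])
  interpret finite_measure I1 by (rule finite_measure_I1)
  show "integrable I1 (\<lambda>t. 1 + (2 - 2 * s) * riesz_kernel s (t - y))"
    using riesz_kernel_section_integrable[OF s y] by simp
qed (use uv in auto)

lemma riesz_kernel_pair_integrable:
  assumes s: "0 < s" "s < 1" and g: "integrable I1 g"
    and h: "h \<in> borel_measurable I1" "\<And>y. y \<in> {-1<..<1} \<Longrightarrow> \<bar>h y\<bar> \<le> B"
  shows "integrable (I1 \<Otimes>\<^sub>M I1) (\<lambda>(t, y). g t * (riesz_kernel s (t - y) * om (s - 1) y * h y))"
proof -
  interpret P: pair_sigma_finite I1 I1 by (rule pair_sigma_finite_I1)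
  note [measurable] = measurable_I1_pair_fst_snd h(1)
  have [measurable]: "g \<in> borel_measurable I1" using g by auto
  have [measurable]: "om (s - 1) \<in> borel_measurable I1" by (rule borel_measurable_I1) measurable
  obtain M where M: "\<And>x. x \<in> {-1<..<1} \<Longrightarrow> (LINT y|I1. \<bar>riesz_kernel s (x - y) * om (s - 1) y\<bar>) \<le> M"
    using riesz_kernel_abs_integral_bound[OF s] by blast
  let ?f = "\<lambda>(t, y). g t * (riesz_kernel s (t - y) * om (s - 1) y * h y)"
  have meas: "?f \<in> borel_measurable (I1 \<Otimes>\<^sub>M I1)" by measurable
  have int: "integrable I1 (\<lambda>y. riesz_kernel s (t - y) * om (s - 1) y * h y)" if "t \<in> {-1<..<1}"
      for t
    by (rule riesz_pot_integrable[OF s that h])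
  show ?thesis
  proof (rule P.Fubini_integrable[OF meas])
    show "AE t in I1. integrable I1 (\<lambda>y. ?f (t, y))"
      by (rule AE_I2) (simp add: space_restrict_space int)
    show "integrable I1 (\<lambda>t. LINT y|I1. norm (?f (t, y)))"
    proof (rule Bochner_Integration.integrable_bound)
      show "integrable I1 (\<lambda>t. \<bar>B\<bar> * M * g t)" using g by simp
      show "(\<lambda>t. LINT y|I1. norm (?f (t, y))) \<in> borel_measurable I1"
        using meas by measurable
      show "AE t in I1. norm (LINT y|I1. norm (?f (t, y))) \<le> norm (\<bar>B\<bar> * M * g t)"
      proof (rule AE_I2)
        fix t assume "t \<in> space I1"
        then have t: "t \<in> {-1<..<1}" by (simp add: space_restrict_space)
        have "(LINT y|I1. \<bar>riesz_kernel s (t - y) * om (s - 1) y * h y\<bar>) \<le> (LINT y|I1. \<bar>B\<bar>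
            * \<bar>riesz_kernel s (t - y) * om (s - 1) y\<bar>)"
        proof (rule integral_mono)
          fix y assume "y \<in> space I1"
          then have "\<bar>h y\<bar> \<le> \<bar>B\<bar>" using h(2)[of y] by (simp add: space_restrict_space)
          then have "\<bar>riesz_kernel s (t - y) * om (s - 1) y\<bar> * \<bar>h y\<bar> \<le> \<bar>riesz_kernel s (t - y)
              * om (s - 1) y\<bar> * \<bar>B\<bar>"
            by (intro mult_left_mono) auto
          then show "\<bar>riesz_kernel s (t - y) * om (s - 1) y * h y\<bar> \<le> \<bar>B\<bar> * \<bar>riesz_kernel s (t - y)
              * om (s - 1) y\<bar>"
            by (simp add: abs_mult mult_ac)
        qed (use int[OF t] riesz_kernel_integrable[OF s t] in auto)
        also have "\<dots> \<le> \<bar>B\<bar> * M" using M[OF t] by (simp add: mult_left_mono)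
        finally have I: "(LINT y|I1. \<bar>riesz_kernel s (t - y) * om (s - 1) y * h y\<bar>) \<le> \<bar>B\<bar> * M" .
        have "(LINT y|I1. norm (?f (t, y))) = \<bar>g t\<bar> * (LINT y|I1. \<bar>riesz_kernel s (t - y) * om (s
            - 1) y * h y\<bar>)"
          by (simp add: abs_mult)
        moreover have "0 \<le> (LINT y|I1. \<bar>riesz_kernel s (t - y) * om (s - 1) y * h y\<bar>)" by simp
        ultimately show "norm (LINT y|I1. norm (?f (t, y))) \<le> norm (\<bar>B\<bar> * M * g t)"
          using mult_left_mono[OF order_trans[OF I abs_ge_self], of "\<bar>g t\<bar>"]
          by (simp add: abs_mult mult_ac)
      qed
    qed
  qed
qed

lemma om_integrable_mult:
  assumes "0 < s" "h \<in> borel_measurable I1" "\<And>y. y \<in> {-1<..<1} \<Longrightarrow> \<bar>h y\<bar> \<le> B"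
  shows "integrable I1 (\<lambda>y. om (s - 1) y * h y)"
  using integrable_I1_bounded_mult[OF integrable_om] assms by blast

text \<open>
  The difference of \<open>x k(x - y) h(y)\<close> and \<open>k(x - y) y h(y)\<close> contains the factor \<open>(x - y) k(x - y)\<close>,
  whose derivative in \<open>x\<close> is \<open>1 + (2 - 2s) k(x - y)\<close>. Integration gives the potential of \<open>y h\<close> from
  that of \<open>h\<close>. The statement is in integrated form, so that the potential need not be known to be
  differentiable.
\<close>

lemma riesz_pot_mult_var_diff:
  assumes s: "0 < s" "s < 1" and h: "h \<in> borel_measurable I1" "\<And>y. y \<in> {-1<..<1} \<Longrightarrow> \<bar>h y\<bar> \<le> B"
    and uv: "-1 < u" "u \<le> v" "v < 1"
  shows "(v * riesz_pot s h v - riesz_pot s (\<lambda>y. y * h y) v) - (u * riesz_pot s h u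
      - riesz_pot s (\<lambda>y. y * h y) u)
    = (LINT t|I1. indicator {u..v} t * ((LINT y|I1. om (s - 1) y * h y) + (2 - 2 * s)
        * riesz_pot s h t))"
proof -
  interpret P: pair_sigma_finite I1 I1 by (rule pair_sigma_finite_I1)
  interpret finite_measure I1 by (rule finite_measure_I1)
  let ?w = "om (s - 1)" and ?H = "\<lambda>t. t * riesz_kernel s t" and ?i
      = "indicator {u..v} :: real \<Rightarrow> real"
  have id_meas: "(\<lambda>y. y) \<in> borel_measurable I1" by (rule borel_measurable_I1) simp
  have yh: "(\<lambda>y. y * h y) \<in> borel_measurable I1" using id_meas h(1) by measurable
  have yhB: "\<bar>y * h y\<bar> \<le> B" if "y \<in> {-1<..<1}" for y
  proof -
    have "\<bar>y\<bar> * \<bar>h y\<bar> \<le> 1 * B" using h(2)[OF that] that by (intro mult_mono) auto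
    then show ?thesis by (simp add: abs_mult)
  qed
  have K: "integrable I1 (\<lambda>y. ?H (x - y) * (?w y * h y))"
    "x * riesz_pot s h x - riesz_pot s (\<lambda>y. y * h y) x = (LINT y|I1. ?H (x - y) * (?w y * h y))"
    if x: "x \<in> {-1<..<1}" for x
  proof -
    note i = riesz_pot_integrable[OF s x h] riesz_pot_integrable[OF s x yh yhB]
    have eq: "?H (x - y) * (?w y * h y) = x * (riesz_kernel s (x - y) * ?w y * h y)
        - riesz_kernel s (x - y) * ?w y * (y * h y)" for y
      by (simp add: algebra_simps)
    show "integrable I1 (\<lambda>y. ?H (x - y) * (?w y * h y))"
      unfolding eq using i by (intro Bochner_Integration.integrable_diff integrable_mult_right) auto
    show "x * riesz_pot s h x - riesz_pot s (\<lambda>y. y * h y) x = (LINT y|I1. ?H (x - y) * (?w y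
        * h y))"
      unfolding eq riesz_pot_def using i by (subst Bochner_Integration.integral_diff) auto
  qed
  have i_int: "integrable I1 ?i"
    by (rule integrable_I1_bounded[of _ 1]) (auto intro!: borel_measurable_I1 simp: indicator_def)
  have wh: "integrable I1 (\<lambda>y. ?w y * h y)" by (rule om_integrable_mult[OF s(1) h])
  have pair1: "integrable (I1 \<Otimes>\<^sub>M I1) (\<lambda>(t, y). ?i t * (?w y * h y))"
    by (rule P.Fubini_integrable) (use i_int wh in \<open>auto simp: abs_mult\<close>)
  have pair: "integrable (I1 \<Otimes>\<^sub>M I1) (\<lambda>(t, y). ?i t * (1 + (2 - 2 * s) * riesz_kernel s (t - y))
      * (?w y * h y))"
    using Bochner_Integration.integrable_add[OF pair1 integrable_mult_right[OF
        riesz_kernel_pair_integrable[OF s i_int h], of "2 - 2 * s"]]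
    by (rule back_subst[of "integrable _"]) (auto simp: algebra_simps)
  have "(v * riesz_pot s h v - riesz_pot s (\<lambda>y. y * h y) v) - (u * riesz_pot s h u
      - riesz_pot s (\<lambda>y. y * h y) u)
    = (LINT y|I1. ?H (v - y) * (?w y * h y)) - (LINT y|I1. ?H (u - y) * (?w y * h y))"
    using K(2) uv by simp
  also have "\<dots> = (LINT y|I1. ?H (v - y) * (?w y * h y) - ?H (u - y) * (?w y * h y))"
    by (rule Bochner_Integration.integral_diff[symmetric]) (use K(1) uv in auto)
  also have "\<dots> = (LINT y|I1. (LINT t|I1. ?i t * (1 + (2 - 2 * s) * riesz_kernel s (t - y)) * (?w y
      * h y)))"
  proof (rule Bochner_Integration.integral_cong[OF refl])
    fix y assume "y \<in> space I1"
    then have "y \<in> {-1<..<1}" by (simp add: space_restrict_space)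
    from LINT_riesz_kernel_interval[OF s this uv]
    show "?H (v - y) * (?w y * h y) - ?H (u - y) * (?w y * h y)
       = (LINT t|I1. ?i t * (1 + (2 - 2 * s) * riesz_kernel s (t - y)) * (?w y * h y))"
      unfolding Bochner_Integration.integral_mult_left_zero by (simp only: left_diff_distrib)
  qed
  also have "\<dots> = (LINT t|I1. (LINT y|I1. ?i t * (1 + (2 - 2 * s) * riesz_kernel s (t - y)) * (?w y
      * h y)))"
    by (rule P.Fubini_integral) (use pair in simp)
  also have "\<dots> = (LINT t|I1. ?i t * ((LINT y|I1. ?w y * h y) + (2 - 2 * s) * riesz_pot s h t))"
  proof (rule Bochner_Integration.integral_cong[OF refl])
    fix t assume "t \<in> space I1"
    then have t: "t \<in> {-1<..<1}" by (simp add: space_restrict_space)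
    have eq: "?i t * (1 + (2 - 2 * s) * riesz_kernel s (t - y)) * (?w y * h y)
       = ?i t * (?w y * h y + (2 - 2 * s) * (riesz_kernel s (t - y) * ?w y * h y))" for y
      by (simp add: algebra_simps)
    show "(LINT y|I1. ?i t * (1 + (2 - 2 * s) * riesz_kernel s (t - y)) * (?w y * h y))
       = ?i t * ((LINT y|I1. ?w y * h y) + (2 - 2 * s) * riesz_pot s h t)"
      unfolding eq riesz_pot_def Bochner_Integration.integral_mult_right_zero
      using wh riesz_pot_integrable[OF s t h] by (subst Bochner_Integration.integral_add) auto
  qed
  finally show ?thesis .
qed

lemma riesz_pot_symmetric:
  assumes s: "0 < s" "s < 1" and g: "g \<in> borel_measurable I1" "\<And>y. y \<in> {-1<..<1} \<Longrightarrow> \<bar>g y\<bar> \<le> A"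
    and h: "h \<in> borel_measurable I1" "\<And>y. y \<in> {-1<..<1} \<Longrightarrow> \<bar>h y\<bar> \<le> B"
  shows "(LINT x|I1. riesz_pot s g x * (om (s - 1) x * h x)) = (LINT x|I1. riesz_pot s h x * (om (s
      - 1) x * g x))"
proof -
  interpret P: pair_sigma_finite I1 I1 by (rule pair_sigma_finite_I1)
  let ?w = "om (s - 1)"
  have int: "integrable (I1 \<Otimes>\<^sub>M I1) (\<lambda>(x, y). (?w x * h x) * (riesz_kernel s (x - y) * ?w y * g y))"
    by (rule riesz_kernel_pair_integrable[OF s om_integrable_mult[OF s(1) h] g])
  have "(LINT x|I1. riesz_pot s g x * (?w x * h x)) = (LINT x|I1. LINT y|I1. (?w x * h x)
      * (riesz_kernel s (x - y) * ?w y * g y))"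
    by (simp add: riesz_pot_def mult.commute)
  also have "\<dots> = (LINT y|I1. LINT x|I1. (?w x * h x) * (riesz_kernel s (x - y) * ?w y * g y))"
    by (rule P.Fubini_integral[symmetric]) (use int in simp)
  also have "\<dots> = (LINT y|I1. riesz_pot s h y * (?w y * g y))"
  proof (rule Bochner_Integration.integral_cong[OF refl])
    fix y
    have "(\<lambda>x. (?w x * h x) * (riesz_kernel s (x - y) * ?w y * g y)) = (\<lambda>x. riesz_kernel s (y - x)
        * ?w x * h x * (?w y * g y))"
      using riesz_kernel_commute[of s _ y] by (simp add: fun_eq_iff)
    then show "(LINT x|I1. (?w x * h x) * (riesz_kernel s (x - y) * ?w y * g y)) = riesz_pot s h y
        * (?w y * g y)"
      by (simp add: riesz_pot_def)
  qed
  finally show ?thesis .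
qed

section \<open>Potentials of polynomials\<close>

lemma poly_measurable_I1: "poly p \<in> borel_measurable I1" for p :: "real poly"
  by (intro borel_measurable_I1 borel_measurable_continuous_onI continuous_intros)

text \<open>
  Leading coefficient of the potential of the density \<open>y\<^sup>n\<close>; the case \<open>n = 0\<close> is the constant of
  \<open>riesz_pot_one\<close>.
\<close>

definition riesz_pot_lead :: "real \<Rightarrow> nat \<Rightarrow> real" where
  "riesz_pot_lead s n = (if n = 0 then riesz_pot s (\<lambda>_. 1) 0
     else - Beta (1 - s) s * pochhammer (2 * s) (n - 1) / fact n)"

text \<open>
  The step from \<open>0\<close> to \<open>1\<close> combines the constant potential with the mass of the weight, by the
  relation in \<open>riesz_pot_one\<close>; afterwards the mass only affects lower coefficients and the
  recursion is that of a Pochhammer symbol.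
\<close>

lemma riesz_pot_lead_Suc:
  assumes s: "0 < s" "s < 1"
  shows "riesz_pot_lead s (Suc n) = riesz_pot_lead s n
    - ((if n = 0 then LINT y|I1. om (s - 1) y else 0) + (2 - 2 * s) * riesz_pot_lead s n) / real
        (Suc n)"
proof (cases n)
  case 0
  obtain \<rho> where \<rho>: "(1 - 2 * s) * \<rho> + (LINT y|I1. om (s - 1) y) = Beta (1 - s) s"
    "\<And>x. x \<in> {-1<..<1} \<Longrightarrow> riesz_pot s (\<lambda>_. 1) x = \<rho>" using riesz_pot_one[OF s] by blast
  have "riesz_pot s (\<lambda>_. 1) 0 = \<rho>" by (rule \<rho>(2)) simp
  with \<rho>(1) 0 show ?thesis by (simp add: riesz_pot_lead_def algebra_simps)
next
  case (Suc m)
  define L where "L = - Beta (1 - s) s * pochhammer (2 * s) m / fact (Suc m)"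
  have "riesz_pot_lead s (Suc n) = L * (2 * s + real m) / real (Suc n)"
  proof -
    have "fact (Suc n) = real (Suc n) * fact (Suc m)" by (simp only: Suc fact_Suc)
    moreover have "pochhammer (2 * s) (Suc n - 1) = pochhammer (2 * s) m * (2 * s + real m)"
      by (simp add: Suc pochhammer_Suc)
    ultimately show ?thesis unfolding riesz_pot_lead_def L_def by (simp add: mult_ac)
  qed
  moreover have "riesz_pot_lead s n = L" by (simp add: riesz_pot_lead_def Suc L_def)
  moreover have "L * (2 * s + real m) / real (Suc n) = L - (0 + (2 - 2 * s) * L) / real (Suc n)"
    using Suc by (simp add: field_simps)
  ultimately show ?thesis using Suc by simp
qed

lemma riesz_pot_monomial:
  assumes s: "0 < s" "s < 1"
  shows "\<exists>q. degree q \<le> n \<and> coeff q n = riesz_pot_lead s n \<and> (\<forall>x\<in>{-1<..<1}. riesz_pot s (\<lambda>y. y ^ n)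
      x = poly q x)"
proof (induction n)
  case 0
  obtain \<rho> where "\<And>x. x \<in> {-1<..<1} \<Longrightarrow> riesz_pot s (\<lambda>_. 1) x = \<rho>" using riesz_pot_one[OF s] by blast
  then have "\<forall>x\<in>{-1<..<1}. riesz_pot s (\<lambda>_. 1) x = \<rho>" "riesz_pot s (\<lambda>_. 1) 0 = \<rho>" by auto
  then show ?case by (intro exI[of _ "[:\<rho>:]"]) (simp add: riesz_pot_lead_def)
next
  case (Suc n)
  then obtain q where q: "degree q \<le> n" "coeff q n = riesz_pot_lead s n"
    "\<And>x. x \<in> {-1<..<1} \<Longrightarrow> riesz_pot s (\<lambda>y. y ^ n) x = poly q x" by blast
  define m where "m = (LINT y|I1. om (s - 1) y * y ^ n)"
  \<comment> \<open>A primitive of the integrand in \<open>riesz_pot_mult_var_diff\<close>.\<close>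
  obtain Q where Q: "pderiv Q = [:m:] + smult (2 - 2 * s) q" using poly_antiderivative by blast
  have h: "(\<lambda>y. y ^ n) \<in> borel_measurable I1" "\<And>y. y \<in> {-1<..<1} \<Longrightarrow> \<bar>y ^ n\<bar> \<le> (1 :: real)"
    by (rule borel_measurable_I1, simp) (auto simp: power_abs abs_le_iff intro!: power_le_one)
  have diff: "(v * poly q v - riesz_pot s (\<lambda>y. y ^ Suc n) v) - (u * poly q u - riesz_pot s (\<lambda>y. y ^
      Suc n) u) = poly Q v - poly Q u"
    if uv: "-1 < u" "u \<le> v" "v < 1" for u v
  proof -
    have "(v * riesz_pot s (\<lambda>y. y ^ n) v - riesz_pot s (\<lambda>y. y * y ^ n) v) - (u * riesz_pot s (\<lambda>y. y
        ^ n) u - riesz_pot s (\<lambda>y. y * y ^ n) u)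
       = (LINT t|I1. indicator {u..v} t * (m + (2 - 2 * s) * riesz_pot s (\<lambda>y. y ^ n) t))"
      unfolding m_def by (rule riesz_pot_mult_var_diff[OF s h uv])
    also have "\<dots> = (LINT t|I1. indicator {u..v} t * poly (pderiv Q) t)"
      by (intro Bochner_Integration.integral_cong refl) (simp add: space_restrict_space q(3) Q)
    also have "\<dots> = poly Q v - poly Q u"
    proof (rule LINT_indicator_interval[OF integrable_I1_poly])
      show "(poly (pderiv Q) has_integral poly Q v - poly Q u) {u..v}"
        using uv by (intro fundamental_theorem_of_calculus)
          (auto intro!: has_field_derivative_at_within poly_DERIV simp flip:
              has_real_derivative_iff_has_vector_derivative)
    qed (use uv in auto)
    finally show ?thesis using uv q(3)[of u] q(3)[of v] by simp
  qed
  \<comment> \<open>The constant of integration, read off at the origin.\<close>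
  define c where "c = - riesz_pot s (\<lambda>y. y ^ Suc n) 0 - poly Q 0"
  have val: "riesz_pot s (\<lambda>y. y ^ Suc n) x = poly (pCons 0 q - Q - [:c:]) x" if x: "x \<in> {-1<..<1}"
      for x
  proof (cases "x \<ge> 0")
    case True
    then show ?thesis using diff[of 0 x] x by (simp add: c_def)
  next
    case False
    then show ?thesis using diff[of x 0] x by (simp add: c_def)
  qed
  have degQ: "degree Q \<le> Suc n"
  proof -
    have "degree (pderiv Q) \<le> n" unfolding Q
      by (intro degree_add_le) (use q(1) in \<open>auto intro: order_trans[OF degree_smult_le]\<close>)
    then show ?thesis by (simp add: degree_pderiv)
  qed
  have "degree (pCons 0 q) \<le> Suc n" using q(1) degree_pCons_le[of 0 q] by linarith
  then have deg: "degree (pCons 0 q - Q - [:c:]) \<le> Suc n"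
    by (intro degree_diff_le degQ) auto
  have "real (Suc n) * coeff Q (Suc n) = coeff (pderiv Q) n" by (simp add: coeff_pderiv)
  also have "\<dots> = (if n = 0 then m else 0) + (2 - 2 * s) * riesz_pot_lead s n"
    unfolding Q by (simp add: q(2) coeff_pCons split: nat.split)
  finally have "coeff Q (Suc n) = ((if n = 0 then m else 0) + (2 - 2 * s) * riesz_pot_lead s n) /
      real (Suc n)"
    by (simp add: field_simps)
  then have "coeff (pCons 0 q - Q - [:c:]) (Suc n) = riesz_pot_lead s (Suc n)"
    unfolding riesz_pot_lead_Suc[OF s] by (simp add: q(2) m_def)
  with deg val show ?case by blast
qed

lemma riesz_pot_poly:
  fixes p :: "real poly"
  assumes s: "0 < s" "s < 1"
  shows "\<exists>q. (\<forall>n\<ge>degree p. degree q \<le> n \<and> coeff q n = riesz_pot_lead s n * coeff p n)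
    \<and> (\<forall>x\<in>{-1<..<1}. riesz_pot s (poly p) x = poly q x)"
proof -
  obtain Q where Q: "\<And>n. degree (Q n) \<le> n" "\<And>n. coeff (Q n) n = riesz_pot_lead s n"
    "\<And>n x. x \<in> {-1<..<1} \<Longrightarrow> riesz_pot s (\<lambda>y. y ^ n) x = poly (Q n) x"
    using riesz_pot_monomial[OF s] by metis
  define q where "q = (\<Sum>i\<le>degree p. smult (coeff p i) (Q i))"
  have deg: "degree q \<le> degree p" unfolding q_def
    using Q(1) by (intro degree_sum_le) (auto intro: order_trans[OF degree_smult_le] order_trans)
  have cf: "coeff q n = riesz_pot_lead s n * coeff p n" if "n \<ge> degree p" for n
  proof (cases "n = degree p")
    case True
    have "coeff q n = (\<Sum>i\<le>degree p. coeff p i * coeff (Q i) n)" by (simp add: q_def coeff_sum)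
    also have "\<dots> = (\<Sum>i\<in>{n}. coeff p i * coeff (Q i) n)"
    proof (rule sum.mono_neutral_right)
      show "\<forall>i\<in>{..degree p} - {n}. coeff p i * coeff (Q i) n = 0"
      proof
        fix i assume "i \<in> {..degree p} - {n}"
        then have "degree (Q i) < n" using Q(1)[of i] True by auto
        then show "coeff p i * coeff (Q i) n = 0" by (simp add: coeff_eq_0)
      qed
    qed (use True in auto)
    finally show ?thesis by (simp add: Q(2))
  next
    case False
    then show ?thesis using that deg by (simp add: coeff_eq_0)
  qed
  have val: "riesz_pot s (poly p) x = poly q x" if x: "x \<in> {-1<..<1}" for x
  proof -
    have int: "integrable I1 (\<lambda>y. riesz_kernel s (x - y) * om (s - 1) y * y ^ i)" for i
      by (rule riesz_pot_integrable[OF s x, of _ 1])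
         (rule borel_measurable_I1, simp, auto simp: power_abs abs_le_iff intro!: power_le_one)
    have "riesz_pot s (poly p) x = (LINT y|I1. (\<Sum>i\<le>degree p. coeff p i * (riesz_kernel s (x - y)
        * om (s - 1) y * y ^ i)))"
      by (simp add: riesz_pot_def poly_altdef sum_distrib_left mult_ac)
    also have "\<dots> = (\<Sum>i\<le>degree p. coeff p i * riesz_pot s (\<lambda>y. y ^ i) x)"
      unfolding riesz_pot_def using int by (subst Bochner_Integration.integral_sum) auto
    also have "\<dots> = poly q x" using Q(3)[OF x] by (simp add: q_def poly_sum)
    finally show ?thesis .
  qed
  show ?thesis using deg cf val by (intro exI[of _ q]) auto
qed

text \<open>
  The clause for all \<open>n \<ge> degree p\<close> makes the coefficient formula applicable with any bound on the
  degree.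
\<close>

definition riesz_poly :: "real \<Rightarrow> real poly \<Rightarrow> real poly" where
  "riesz_poly s p = (SOME q. (\<forall>n\<ge>degree p. degree q \<le> n \<and> coeff q n = riesz_pot_lead s n
      * coeff p n)
    \<and> (\<forall>x\<in>{-1<..<1}. riesz_pot s (poly p) x = poly q x))"

lemma riesz_poly:
  assumes s: "0 < s" "s < 1"
  shows "degree p \<le> n \<Longrightarrow> degree (riesz_poly s p) \<le> n"
    and "degree p \<le> n \<Longrightarrow> coeff (riesz_poly s p) n = riesz_pot_lead s n * coeff p n"
    and "x \<in> {-1<..<1} \<Longrightarrow> riesz_pot s (poly p) x = poly (riesz_poly s p) x"
  using someI_ex[OF riesz_pot_poly[OF s, of p]] unfolding riesz_poly_def by auto

section \<open>The operator on polynomials\<close>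

text \<open>
  The polynomial \<open>q\<close> with \<open>(\<omega>\<^sup>s p)' = \<omega>\<^bsup>s-1\<^esup> q\<close>.
\<close>

definition wderiv :: "real \<Rightarrow> real poly \<Rightarrow> real poly" where
  "wderiv s p = [:1, 0, -1:] * pderiv p - smult (2 * s) (pCons 0 p)"

lemma poly_wderiv: "poly (wderiv s p) y = poly (pderiv p) y * (1 - y\<^sup>2) - 2 * s * y * poly p y"
  by (simp add: wderiv_def power2_eq_square algebra_simps)

lemma degree_wderiv:
  assumes "degree p \<le> n"
  shows "degree (wderiv s p) \<le> Suc n" and "coeff (wderiv s p) (Suc n) = - (real n + 2 * s)
      * coeff p n"
proof -
  have dp: "degree (pderiv p) \<le> n - 1" using assms by (simp add: degree_pderiv)
  have "degree ([:1, 0, -1:] * pderiv p) \<le> Suc n"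
  proof (cases "pderiv p = 0")
    case False
    then have "degree p \<noteq> 0" using pderiv_eq_0_iff by blast
    then show ?thesis using degree_mult_le[of "[:1, 0, -1:]" "pderiv p"] dp assms by simp
  qed simp
  moreover have "degree (smult (2 * s) (pCons 0 p)) \<le> Suc n"
    using degree_pCons_le[of 0 p] assms degree_smult_le[of "2 * s" "pCons 0 p"] by linarith
  ultimately show "degree (wderiv s p) \<le> Suc n" unfolding wderiv_def by (rule degree_diff_le)
  have "coeff ([:1, 0, -1:] * pderiv p) (Suc n) = coeff (pderiv p) (Suc n) - (if n
      = 0 then 0 else coeff (pderiv p) (n - 1))"
    by (cases n) simp_all
  also have "\<dots> = - real n * coeff p n"
    using assms by (cases n) (simp_all add: coeff_pderiv coeff_eq_0 algebra_simps)
  finally show "coeff (wderiv s p) (Suc n) = - (real n + 2 * s) * coeff p n"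
    by (simp add: wderiv_def algebra_simps)
qed

text \<open>
  The factor in front of the potential in both cases of the definition of the operator, see
  \<open>kernel_const_relation\<close>.
\<close>

definition kernel_const :: "real \<Rightarrow> real" where "kernel_const s = Gamma (2 * s) / Beta (1 - s) s"

text \<open>
  This is \<open>\<Gamma>(2s + n + 1) / n!\<close>, in a form that makes the recursion for the leading coefficients
  visible.
\<close>

definition eigval :: "real \<Rightarrow> nat \<Rightarrow> real" where
  "eigval s n = Gamma (2 * s) * pochhammer (2 * s) (Suc n) / fact n"

definition frac_lap_poly :: "real \<Rightarrow> real poly \<Rightarrow> real poly" where
  "frac_lap_poly s p = smult (kernel_const s) (pderiv (riesz_poly s (wderiv s p)))"

lemma Beta_pos_real: "a > 0 \<Longrightarrow> b > 0 \<Longrightarrow> Beta a b > (0 :: real)"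
  by (simp add: Beta_def)

text \<open>
  Differentiating \<open>\<omega>\<^sup>s p\<close> raises the degree by one, the potential preserves it, and the outer
  derivative lowers it again.
\<close>

lemma frac_lap_poly_triangular:
  assumes s: "0 < s" "s < 1" and p: "degree p \<le> n"
  shows "degree (frac_lap_poly s p) \<le> n" and "coeff (frac_lap_poly s p) n = eigval s n * coeff p n"
proof -
  note r = riesz_poly(1,2)[OF s degree_wderiv(1)[OF p, of s]]
  show "degree (frac_lap_poly s p) \<le> n"
    unfolding frac_lap_poly_def using r(1) by (intro order_trans[OF degree_smult_le]) (simp add:
        degree_pderiv)
  have B: "Beta (1 - s) s \<noteq> 0" using Beta_pos_real[of "1 - s" s] s by simp
  have "coeff (frac_lap_poly s p) n = kernel_const s * (real (Suc n) * (riesz_pot_lead s (Suc n)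
      * (- (real n + 2 * s) * coeff p n)))"
    using r(2) degree_wderiv(2)[OF p, of s] by (simp add: frac_lap_poly_def coeff_pderiv)
  also have "\<dots> = eigval s n * coeff p n"
    using B by (simp add: kernel_const_def eigval_def riesz_pot_lead_def pochhammer_Suc fact_Suc
        field_simps del: of_nat_Suc)
  finally show "coeff (frac_lap_poly s p) n = eigval s n * coeff p n" .
qed

lemma DERIV_om_mult:
  assumes y: "y \<in> {-1<..<1}" and h: "(h has_real_derivative h') (at y)"
  shows "((\<lambda>y. om s y * h y) has_real_derivative
      om (s - 1) y * (h' * (1 - y\<^sup>2) - 2 * s * y * h y)) (at y)"
proof -
  have "((\<lambda>y. om s y * h y) has_real_derivative
     ((s * (1 + y) powr (s - 1) * (1 - y) powr s + (1 + y) powr s * (s * (1 - y) powr (s - 1)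
         * (-1))) * h y
       + om s y * h')) (at y)"
    unfolding om_alt using y h by (auto intro!: derivative_eq_intros simp: field_simps)
  moreover have "(1 + y) powr s = (1 + y) powr (s - 1) * (1 + y)" "(1 - y) powr s = (1 - y) powr (s
      - 1) * (1 - y)"
    using y powr_add[of "1 + y" "s - 1" 1] powr_add[of "1 - y" "s - 1" 1] by simp_all
  ultimately show ?thesis
    unfolding om_alt by (simp only:) (simp add: algebra_simps power2_eq_square)
qed

lemma om_continuous_on: "s > 0 \<Longrightarrow> continuous_on {-1..1} (om s)"
  unfolding omega_def by (intro continuous_intros continuous_on_powr') auto

text \<open>
  The factor \<open>g\<close> is kept apart from its formula so that instances can take a polynomial or a
  continuous function, whose measurability and boundedness are at hand.
\<close>

lemma integral_deriv_om_tail: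
  fixes h h' :: "real \<Rightarrow> real"
  assumes s: "0 < s" and h: "continuous_on {-1..1} h"
    and h': "\<And>y. y \<in> {-1<..<1} \<Longrightarrow> (h has_real_derivative h' y) (at y)"
    and D: "g \<in> borel_measurable I1" "\<And>y. y \<in> {-1<..<1} \<Longrightarrow> \<bar>g y\<bar> \<le> B"
    and g: "\<And>y. y \<in> {-1<..<1} \<Longrightarrow> g y = h' y * (1 - y\<^sup>2) - 2 * s * y * h y"
    and t: "t \<in> {-1..<1}"
  shows "(LINT y|I1. indicator {t<..} y * (om (s - 1) y * g y)) = - om s t * h t"
proof -
  let ?f = "\<lambda>y. om (s - 1) y * g y"
  have int: "integrable I1 ?f" by (rule om_integrable_mult[OF s D])
  have "(?f has_integral (om s 1 * h 1 - om s t * h t)) {t..1}"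
  proof (rule fundamental_theorem_of_calculus_interior)
    show "continuous_on {t..1} (\<lambda>y. om s y * h y)"
      by (intro continuous_intros continuous_on_subset[OF om_continuous_on[OF s]]
          continuous_on_subset[OF h]) (use t in auto)
    fix y assume "y \<in> {t<..<1}"
    then have y: "y \<in> {-1<..<1}" using t by auto
    show "((\<lambda>y. om s y * h y) has_vector_derivative ?f y) (at y)"
      using DERIV_om_mult[OF y h'[OF y]] g[OF y]
          by (simp add: has_real_derivative_iff_has_vector_derivative)
  qed (use t in auto)
  then have "(LINT y|I1. indicator {t..1} y * ?f y) = - om s t * h t"
    using LINT_indicator_interval[OF int, of t 1] t by (simp add: omega_def)
  moreover have "(LINT y|I1. indicator {t<..} y * ?f y) = (LINT y|I1. indicator {t..1} y * ?f y)"
  proof (rule integral_cong_AE)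
    have "AE y in I1. y \<in> {-1<..<1}" by (rule AE_I1_mem)
    then show "AE y in I1. indicator {t<..} y * ?f y = indicator {t..1} y * ?f y"
      using AE_I1_neq[of t] by eventually_elim (auto simp: indicator_def)
    have [measurable]: "?f \<in> borel_measurable I1" using int by auto
    have [measurable]: "indicator {t<..} \<in> borel_measurable I1" "indicator {t..1} \<in> borel_measurable
        I1"
      by (auto intro!: borel_measurable_I1)
    show "(\<lambda>y. indicator {t<..} y * ?f y) \<in> borel_measurable I1"
      "(\<lambda>y. indicator {t..1} y * ?f y) \<in> borel_measurable I1" by measurable
  qed
  ultimately show ?thesis by simp
qed

lemma integral_deriv_om_zero:
  fixes h h' :: "real \<Rightarrow> real"
  assumes s: "0 < s" and h: "continuous_on {-1..1} h"
    and h': "\<And>y. y \<in> {-1<..<1} \<Longrightarrow> (h has_real_derivative h' y) (at y)"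
    and D: "g \<in> borel_measurable I1" "\<And>y. y \<in> {-1<..<1} \<Longrightarrow> \<bar>g y\<bar> \<le> B"
    and g: "\<And>y. y \<in> {-1<..<1} \<Longrightarrow> g y = h' y * (1 - y\<^sup>2) - 2 * s * y * h y"
  shows "(LINT y|I1. om (s - 1) y * g y) = 0"
proof -
  have "(LINT y|I1. om (s - 1) y * g y) = (LINT y|I1. indicator {-1<..} y * (om (s - 1) y * g y))"
    by (intro Bochner_Integration.integral_cong refl) (simp add: space_restrict_space)
  also have "\<dots> = - om s (-1) * h (-1)"
    by (rule integral_deriv_om_tail[OF assms]) auto
  also have "\<dots> = 0" by (simp add: omega_def)
  finally show ?thesis .
qed

lemma continuous_on_I1_bounded:
  fixes f :: "real \<Rightarrow> real"
  assumes "continuous_on {-1..1} f"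
  obtains B where "f \<in> borel_measurable I1" "\<And>y. y \<in> {-1<..<1} \<Longrightarrow> \<bar>f y\<bar> \<le> B"
proof -
  have "bounded (f ` {-1..1})"
    by (intro compact_imp_bounded compact_continuous_image assms) auto
  then have "\<exists>B. \<forall>x\<in>{-1..1}. \<bar>f x\<bar> \<le> B" by (simp add: bounded_iff)
  then obtain B where "\<forall>x\<in>{-1..1}. \<bar>f x\<bar> \<le> B" ..
  then have "\<bar>f x\<bar> \<le> B" if "x \<in> {-1<..<1}" for x using that by auto
  moreover have "f \<in> borel_measurable I1"
    by (rule continuous_on_measurable_I1) (rule continuous_on_subset[OF assms], auto)
  ultimately show ?thesis using that by blast
qed

text \<open>
  Fubini's theorem moves the potential from \<open>D\<close> to the polynomial density, where it is again a
  polynomial \<open>P\<close>. As \<open>\<omega>\<^sup>s \<phi> P\<close> vanishes at both end points, integration by parts moves the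
  derivative from \<open>\<omega>\<^sup>s \<phi>\<close> to \<open>P\<close>.
\<close>

lemma frac_lap_adjoint_C1:
  fixes \<phi> \<phi>' :: "real \<Rightarrow> real" and q :: "real poly"
  assumes s: "0 < s" "s < 1" and \<phi>: "continuous_on {-1..1} \<phi>" and \<phi>'c: "continuous_on {-1..1} \<phi>'"
    and \<phi>': "\<And>y. y \<in> {-1<..<1} \<Longrightarrow> (\<phi> has_real_derivative \<phi>' y) (at y)"
  defines "D \<equiv> \<lambda>y. \<phi>' y * (1 - y\<^sup>2) - 2 * s * y * \<phi> y"
  shows "kernel_const s * (LINT x|I1. riesz_pot s D x * (om (s - 1) x * poly (wderiv s q) x))
     = - (LINT x|I1. \<phi> x * poly (frac_lap_poly s q) x * om s x)"
proof -
  let ?w = "om (s - 1)" and ?P = "riesz_poly s (wderiv s q)"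
  have Dc: "continuous_on {-1..1} D" unfolding D_def by (intro continuous_intros \<phi> \<phi>'c)
  obtain A where A: "D \<in> borel_measurable I1" "\<And>y. y \<in> {-1<..<1} \<Longrightarrow> \<bar>D y\<bar> \<le> A"
    using continuous_on_I1_bounded[OF Dc] by blast
  have "continuous_on {-1..1} (poly (wderiv s q))" by (intro continuous_intros)
  then obtain B where B: "poly (wderiv s q) \<in> borel_measurable I1" "\<And>y. y \<in> {-1<..<1}
      \<Longrightarrow> \<bar>poly (wderiv s q) y\<bar> \<le> B"
    using continuous_on_I1_bounded by blast
  have c1: "continuous_on {-1..1} (\<lambda>y. D y * poly ?P y)" by (intro continuous_intros Dc)
  have c2: "continuous_on {-1..1} (\<lambda>y. \<phi> y * poly (pderiv ?P) y * (1 - y\<^sup>2))"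
      by (intro continuous_intros \<phi>)
  obtain B1 where B1: "(\<lambda>y. D y * poly ?P y) \<in> borel_measurable I1" "\<And>y. y \<in> {-1<..<1}
      \<Longrightarrow> \<bar>D y * poly ?P y\<bar> \<le> B1"
    using continuous_on_I1_bounded[OF c1] by blast
  obtain B2 where B2: "(\<lambda>y. \<phi> y * poly (pderiv ?P) y * (1 - y\<^sup>2)) \<in> borel_measurable I1"
    "\<And>y. y \<in> {-1<..<1} \<Longrightarrow> \<bar>\<phi> y * poly (pderiv ?P) y * (1 - y\<^sup>2)\<bar> \<le> B2"
    using continuous_on_I1_bounded[OF c2] by blast
  have sum0: "(LINT y|I1. ?w y * (D y * poly ?P y + \<phi> y * poly (pderiv ?P) y * (1 - y\<^sup>2))) = 0"
  proof (rule integral_deriv_om_zero[OF s(1), where h = "\<lambda>y. \<phi> y * poly ?P y" and h'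
      = "\<lambda>y. \<phi>' y * poly ?P y + poly (pderiv ?P) y * \<phi> y" and B = "B1 + B2"])
    show "continuous_on {-1..1} (\<lambda>y. \<phi> y * poly ?P y)" by (intro continuous_intros \<phi>)
    show "((\<lambda>y. \<phi> y * poly ?P y) has_real_derivative \<phi>' y * poly ?P y + poly (pderiv ?P) y
        * \<phi> y) (at y)"
      if "y \<in> {-1<..<1}" for y using that by (intro DERIV_mult \<phi>' poly_DERIV)
    show "(\<lambda>y. D y * poly ?P y + \<phi> y * poly (pderiv ?P) y * (1 - y\<^sup>2)) \<in> borel_measurable I1"
      using B1(1) B2(1) by (rule borel_measurable_add)
    show "\<bar>D y * poly ?P y + \<phi> y * poly (pderiv ?P) y * (1 - y\<^sup>2)\<bar> \<le> B1 + B2" if "y \<in> {-1<..<1}"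
        for y
      using B1(2)[OF that] B2(2)[OF that] by linarith
    show "D y * poly ?P y + \<phi> y * poly (pderiv ?P) y * (1 - y\<^sup>2) =
      (\<phi>' y * poly ?P y + poly (pderiv ?P) y * \<phi> y) * (1 - y\<^sup>2) - 2 * s * y * (\<phi> y * poly ?P y)"
          for y
      by (simp add: D_def algebra_simps)
  qed
  have sum: "(LINT y|I1. ?w y * (D y * poly ?P y)) + (LINT y|I1. ?w y * (\<phi> y * poly (pderiv ?P) y
      * (1 - y\<^sup>2))) = 0"
    using sum0 om_integrable_mult[OF s(1) B1] om_integrable_mult[OF s(1) B2]
    by (subst Bochner_Integration.integral_add[symmetric]) (auto simp: distrib_left)
  have "(LINT x|I1. riesz_pot s D x * (?w x * poly (wderiv s q) x))
      = (LINT x|I1. riesz_pot s (poly (wderiv s q)) x * (?w x * D x))"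
    by (rule riesz_pot_symmetric[OF s A B])
  also have "\<dots> = (LINT y|I1. ?w y * (D y * poly ?P y))"
    by (intro Bochner_Integration.integral_cong refl) (simp add: space_restrict_space
        riesz_poly(3)[OF s])
  also have "\<dots> = - (LINT y|I1. ?w y * (\<phi> y * poly (pderiv ?P) y * (1 - y\<^sup>2)))" using sum by simp
  also have "(LINT y|I1. ?w y * (\<phi> y * poly (pderiv ?P) y * (1 - y\<^sup>2))) = (LINT y|I1. \<phi> y
      * poly (pderiv ?P) y * om s y)"
  proof (intro Bochner_Integration.integral_cong refl)
    fix y assume "y \<in> space I1"
    then have om: "?w y * (1 - y\<^sup>2) = om s y"
      using om_mult[of "s - 1" y 1] by (simp add: space_restrict_space om_alt power2_eq_square
          algebra_simps)
    have "?w y * (\<phi> y * poly (pderiv ?P) y * (1 - y\<^sup>2)) = \<phi> y * poly (pderiv ?P) y * (?w y * (1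
        - y\<^sup>2))"
      by (simp only: mult_ac)
    then show "?w y * (\<phi> y * poly (pderiv ?P) y * (1 - y\<^sup>2)) = \<phi> y * poly (pderiv ?P) y * om s y"
      by (simp only: om)
  qed
  finally have "(LINT x|I1. riesz_pot s D x * (?w x * poly (wderiv s q) x)) = - (LINT y|I1. \<phi> y
      * poly (pderiv ?P) y * om s y)" .
  then have "kernel_const s * (LINT x|I1. riesz_pot s D x * (?w x * poly (wderiv s q) x))
      = - (LINT y|I1. kernel_const s * (\<phi> y * poly (pderiv ?P) y * om s y))"
    by simp
  then show ?thesis by (simp add: frac_lap_poly_def mult_ac)
qed

lemma frac_lap_poly_symmetric:
  assumes s: "0 < s" "s < 1"
  shows "(LINT x|I1. poly (frac_lap_poly s p) x * poly q x * om s x) = (LINT x|I1. poly p x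
      * poly (frac_lap_poly s q) x * om s x)"
proof -
  have adj: "kernel_const s * (LINT x|I1. riesz_pot s (poly (wderiv s p)) x * (om (s - 1) x
      * poly (wderiv s q) x))
     = - (LINT x|I1. poly p x * poly (frac_lap_poly s q) x * om s x)" for p q
    using frac_lap_adjoint_C1[OF s, of "poly p" "poly (pderiv p)" q]
        by (simp add: poly_wderiv[abs_def] continuous_intros)
  obtain A B where A: "\<And>y. y \<in> {-1..1} \<Longrightarrow> \<bar>poly (wderiv s p) y\<bar> \<le> A" and B: "\<And>y. y \<in> {-1..1}
      \<Longrightarrow> \<bar>poly (wderiv s q) y\<bar> \<le> B"
    using poly_bounded_I1 by metis
  have "(LINT x|I1. riesz_pot s (poly (wderiv s p)) x * (om (s - 1) x * poly (wderiv s q) x))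
     = (LINT x|I1. riesz_pot s (poly (wderiv s q)) x * (om (s - 1) x * poly (wderiv s p) x))"
    by (rule riesz_pot_symmetric[OF s poly_measurable_I1 A poly_measurable_I1 B]) auto
  then show ?thesis using adj[of p q] adj[of q p] by (simp add: mult_ac)
qed

section \<open>Orthogonality of the Gegenbauer polynomials\<close>

fun gegenbauer_poly :: "real \<Rightarrow> nat \<Rightarrow> real poly" where
  "gegenbauer_poly a 0 = 1"
| "gegenbauer_poly a (Suc 0) = [:0, 2 * a:]"
| "gegenbauer_poly a (Suc (Suc n)) = smult (1 / real (n + 2))
     (smult (2 * (real (n + 2) + a - 1)) (pCons 0 (gegenbauer_poly a (Suc n)))
      - smult (real (n + 2) + 2 * a - 2) (gegenbauer_poly a n))"

lemma poly_gegenbauer_poly: "poly (gegenbauer_poly a n) x = gegenbauer a n x"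
  by (induction a n rule: gegenbauer_poly.induct) (simp_all add: algebra_simps)

lemma gegenbauer_poly_degree_lead:
  assumes "a > 0"
  shows "(\<forall>i>n. coeff (gegenbauer_poly a n) i = 0) \<and> coeff (gegenbauer_poly a n) n > 0"
proof (induction n rule: induct_nat_012)
  case (ge2 n)
  have "coeff (gegenbauer_poly a (Suc (Suc n))) i = 0" if i: "i > Suc (Suc n)" for i
  proof -
    obtain k where k: "i = Suc k" using i by (cases i) auto
    show ?thesis using ge2 i by (simp add: k)
  qed
  moreover have "coeff (gegenbauer_poly a (Suc (Suc n))) (Suc (Suc n)) > 0"
    using ge2 assms by simp
  ultimately show ?case by blast
qed (use assms in \<open>auto simp: coeff_pCons split: nat.splits\<close>)

lemma gegenbauer_poly_rec:
  "(real n + 2) * poly (gegenbauer_poly a (Suc (Suc n))) x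
     = 2 * (real n + 1 + a) * x * poly (gegenbauer_poly a (Suc n)) x - (real n + 2 * a)
         * poly (gegenbauer_poly a n) x"
  by (simp add: field_simps)

lemma gegenbauer_poly_deriv_rec:
  "(real n + 2) * poly (pderiv (gegenbauer_poly a (Suc (Suc n)))) x
     = 2 * (real n + 1 + a) * (poly (gegenbauer_poly a (Suc n)) x + x
         * poly (pderiv (gegenbauer_poly a (Suc n))) x)
       - (real n + 2 * a) * poly (pderiv (gegenbauer_poly a n)) x"
  by (simp add: pderiv_smult pderiv_diff pderiv_pCons field_simps)

text \<open>
  Both first order relations are proved together: the three-term recursion turns one into the
  other, and its derivative yields the next step.
\<close>

lemma gegenbauer_poly_ladder:
  "(1 - x\<^sup>2) * poly (pderiv (gegenbauer_poly a (Suc n))) x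
     = - (real n + 1) * x * poly (gegenbauer_poly a (Suc n)) x + (real n + 2 * a)
         * poly (gegenbauer_poly a n) x \<and>
   (1 - x\<^sup>2) * poly (pderiv (gegenbauer_poly a n)) x
     = (real n + 2 * a) * x * poly (gegenbauer_poly a n) x - (real n + 1) * poly (gegenbauer_poly a
         (Suc n)) x"
proof (induction n)
  case 0
  show ?case by (simp add: pderiv_pCons power2_eq_square algebra_simps)
next
  case (Suc n)
  define C0 C1 C2 D0 D1 D2 N where "C0 = poly (gegenbauer_poly a n) x" "C1
      = poly (gegenbauer_poly a (Suc n)) x"
    "C2 = poly (gegenbauer_poly a (Suc (Suc n))) x" "D0 = poly (pderiv (gegenbauer_poly a n)) x"
    "D1 = poly (pderiv (gegenbauer_poly a (Suc n))) x" "D2 = poly (pderiv (gegenbauer_poly a (Suc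
        (Suc n)))) x" "N = real n"
  note defs = this
  have r: "(N + 2) * C2 = 2 * (N + 1 + a) * x * C1 - (N + 2 * a) * C0"
    "(N + 2) * D2 = 2 * (N + 1 + a) * (C1 + x * D1) - (N + 2 * a) * D0"
    using gegenbauer_poly_rec[of n a x] gegenbauer_poly_deriv_rec[of n a x]
        by (simp_all add: defs del: gegenbauer_poly.simps)
  have I: "(1 - x\<^sup>2) * D1 = - (N + 1) * x * C1 + (N + 2 * a) * C0"
    "(1 - x\<^sup>2) * D0 = (N + 2 * a) * x * C0 - (N + 1) * C1"
    using Suc by (simp_all add: defs del: gegenbauer_poly.simps)
  have N: "N + 2 \<noteq> 0" by (simp add: defs)
  have "(1 - x\<^sup>2) * D1 = (N + 1 + 2 * a) * x * C1 - (N + 2) * C2"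
    unfolding I r by (simp add: algebra_simps)
  moreover have "(1 - x\<^sup>2) * D2 = - (N + 2) * x * C2 + (N + 1 + 2 * a) * C1"
  proof -
    have "(N + 2) * ((1 - x\<^sup>2) * D2) = (1 - x\<^sup>2) * ((N + 2) * D2)" by simp
    also have "\<dots> = 2 * (N + 1 + a) * ((1 - x\<^sup>2) * C1 + x * ((1 - x\<^sup>2) * D1)) - (N + 2 * a) * ((1
        - x\<^sup>2) * D0)"
      unfolding r by (simp add: algebra_simps)
    also have "\<dots> = - (N + 2) * x * (2 * (N + 1 + a) * x * C1 - (N + 2 * a) * C0) + (N + 2) * (N + 1
        + 2 * a) * C1"
      unfolding I by (simp add: algebra_simps power2_eq_square)
    also have "\<dots> = (N + 2) * (- (N + 2) * x * C2 + (N + 1 + 2 * a) * C1)"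
      unfolding r(1)[symmetric] by (simp add: algebra_simps)
    finally show ?thesis using N by simp
  qed
  ultimately show ?case by (simp add: defs add_ac del: gegenbauer_poly.simps)
qed

text \<open>
  Differentiating the first ladder relation and eliminating the derivative of \<open>C\<^sub>m\<close> by the second
  one gives Gegenbauer's equation multiplied by \<open>1 - x\<^sup>2\<close>, which is positive on the open interval.
\<close>

lemma gegenbauer_poly_ode:
  assumes x: "x \<in> {-1<..<1}"
  shows "(1 - x\<^sup>2) * poly (pderiv (pderiv (gegenbauer_poly a n))) x - (2 * a + 1) * x
      * poly (pderiv (gegenbauer_poly a n)) x
    = - real n * (real n + 2 * a) * poly (gegenbauer_poly a n) x"
proof (cases n)
  case (Suc m)
  let ?C = "gegenbauer_poly a (Suc m)" and ?B = "gegenbauer_poly a m"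
  have "poly ([:1, 0, -1:] * pderiv ?C) y = poly (smult (- (real m + 1)) (pCons 0 ?C)
      + smult (real m + 2 * a) ?B) y" for y
    using gegenbauer_poly_ladder[of y a m] by (simp add: power2_eq_square algebra_simps)
  then have "[:1, 0, -1:] * pderiv ?C = smult (- (real m + 1)) (pCons 0 ?C) + smult (real m + 2
      * a) ?B"
    by (intro poly_eq_poly_eq_iff[THEN iffD1] ext)
  then have "pderiv ([:1, 0, -1:] * pderiv ?C) = pderiv (smult (- (real m + 1)) (pCons 0 ?C)
      + smult (real m + 2 * a) ?B)"
    by (rule arg_cong)
  then have "poly (pderiv ([:1, 0, -1:] * pderiv ?C)) x = poly (pderiv (smult (- (real m
      + 1)) (pCons 0 ?C) + smult (real m + 2 * a) ?B)) x"
    by simp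
  moreover define C C1 C2 B B1 M where "C = poly ?C x" "C1 = poly (pderiv ?C) x" "C2
      = poly (pderiv (pderiv ?C)) x"
    "B = poly ?B x" "B1 = poly (pderiv ?B) x" "M = real m"
  note defs = this
  ultimately have d: "(1 - x\<^sup>2) * C2 - 2 * x * C1 = - (M + 1) * (C + x * C1) + (M + 2 * a) * B1"
    by (simp add: pderiv_mult pderiv_add pderiv_minus pderiv_smult pderiv_pCons power2_eq_square
        algebra_simps)
  have I: "(1 - x\<^sup>2) * C1 = - (M + 1) * x * C + (M + 2 * a) * B"
    and II: "(1 - x\<^sup>2) * B1 = (M + 2 * a) * x * B - (M + 1) * C"
    using gegenbauer_poly_ladder[of x a m] by (simp_all add: defs)
  have "(1 - x\<^sup>2) * ((M + 2 * a) * B1) = (M + 2 * a) * ((M + 2 * a) * x * B - (M + 1) * C)"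
    unfolding II[symmetric] by simp
  also have "\<dots> = (M + 2 * a) * x * ((M + 2 * a) * B) - (M + 2 * a) * (M + 1) * C"
    by (simp add: algebra_simps)
  also have "(M + 2 * a) * B = (1 - x\<^sup>2) * C1 + (M + 1) * x * C" using I
      by (simp add: algebra_simps)
  also have "(M + 2 * a) * x * ((1 - x\<^sup>2) * C1 + (M + 1) * x * C) - (M + 2 * a) * (M + 1) * C
     = (1 - x\<^sup>2) * ((M + 2 * a) * x * C1 - (M + 2 * a) * (M + 1) * C)"
    by (simp add: algebra_simps power2_eq_square)
  finally have "(M + 2 * a) * B1 = (M + 2 * a) * x * C1 - (M + 2 * a) * (M + 1) * C"
    using x abs_square_less_1[of x] by auto
  with d have "(1 - x\<^sup>2) * C2 - (2 * a + 1) * x * C1 = - (M + 1) * (M + 1 + 2 * a) * C"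
    by (simp add: algebra_simps)
  then show ?thesis using Suc by (simp add: defs add_ac)
qed simp

definition omega_integral :: "real \<Rightarrow> real poly \<Rightarrow> real" where
  "omega_integral s p = (LINT x|I1. poly p x * om s x)"

lemma integrable_om_gt: "s > -1 \<Longrightarrow> integrable I1 (om s)"
  using integrable_om[of "s + 1"] by simp

lemma integrable_poly_om: "s > 0 \<Longrightarrow> integrable I1 (\<lambda>x. poly p x * om s x)"
  using integrable_I1_mult_poly[OF integrable_om_gt[of s], of p] by (simp add: mult.commute)

lemma omega_integral_add: "s > 0 \<Longrightarrow> omega_integral s (p + q) = omega_integral s p + omega_integral s
    q"
  unfolding omega_integral_def poly_add distrib_right
  by (rule Bochner_Integration.integral_add) (rule integrable_poly_om, assumption)+

lemma omega_integral_smult: "omega_integral s (smult c p) = c * omega_integral s p"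
  by (simp add: omega_integral_def mult.assoc)

lemma omega_integral_diff: "s > 0 \<Longrightarrow> omega_integral s (p - q) = omega_integral s p - omega_integral s
    q"
  unfolding omega_integral_def poly_diff left_diff_distrib
  by (rule Bochner_Integration.integral_diff) (rule integrable_poly_om, assumption)+

lemma omega_integral_0: "omega_integral s 0 = 0" by (simp add: omega_integral_def)

lemma omega_integral_sum: "s > 0 \<Longrightarrow> omega_integral s (\<Sum>i\<in>A. f i) = (\<Sum>i\<in>A. omega_integral s (f i))"
  by (induction A rule: infinite_finite_induct) (simp_all add: omega_integral_0 omega_integral_add)

lemma omega_integral_square_pos:
  assumes s: "s > 0" and p: "p \<noteq> 0"
  shows "omega_integral s (p * p) > 0"
proof -
  have nn: "poly (p * p) x * om s x \<ge> 0" for x using om_nonneg by simp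
  then have "omega_integral s (p * p) \<ge> 0" unfolding omega_integral_def
      by (intro Bochner_Integration.integral_nonneg)
  moreover have "omega_integral s (p * p) \<noteq> 0"
  proof
    assume "omega_integral s (p * p) = 0"
    then have "AE x in I1. poly (p * p) x * om s x = 0"
      unfolding omega_integral_def using nn by (subst (asm) integral_nonneg_eq_0_iff_AE[OF
          integrable_poly_om[OF s]]) auto
    moreover have "AE x in I1. x \<in> {-1<..<1}" by (rule AE_I1_mem)
    ultimately have "AE x in I1. poly p x = 0"
    proof eventually_elim
      case (elim x)
      then show ?case using om_pos[of x s] by simp
    qed
    then have "poly p x = 0" if "x \<in> {-1<..<1}" for x
      by (rule AE_zero_imp_zero_I1) (use that in \<open>auto intro!: continuous_intros\<close>)
    then have "{-1<..<1} \<subseteq> {x. poly p x = 0}" by blast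
    then have "finite {-1<..<1::real}" using poly_roots_finite[OF p] finite_subset by blast
    then show False by (simp add: infinite_Ioo)
  qed
  ultimately show ?thesis by simp
qed

lemma om_mult_one_minus_square: "om (s - 1) y * (1 - y\<^sup>2) = om s y" if "y \<in> {-1<..<1}"
  using that om_mult[of "s - 1" y 1] by (simp add: om_alt power2_eq_square algebra_simps)

text \<open>
  Gegenbauer's differential operator for the parameter \<open>\<alpha> = s + 1/2\<close>.
\<close>

definition gegen_op :: "real \<Rightarrow> real poly \<Rightarrow> real poly" where
  "gegen_op s p = [:1, 0, -1:] * pderiv (pderiv p) - smult (2 * s + 2) (pCons 0 (pderiv p))"

text \<open>
  The Sturm--Liouville form: \<open>\<omega>\<^sup>s\<close> times the operator is the derivative of \<open>\<omega>\<^sup>s (1 - x\<^sup>2) p'\<close>. The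
  right-hand side is symmetric in \<open>p\<close> and \<open>q\<close>.
\<close>

lemma gegen_op_energy:
  assumes s: "0 < s"
  shows "omega_integral s (gegen_op s p * q) = - omega_integral s ([:1, 0, -1:] * pderiv p
      * pderiv q)"
proof -
  let ?h = "[:1, 0, -1:] * pderiv p * q"
  let ?g = "gegen_op s p * q + [:1, 0, -1:] * pderiv p * pderiv q"
  obtain B where B: "\<forall>x\<in>{-1..1}. \<bar>poly ([:1, 0, -1:] * ?g) x\<bar> \<le> B" using poly_bounded_I1 by blast
  have "(LINT y|I1. om (s - 1) y * poly ([:1, 0, -1:] * ?g) y) = 0"
  proof (rule integral_deriv_om_zero[OF s, where h = "poly ?h" and h' = "poly (pderiv ?h)"])
    show "poly ([:1, 0, -1:] * ?g) y = poly (pderiv ?h) y * (1 - y\<^sup>2) - 2 * s * y * poly ?h y" for y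
      unfolding gegen_op_def pderiv_mult by (simp add: pderiv_pCons algebra_simps power2_eq_square)
    show "poly ([:1, 0, -1:] * ?g) \<in> borel_measurable I1" by (rule poly_measurable_I1)
    show "\<bar>poly ([:1, 0, -1:] * ?g) y\<bar> \<le> B" if "y \<in> {-1<..<1}" for y using B that by auto
  qed (intro continuous_intros poly_DERIV)+
  moreover have "(LINT y|I1. om (s - 1) y * poly ([:1, 0, -1:] * ?g) y) = omega_integral s ?g"
    unfolding omega_integral_def
  proof (intro Bochner_Integration.integral_cong refl)
    fix y assume "y \<in> space I1"
    then have "om (s - 1) y * (1 - y\<^sup>2) = om s y" by (intro om_mult_one_minus_square) (simp add:
        space_restrict_space)
    moreover have "om (s - 1) y * poly ([:1, 0, -1:] * ?g) y = poly ?g y * (om (s - 1) y * (1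
        - y\<^sup>2))"
      by (simp add: power2_eq_square algebra_simps)
    ultimately show "om (s - 1) y * poly ([:1, 0, -1:] * ?g) y = poly ?g y * om s y" by simp
  qed
  ultimately show ?thesis using omega_integral_add[OF s] by simp
qed

lemma gegen_op_symmetric: "0 < s \<Longrightarrow> omega_integral s (gegen_op s p * q) = omega_integral s (p
    * gegen_op s q)"
  using gegen_op_energy[of s p q] gegen_op_energy[of s q p] by (simp only: mult_ac)

lemma gegen_op_gegenbauer_poly: "gegen_op s (gegenbauer_poly (s + 1 / 2) n) = smult (- real n
    * (real n + 2 * s + 1)) (gegenbauer_poly (s + 1 / 2) n)"
proof (rule ccontr)
  let ?d = "gegen_op s (gegenbauer_poly (s + 1 / 2) n) - smult (- real n * (real n + 2 * s
      + 1)) (gegenbauer_poly (s + 1 / 2) n)"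
  assume "\<not> ?thesis"
  then have "finite {x. poly ?d x = 0}" by (intro poly_roots_finite) simp
  moreover have "poly ?d x = 0" if "x \<in> {-1<..<1}" for x
    using gegenbauer_poly_ode[OF that, of "s + 1 / 2" n] by (simp add: gegen_op_def power2_eq_square
        algebra_simps)
  then have "{-1<..<1} \<subseteq> {x. poly ?d x = 0}" by blast
  ultimately have "finite {-1<..<1::real}" using finite_subset by blast
  then show False by (simp add: infinite_Ioo)
qed

lemma gegenbauer_poly_orthogonal:
  assumes s: "0 < s" and nm: "n \<noteq> m"
  shows "omega_integral s (gegenbauer_poly (s + 1 / 2) n * gegenbauer_poly (s + 1 / 2) m) = 0"
proof -
  define \<mu> where "\<mu> n = - real n * (real n + 2 * s + 1)" for n
  have "\<mu> n \<noteq> \<mu> m"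
  proof
    assume "\<mu> n = \<mu> m"
    then have "(real n - real m) * (real n + real m + 2 * s + 1) = 0"
        by (simp add: \<mu>_def algebra_simps)
    moreover have "real n + real m + 2 * s + 1 > 0" using s by simp
    ultimately show False using nm by simp
  qed
  moreover have "\<mu> n * omega_integral s (gegenbauer_poly (s + 1 / 2) n * gegenbauer_poly (s
      + 1 / 2) m) = \<mu> m * omega_integral s (gegenbauer_poly (s + 1 / 2) n * gegenbauer_poly (s
      + 1 / 2) m)"
    using gegen_op_symmetric[OF s, of "gegenbauer_poly (s + 1 / 2) n" "gegenbauer_poly (s
        + 1 / 2) m"]
    unfolding gegen_op_gegenbauer_poly \<mu>_def[symmetric]
        by (simp only: mult_smult_left mult_smult_right omega_integral_smult)
  ultimately show ?thesis by simp
qed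

section \<open>Eigenvectors of the operator\<close>

definition gbasis :: "real \<Rightarrow> nat \<Rightarrow> real poly" where
  "gbasis s n = smult (1 / L2s_norm s (-1) 1 (gegenbauer (s + 1 / 2) n)) (gegenbauer_poly (s
      + 1 / 2) n)"

lemma poly_gbasis: "poly (gbasis s n) x = gegenbauer_normalized s n x"
  by (simp add: gbasis_def gegenbauer_normalized_def poly_gegenbauer_poly)

lemma L2s_norm_gegenbauer_poly: "L2s_norm s (-1) 1 (gegenbauer (s + 1 / 2) n)
    = sqrt (omega_integral s (gegenbauer_poly (s + 1 / 2) n * gegenbauer_poly (s + 1 / 2) n))"
  by (simp add: L2s_norm_def omega_integral_def poly_gegenbauer_poly power2_eq_square)

lemma gegenbauer_poly_neq_0: "a > 0 \<Longrightarrow> gegenbauer_poly a n \<noteq> 0"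
  using gegenbauer_poly_degree_lead[of a n] by auto

lemma L2s_norm_gegenbauer_poly_pos: "s > 0 \<Longrightarrow> L2s_norm s (-1) 1 (gegenbauer (s + 1 / 2) n) > 0"
  unfolding L2s_norm_gegenbauer_poly using omega_integral_square_pos[of s "gegenbauer_poly (s
      + 1 / 2) n"] gegenbauer_poly_neq_0 by simp

lemma gbasis_orthonormal:
  assumes s: "s > 0"
  shows "omega_integral s (gbasis s n * gbasis s m) = (if n = m then 1 else 0)"
proof (cases "n = m")
  case True
  let ?N = "L2s_norm s (-1) 1 (gegenbauer (s + 1 / 2) n)" and ?W
      = "omega_integral s (gegenbauer_poly (s + 1 / 2) n * gegenbauer_poly (s + 1 / 2) n)"
  have "omega_integral s (gbasis s n * gbasis s n) = (1 / ?N) * ((1 / ?N) * ?W)"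
    by (simp only: gbasis_def mult_smult_left mult_smult_right omega_integral_smult)
  then have *: "omega_integral s (gbasis s n * gbasis s n) = ?W / (?N * ?N)" by simp
  have W: "?W > 0" using s by (intro omega_integral_square_pos gegenbauer_poly_neq_0) auto
  have "?N * ?N = ?W" unfolding L2s_norm_gegenbauer_poly using W by simp
  with * have "omega_integral s (gbasis s n * gbasis s n) = 1" using W by simp
  then show ?thesis using True by simp
next
  case False
  then show ?thesis
    by (simp add: gbasis_def omega_integral_smult gegenbauer_poly_orthogonal[OF s False])
qed

lemma gbasis_lead:
  assumes "s > 0"
  shows "i > n \<Longrightarrow> coeff (gbasis s n) i = 0" "coeff (gbasis s n) n \<noteq> 0"
  using gegenbauer_poly_degree_lead[of "s + 1 / 2" n] L2s_norm_gegenbauer_poly_pos[OF assms, of n]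
      assms by (auto simp: gbasis_def)

lemma degree_gbasis: "s > 0 \<Longrightarrow> degree (gbasis s n) = n"
  using gbasis_lead[of s n] by (metis leading_coeff_0_iff le_degree le_neq_implies_less coeff_0)

text \<open>
  The assumption on coefficients expresses degree less than \<open>n\<close> and also covers \<open>n = 0\<close>.
\<close>

lemma gbasis_span:
  assumes s: "s > 0"
  shows "(\<And>i. i \<ge> n \<Longrightarrow> coeff p i = 0) \<Longrightarrow> \<exists>c. p = (\<Sum>j<n. smult (c j) (gbasis s j))"
proof (induction n arbitrary: p)
  case 0
  then show ?case by (simp add: poly_eq_iff)
next
  case (Suc n)
  define b where "b = coeff p n / coeff (gbasis s n) n"
  have "coeff (p - smult b (gbasis s n)) i = 0" if "i \<ge> n" for i
  proof (cases "i = n")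
    case True
    then show ?thesis using gbasis_lead(2)[OF s, of n] by (simp add: b_def)
  next
    case False
    then show ?thesis using Suc.prems[of i] gbasis_lead(1)[OF s, of n i] that by simp
  qed
  from Suc.IH[OF this] obtain c where "p - smult b (gbasis s n) = (\<Sum>j<n. smult (c j) (gbasis s j))"
      by blast
  then have "p = (\<Sum>j<n. smult (c j) (gbasis s j)) + smult b (gbasis s n)"
      by (simp add: algebra_simps)
  also have "\<dots> = (\<Sum>j<Suc n. smult ((c(n := b)) j) (gbasis s j))" by simp
  finally show ?case by blast
qed

lemma omega_integral_gbasis_lower:
  assumes s: "s > 0" and "degree p < n"
  shows "omega_integral s (gbasis s n * p) = 0"
proof -
  obtain c where c: "p = (\<Sum>j<n. smult (c j) (gbasis s j))"
    using gbasis_span[OF s, of n p] assms(2) by (auto simp: coeff_eq_0)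
  show ?thesis unfolding c sum_distrib_left omega_integral_sum[OF s]
    by (simp add: omega_integral_smult gbasis_orthonormal[OF s])
qed

lemma omega_integral_frac_lap_symmetric:
  assumes "0 < s" "s < 1"
  shows "omega_integral s (frac_lap_poly s p * q) = omega_integral s (p * frac_lap_poly s q)"
  using frac_lap_poly_symmetric[OF assms, of p q] by (simp add: omega_integral_def)

text \<open>
  By triangularity the difference \<open>d\<close> of both sides has degree less than \<open>n\<close>; by symmetry it is
  orthogonal to all polynomials of degree less than \<open>n\<close>, hence to itself.
\<close>

lemma frac_lap_poly_gbasis:
  assumes s: "0 < s" "s < 1"
  shows "frac_lap_poly s (gbasis s n) = smult (eigval s n) (gbasis s n)"
proof (rule ccontr)
  define d where "d = frac_lap_poly s (gbasis s n) - smult (eigval s n) (gbasis s n)"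
  assume "\<not> ?thesis"
  then have "d \<noteq> 0" by (simp add: d_def)
  note t = frac_lap_poly_triangular[OF s, of "gbasis s n" n]
  have dg: "degree (gbasis s n) = n" by (rule degree_gbasis[OF s(1)])
  have cd: "coeff d i = 0" if "i \<ge> n" for i
  proof (cases "i = n")
    case True
    then show ?thesis using t(2) dg by (simp add: d_def)
  next
    case False
    then show ?thesis using t(1) dg that by (simp add: d_def coeff_eq_0)
  qed
  obtain c where c: "d = (\<Sum>j<n. smult (c j) (gbasis s j))" using gbasis_span[OF s(1), of n d] cd
      by blast
  have "omega_integral s (d * gbasis s j) = 0" if "j < n" for j
  proof -
    have "degree (frac_lap_poly s (gbasis s j)) < n" using frac_lap_poly_triangular(1)[OF s, of
        "gbasis s j" j] degree_gbasis[OF s(1)] that by simp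
    then have "omega_integral s (frac_lap_poly s (gbasis s n) * gbasis s j) = 0"
      unfolding omega_integral_frac_lap_symmetric[OF s]
          by (rule omega_integral_gbasis_lower[OF s(1)])
    then show ?thesis using that gbasis_orthonormal[OF s(1), of n j]
      by (simp add: d_def left_diff_distrib omega_integral_diff[OF s(1)] omega_integral_smult)
  qed
  then have "omega_integral s (d * d) = 0"
    by (subst (2) c) (simp add: sum_distrib_left omega_integral_sum[OF s(1)] omega_integral_smult)
  then show False using omega_integral_square_pos[OF s(1) \<open>d \<noteq> 0\<close>] by simp
qed

section \<open>Gegenbauer expansions in the weighted square-integrable functions\<close>

lemma L2s_I1:
  "v \<in> L2s s (-1) 1 \<longleftrightarrow> v \<in> borel_measurable I1 \<and> integrable I1 (\<lambda>x. (v x)\<^sup>2 * om s x)"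
  by (simp add: L2s_def)

lemma om_measurable_I1: "om s \<in> borel_measurable I1"
  by (rule borel_measurable_I1) measurable

text \<open>
  The second claim uses \<open>\<bar>v\<bar> \<le> v\<^sup>2 \<omega>\<^sup>s + \<omega>\<^bsup>-s\<^esup>\<close> and the integrability of \<open>\<omega>\<^bsup>-s\<^esup>\<close>
      for \<open>s < 1\<close>. It gives
  every element of the space a continuous primitive.
\<close>

lemma L2s_integrable:
  assumes s: "0 < s" "s < 1" and v: "v \<in> L2s s (-1) 1"
  shows "integrable I1 (\<lambda>x. v x * om s x)" and "integrable I1 v"
proof -
  note om_measurable_I1 [measurable]
  have [measurable]: "v \<in> borel_measurable I1" and sq: "integrable I1 (\<lambda>x. (v x)\<^sup>2 * om s x)"
    using v by (auto simp: L2s_I1)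
  have "integrable I1 (\<lambda>x. (v x)\<^sup>2 * om s x + om s x)"
    using sq integrable_om_gt[of s] s by (intro Bochner_Integration.integrable_add) auto
  then show "integrable I1 (\<lambda>x. v x * om s x)"
  proof (rule Bochner_Integration.integrable_bound)
    show "AE x in I1. norm (v x * om s x) \<le> norm ((v x)\<^sup>2 * om s x + om s x)"
    proof (rule AE_I2)
      fix x
      have "\<bar>v x\<bar> \<le> (v x)\<^sup>2 + 1" using sum_squares_bound[of "\<bar>v x\<bar>" 1] by simp
      then have "\<bar>v x\<bar> * om s x \<le> ((v x)\<^sup>2 + 1) * om s x"
        by (intro mult_right_mono om_nonneg)
      then show "norm (v x * om s x) \<le> norm ((v x)\<^sup>2 * om s x + om s x)"
        using om_nonneg[of s "-1" 1 x] by (simp add: abs_mult distrib_right)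
    qed
  qed measurable
  have "integrable I1 (\<lambda>x. (v x)\<^sup>2 * om s x + om (- s) x)"
    using sq integrable_om_gt[of "- s"] s by (intro Bochner_Integration.integrable_add) auto
  then show "integrable I1 v"
  proof (rule Bochner_Integration.integrable_bound)
    show "AE x in I1. norm (v x) \<le> norm ((v x)\<^sup>2 * om s x + om (- s) x)"
    proof (rule AE_I2)
      fix x assume "x \<in> space I1"
      then have x: "x \<in> {-1<..<1}" by (simp add: space_restrict_space)
      define h where "h = om (s / 2) x"
      have h: "h > 0" "h * h = om s x" using om_pos[OF x, of "s / 2"] om_mult[of "s / 2" x "s / 2"]
          by (auto simp: h_def)
      have i: "h * om (- (s / 2)) x = 1" "om (- (s / 2)) x * om (- (s / 2)) x = om (- s) x"
        using om_mult[of "s / 2" x "- (s / 2)"] om_mult[of "- (s / 2)" x "- (s / 2)"] x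
            by (auto simp: h_def om_alt)
      have "2 * (\<bar>v x\<bar> * h) * om (- (s / 2)) x \<le> (\<bar>v x\<bar> * h)\<^sup>2 + (om (- (s / 2)) x)\<^sup>2"
        by (rule sum_squares_bound)
      also have "2 * (\<bar>v x\<bar> * h) * om (- (s / 2)) x = 2 * \<bar>v x\<bar> * (h * om (- (s / 2)) x)"
        by (simp only: mult_ac)
      also have "(\<bar>v x\<bar> * h)\<^sup>2 + (om (- (s / 2)) x)\<^sup>2 = (v x)\<^sup>2 * (h * h) + om (- s) x"
        using i(2) by (simp add: power2_eq_square mult_ac)
      finally have "\<bar>v x\<bar> \<le> (v x)\<^sup>2 * om s x + om (- s) x"
        using h i(1) by simp
      then show "norm (v x) \<le> norm ((v x)\<^sup>2 * om s x + om (- s) x)" by simp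
    qed
  qed measurable
qed

lemma L2s_scale: "v \<in> L2s s (-1) 1 \<Longrightarrow> (\<lambda>x. c * v x) \<in> L2s s (-1) 1"
  by (auto simp: L2s_I1 power_mult_distrib mult.assoc)

lemma L2s_add:
  assumes "u \<in> L2s s (-1) 1" "v \<in> L2s s (-1) 1"
  shows "(\<lambda>x. u x + v x) \<in> L2s s (-1) 1"
proof -
  note om_measurable_I1 [measurable]
  have [measurable]: "u \<in> borel_measurable I1" "v \<in> borel_measurable I1" using assms
      by (auto simp: L2s_I1)
  have "integrable I1 (\<lambda>x. 2 * ((u x)\<^sup>2 * om s x) + 2 * ((v x)\<^sup>2 * om s x))"
    using assms by (intro Bochner_Integration.integrable_add integrable_mult_right) (auto simp:
        L2s_I1)
  then have "integrable I1 (\<lambda>x. (u x + v x)\<^sup>2 * om s x)"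
  proof (rule Bochner_Integration.integrable_bound)
    show "AE x in I1. norm ((u x + v x)\<^sup>2 * om s x) \<le> norm (2 * ((u x)\<^sup>2 * om s x) + 2 * ((v x)\<^sup>2
        * om s x))"
    proof (rule AE_I2)
      fix x
      have "(u x + v x)\<^sup>2 \<le> 2 * (u x)\<^sup>2 + 2 * (v x)\<^sup>2" using sum_squares_bound[of "u x" "v x"]
          by (simp add: power2_sum)
      then have "(u x + v x)\<^sup>2 * om s x \<le> (2 * (u x)\<^sup>2 + 2 * (v x)\<^sup>2) * om s x"
        by (intro mult_right_mono om_nonneg)
      then show "norm ((u x + v x)\<^sup>2 * om s x) \<le> norm (2 * ((u x)\<^sup>2 * om s x) + 2 * ((v x)\<^sup>2
          * om s x))"
        using om_nonneg[of s "-1" 1 x] by (simp add: abs_mult distrib_right mult.assoc)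
    qed
  qed measurable
  then show ?thesis by (simp add: L2s_I1)
qed

lemma L2s_poly: "s > 0 \<Longrightarrow> poly p \<in> L2s s (-1) 1"
  using integrable_poly_om[of s "p * p"] by (simp add: L2s_I1 poly_measurable_I1 power2_eq_square)

lemma gegenbauer_coeff_eq: "gegenbauer_coeff s v j = (LINT x|I1. v x * om s x * poly (gbasis s j)
    x)"
  unfolding gegenbauer_coeff_def poly_gbasis by (simp add: mult_ac)

lemma coeff_integrable:
  assumes "0 < s" "s < 1" "v \<in> L2s s (-1) 1"
  shows "integrable I1 (\<lambda>x. v x * om s x * poly p x)"
  using L2s_integrable(1)[OF assms] by (rule integrable_I1_mult_poly)

lemma coeff_add:
  assumes "0 < s" "s < 1" "u \<in> L2s s (-1) 1" "v \<in> L2s s (-1) 1"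
  shows "gegenbauer_coeff s (\<lambda>x. u x + v x) j = gegenbauer_coeff s u j + gegenbauer_coeff s v j"
  unfolding gegenbauer_coeff_eq distrib_right using assms by (intro Bochner_Integration.integral_add
      coeff_integrable)

lemma coeff_scale: "gegenbauer_coeff s (\<lambda>x. c * v x) j = c * gegenbauer_coeff s v j"
  unfolding gegenbauer_coeff_eq by (simp add: mult.assoc)

lemma coeff_cong_AE:
  assumes "u \<in> borel_measurable I1" "v \<in> borel_measurable I1" "AE x in I1. u x = v x"
  shows "gegenbauer_coeff s u j = gegenbauer_coeff s v j"
  unfolding gegenbauer_coeff_eq
proof (rule integral_cong_AE)
  note om_measurable_I1 [measurable] poly_measurable_I1 [measurable] assms(1,2) [measurable]
  show "(\<lambda>x. u x * om s x * poly (gbasis s j) x) \<in> borel_measurable I1"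
    "(\<lambda>x. v x * om s x * poly (gbasis s j) x) \<in> borel_measurable I1" by measurable
  show "AE x in I1. u x * om s x * poly (gbasis s j) x = v x * om s x * poly (gbasis s j) x"
    using assms(3) by eventually_elim simp
qed

text \<open>
  All moments of the integrable function \<open>v \<omega>\<^sup>s\<close> vanish.
\<close>

lemma L2s_zero_if_coeff_zero:
  assumes s: "0 < s" "s < 1" and v: "v \<in> L2s s (-1) 1" and c: "\<And>j. gegenbauer_coeff s v j = 0"
  shows "AE x in I1. v x = 0"
proof -
  have "(LINT x|I1. v x * om s x * poly p x) = 0" for p
  proof -
    obtain b where b: "p = (\<Sum>j<Suc (degree p). smult (b j) (gbasis s j))"
      using gbasis_span[OF s(1), of "Suc (degree p)" p] by (auto simp: coeff_eq_0)
    have "(LINT x|I1. v x * om s x * poly (\<Sum>j<Suc (degree p). smult (b j) (gbasis s j)) x)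
      = (LINT x|I1. (\<Sum>j<Suc (degree p). b j * (v x * om s x * poly (gbasis s j) x)))"
      by (simp only: poly_sum poly_smult sum_distrib_left mult_ac)
    also have "\<dots> = (\<Sum>j<Suc (degree p). b j * gegenbauer_coeff s v j)"
      unfolding gegenbauer_coeff_eq using coeff_integrable[OF s v]
          by (subst Bochner_Integration.integral_sum) auto
    also have "\<dots> = 0" by (simp add: c)
    finally show ?thesis by (simp only: b[symmetric])
  qed
  then have "AE x in I1. v x * om s x = 0"
    by (intro AE_zero_if_moments_zero L2s_integrable(1)[OF s v])
  moreover have "AE x in I1. x \<in> {-1<..<1}" by (rule AE_I1_mem)
  ultimately show ?thesis
  proof eventually_elim
    case (elim x)
    then show ?case using om_pos[of x s] by simp
  qed
qed

lemma omega_integral_square_sum: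
  assumes "s > 0" "finite A"
  shows "omega_integral s ((\<Sum>j\<in>A. smult (c j) (gbasis s j)) * (\<Sum>j\<in>A. smult (c j) (gbasis s j)))
      = (\<Sum>j\<in>A. (c j)\<^sup>2)"
proof -
  have "omega_integral s ((\<Sum>j\<in>A. smult (c j) (gbasis s j)) * (\<Sum>j\<in>A. smult (c j) (gbasis s j)))
     = (\<Sum>i\<in>A. \<Sum>j\<in>A. c i * (c j * omega_integral s (gbasis s i * gbasis s j)))"
    unfolding sum_product omega_integral_sum[OF assms(1)]
    by (simp only: mult_smult_left mult_smult_right omega_integral_smult mult_ac)
  also have "\<dots> = (\<Sum>i\<in>A. (c i)\<^sup>2)"
    by (intro sum.cong refl) (simp add: gbasis_orthonormal[OF assms(1)] assms(2) power2_eq_square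
        if_distrib cong: if_cong)
  finally show ?thesis .
qed

text \<open>
  Blocks of the series whose squared norms are at most \<open>4\<^bsup>-k\<^esup>\<close> have \<open>L\<^sup>1\<close> norms summable in \<open>k\<close>. So
  the blocked series converges absolutely almost everywhere and in \<open>L\<^sup>1\<close>. Fatou's lemma puts the
  limit into the weighted \<open>L\<^sup>2\<close> space, and \<open>L\<^sup>1\<close> convergence suffices for the coefficients because
  the basis functions are bounded.
\<close>

lemma Riesz_Fischer_gegenbauer:
  assumes s: "0 < s" "s < 1" and c: "summable (\<lambda>j. (c j)\<^sup>2)"
  shows "\<exists>v\<in>L2s s (-1) 1. \<forall>j. gegenbauer_coeff s v j = c j"
proof -
  define P where "P A = (\<Sum>j\<in>A. smult (c j) (gbasis s j))" for A
  note om_measurable_I1 [measurable] poly_measurable_I1 [measurable]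
  let ?w = "om s"
  have "\<forall>k. \<exists>N. \<forall>m\<ge>N. \<forall>n. (\<Sum>j\<in>{m..<n}. (c j)\<^sup>2) < (1 / 4) ^ k"
  proof
    fix k :: nat
    have "(1 / 4 :: real) ^ k > 0" by simp
    then obtain N where N: "\<forall>m\<ge>N. \<forall>n. norm (\<Sum>j\<in>{m..<n}. (c j)\<^sup>2) < (1 / 4) ^ k"
      using c unfolding summable_Cauchy by blast
    have "(\<Sum>j\<in>{m..<n}. (c j)\<^sup>2) < (1 / 4) ^ k" if "m \<ge> N" for m n
      using N that by (smt (verit) real_norm_def)
    then show "\<exists>N. \<forall>m\<ge>N. \<forall>n. (\<Sum>j\<in>{m..<n}. (c j)\<^sup>2) < (1 / 4) ^ k" by blast
  qed
  then obtain N where N: "\<And>k m n. m \<ge> N k \<Longrightarrow> (\<Sum>j\<in>{m..<n}. (c j)\<^sup>2) < (1 / 4) ^ k" by metis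
  \<comment> \<open>Block ends beyond \<open>N k\<close> that increase and tend to infinity.\<close>
  define n where "n k = (\<Sum>i\<le>k. N i) + k" for k
  have n_ge: "n k \<ge> N k" "n k \<ge> k" for k by (auto simp: n_def intro: trans_le_add1 member_le_sum)
  have n_mono: "n k \<le> n (Suc k)" for k by (simp add: n_def)
  define d where "d k = P {n k..<n (Suc k)}" for k
  have partial: "P {..<n 0} + (\<Sum>k<K. d k) = P {..<n K}" for K
  proof (induction K)
    case (Suc K)
    have "P {..<n K} + d K = P {..<n (Suc K)}" unfolding P_def d_def
      using sum.atLeastLessThan_concat[of 0 "n K" "n (Suc K)" "\<lambda>j. smult (c j) (gbasis s j)"]
          n_mono[of K]
      by (simp add: atLeast0LessThan)
    then show ?case using Suc by (simp add: add.assoc[symmetric])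
  qed simp
  define m where "m = (LINT x|I1. ?w x)"
  have m: "m \<ge> 0" unfolding m_def by (intro Bochner_Integration.integral_nonneg om_nonneg)
  have int_d: "integrable I1 (\<lambda>x. \<bar>poly (d k) x\<bar> * ?w x)" for k
  proof -
    have "integrable I1 (\<lambda>x. norm (poly (d k) x * ?w x))"
        by (intro integrable_norm integrable_poly_om s)
    then show ?thesis using om_nonneg by (simp add: abs_mult)
  qed
  have bound_d: "(LINT x|I1. \<bar>poly (d k) x\<bar> * ?w x) \<le> (1 + m) * (1 / 2) ^ k" for k
  proof -
    have "(LINT x|I1. \<bar>poly (d k) x\<bar> * ?w x) \<le> (LINT x|I1. 2 ^ k * (poly (d k * d k) x * ?w x)
        + (1 / 2) ^ k * ?w x)"
    proof (rule integral_mono[OF int_d])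
      show "integrable I1 (\<lambda>x. 2 ^ k * (poly (d k * d k) x * ?w x) + (1 / 2) ^ k * ?w x)"
        using s by (intro Bochner_Integration.integrable_add integrable_mult_right
            integrable_poly_om integrable_om_gt) auto
      fix x
      \<comment> \<open>The weights balance the bounds \<open>4\<^bsup>-k\<^esup>\<close> for the square and \<open>2\<^bsup>-k\<^esup>\<close> for the mass term.\<close>
      have "0 \<le> 2 ^ k * (\<bar>poly (d k) x\<bar> - (1 / 2) ^ k)\<^sup>2" by simp
      also have "\<dots> = 2 ^ k * (poly (d k) x)\<^sup>2 - 2 * (2 ^ k * (1 / 2) ^ k) * \<bar>poly (d k) x\<bar> + (2 ^ k
          * (1 / 2) ^ k) * (1 / 2) ^ k"
        by (simp add: power2_eq_square algebra_simps)
      also have "(2 :: real) ^ k * (1 / 2) ^ k = 1" by (simp flip: power_mult_distrib)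
      finally have "\<bar>poly (d k) x\<bar> \<le> 2 ^ k * poly (d k * d k) x + (1 / 2) ^ k"
          by (simp add: power2_eq_square)
      then have "\<bar>poly (d k) x\<bar> * ?w x \<le> (2 ^ k * poly (d k * d k) x + (1 / 2) ^ k) * ?w x"
        by (intro mult_right_mono om_nonneg)
      then show "\<bar>poly (d k) x\<bar> * ?w x \<le> 2 ^ k * (poly (d k * d k) x * ?w x) + (1 / 2) ^ k * ?w x"
        by (simp only: distrib_right mult.assoc)
    qed
    also have "\<dots> = 2 ^ k * omega_integral s (d k * d k) + (1 / 2) ^ k * m"
      unfolding omega_integral_def m_def using s integrable_poly_om[OF s(1)] integrable_om_gt[of s]
      by (subst Bochner_Integration.integral_add) (auto simp del: poly_mult)
    also have "omega_integral s (d k * d k) = (\<Sum>j\<in>{n k..<n (Suc k)}. (c j)\<^sup>2)"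
      unfolding d_def P_def by (rule omega_integral_square_sum[OF s(1)]) simp
    also have "2 ^ k * \<dots> \<le> 2 ^ k * (1 / 4) ^ k"
      using N[OF n_ge(1), of k "n (Suc k)"] by (intro mult_left_mono) auto
    also have "(2 :: real) ^ k * (1 / 4) ^ k = (1 / 2) ^ k" by (simp flip: power_mult_distrib)
    finally show ?thesis by (simp add: algebra_simps)
  qed
  have sum_d: "summable (\<lambda>k. LINT x|I1. \<bar>poly (d k) x\<bar> * ?w x)"
  proof (rule summable_comparison_test')
    show "summable (\<lambda>k. (1 + m) * (1 / 2 :: real) ^ k)" by (intro summable_mult summable_geometric)
        simp
    show "norm (LINT x|I1. \<bar>poly (d k) x\<bar> * ?w x) \<le> (1 + m) * (1 / 2) ^ k" for k
      using bound_d[of k] Bochner_Integration.integral_nonneg[of I1 "\<lambda>x. \<bar>poly (d k) x\<bar>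
          * ?w x"] om_nonneg by simp
  qed
  have inI: "AE x in I1. x \<in> {-1<..<1}" by (rule AE_I1_mem)
  have AE_sum: "AE x in I1. summable (\<lambda>k. \<bar>poly (d k) x\<bar>)"
  proof -
    have "(\<integral>\<^sup>+x. (\<Sum>k. ennreal (\<bar>poly (d k) x\<bar> * ?w x)) \<partial>I1) = (\<Sum>k. \<integral>\<^sup>+x. ennreal (\<bar>poly (d k) x\<bar>
        * ?w x) \<partial>I1)"
      by (rule nn_integral_suminf) measurable
    also have "\<dots> = (\<Sum>k. ennreal (LINT x|I1. \<bar>poly (d k) x\<bar> * ?w x))"
      using om_nonneg by (intro arg_cong[where f = suminf] ext nn_integral_eq_integral int_d) auto
    also have "\<dots> \<noteq> \<infinity>"
      unfolding infinity_ennreal_def using om_nonneg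
      by (intro ennreal_suminf_neq_top[OF sum_d] Bochner_Integration.integral_nonneg) auto
    finally have "AE x in I1. (\<Sum>k. ennreal (\<bar>poly (d k) x\<bar> * ?w x)) \<noteq> \<infinity>"
      by (intro nn_integral_noteq_infinite) measurable
    then show ?thesis using inI
    proof eventually_elim
      case (elim x)
      have "summable (\<lambda>k. \<bar>poly (d k) x\<bar> * ?w x)"
        by (rule summable_suminf_not_top) (use elim om_nonneg in auto)
      then have "summable (\<lambda>k. \<bar>poly (d k) x\<bar> * ?w x * inverse (?w x))" by (rule summable_mult2)
      then show ?case using om_pos[OF elim(2), of s] by (simp add: mult.assoc)
    qed
  qed
  define v where "v x = poly (P {..<n 0}) x + (\<Sum>k. poly (d k) x)" for x
  have v_meas [measurable]: "v \<in> borel_measurable I1" unfolding v_def by measurable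
  have v_lim: "AE x in I1. (\<lambda>K. poly (P {..<n K}) x) \<longlonglongrightarrow> v x"
    using AE_sum
  proof eventually_elim
    case (elim x)
    then have "(\<lambda>k. poly (d k) x) sums (\<Sum>k. poly (d k) x)"
        by (rule summable_sums[OF summable_rabs_cancel])
    then have "(\<lambda>K. poly (P {..<n 0}) x + (\<Sum>k<K. poly (d k) x)) \<longlonglongrightarrow> v x"
      unfolding sums_def v_def by (intro tendsto_intros)
    moreover have "poly (P {..<n 0}) x + (\<Sum>k<K. poly (d k) x) = poly (P {..<n K}) x" for K
      using arg_cong[OF partial[of K], of "\<lambda>p. poly p x"] by (simp add: poly_sum)
    ultimately show ?case by simp
  qed
  have "integrable I1 (\<lambda>x. (v x)\<^sup>2 * ?w x)"
  proof (rule integrableI_bounded)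
    have "(\<integral>\<^sup>+x. ennreal (norm ((v x)\<^sup>2 * ?w x)) \<partial>I1) = (\<integral>\<^sup>+x. liminf (\<lambda>K. ennreal ((poly (P {..<n
        K}) x)\<^sup>2 * ?w x)) \<partial>I1)"
    proof (rule nn_integral_cong_AE)
      show "AE x in I1. ennreal (norm ((v x)\<^sup>2 * ?w x)) = liminf (\<lambda>K. ennreal ((poly (P {..<n K})
          x)\<^sup>2 * ?w x))"
        using v_lim
      proof eventually_elim
        case (elim x)
        have "(\<lambda>K. ennreal ((poly (P {..<n K}) x)\<^sup>2 * ?w x)) \<longlonglongrightarrow> ennreal ((v x)\<^sup>2 * ?w x)"
          by (intro tendsto_ennrealI tendsto_mult tendsto_power elim tendsto_const)
        then show ?case using lim_imp_Liminf[OF trivial_limit_sequentially] om_nonneg by fastforce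
      qed
    qed
    also have "\<dots> \<le> liminf (\<lambda>K. \<integral>\<^sup>+x. ennreal ((poly (P {..<n K}) x)\<^sup>2 * ?w x) \<partial>I1)"
      by (rule nn_integral_liminf) measurable
    also have "\<dots> \<le> ennreal (\<Sum>j. (c j)\<^sup>2)"
    proof (rule Liminf_le)
      show "\<forall>\<^sub>F K in sequentially. (\<integral>\<^sup>+x. ennreal ((poly (P {..<n K}) x)\<^sup>2 * ?w x) \<partial>I1)
          \<le> ennreal (\<Sum>j. (c j)\<^sup>2)"
      proof (rule always_eventually, rule allI)
        fix K
        have "(\<integral>\<^sup>+x. ennreal ((poly (P {..<n K}) x)\<^sup>2 * ?w x) \<partial>I1)
            = (\<integral>\<^sup>+x. ennreal (poly (P {..<n K} * P {..<n K}) x * ?w x) \<partial>I1)"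
          by (simp add: power2_eq_square)
        also have "\<dots> = ennreal (omega_integral s (P {..<n K} * P {..<n K}))"
          unfolding omega_integral_def using om_nonneg
              by (intro nn_integral_eq_integral integrable_poly_om s) auto
        also have "omega_integral s (P {..<n K} * P {..<n K}) = (\<Sum>j<n K. (c j)\<^sup>2)"
          unfolding P_def by (rule omega_integral_square_sum[OF s(1)]) simp
        also have "ennreal \<dots> \<le> ennreal (\<Sum>j. (c j)\<^sup>2)"
          by (intro ennreal_leI sum_le_suminf c) auto
        finally show "(\<integral>\<^sup>+x. ennreal ((poly (P {..<n K}) x)\<^sup>2 * ?w x) \<partial>I1)
            \<le> ennreal (\<Sum>j. (c j)\<^sup>2)" .
      qed
    qed simp
    finally show "(\<integral>\<^sup>+x. ennreal (norm ((v x)\<^sup>2 * ?w x)) \<partial>I1) < \<infinity>"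
      using ennreal_less_top le_less_trans by (metis infinity_ennreal_def)
  qed measurable
  then have vL: "v \<in> L2s s (-1) 1" by (simp add: L2s_I1)
  have "gegenbauer_coeff s v j = c j" for j
  proof -
    let ?e = "poly (gbasis s j)"
    obtain B where B: "\<forall>x\<in>{-1..1}. \<bar>?e x\<bar> \<le> B" using poly_bounded_I1 by blast
    let ?f = "\<lambda>k x. poly (d k) x * ?w x * ?e x"
    have f_int: "integrable I1 (?f k)" for k
      by (rule integrable_I1_mult_poly[OF integrable_poly_om[OF s(1)]])
    have f_le: "norm (?f k x) \<le> \<bar>B\<bar> * (\<bar>poly (d k) x\<bar> * ?w x)" if "x \<in> {-1<..<1}" for k x
    proof -
      have "\<bar>?e x\<bar> \<le> B" using B that by auto
      then have "\<bar>?e x\<bar> \<le> \<bar>B\<bar>" by linarith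
      then have "(\<bar>poly (d k) x\<bar> * ?w x) * \<bar>?e x\<bar> \<le> (\<bar>poly (d k) x\<bar> * ?w x) * \<bar>B\<bar>"
        using om_nonneg by (intro mult_left_mono) auto
      then show ?thesis using om_nonneg[of s "-1" 1 x] by (simp add: abs_mult mult_ac)
    qed
    have "(\<lambda>k. integral\<^sup>L I1 (?f k)) sums (LINT x|I1. (\<Sum>k. ?f k x))"
    proof (rule sums_integral[OF f_int])
      show "AE x in I1. summable (\<lambda>k. norm (?f k x))"
        using AE_sum
      proof eventually_elim
        case (elim x)
        then have "summable (\<lambda>k. \<bar>poly (d k) x\<bar> * (?w x * \<bar>?e x\<bar>))" by (rule summable_mult2)
        then show ?case using om_nonneg[of s "-1" 1 x] by (simp add: abs_mult mult_ac)
      qed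
      show "summable (\<lambda>k. LINT x|I1. norm (?f k x))"
      proof (rule summable_comparison_test')
        show "summable (\<lambda>k. \<bar>B\<bar> * (LINT x|I1. \<bar>poly (d k) x\<bar> * ?w x))"
            by (rule summable_mult[OF sum_d])
        fix k
        have "(LINT x|I1. norm (?f k x)) \<le> (LINT x|I1. \<bar>B\<bar> * (\<bar>poly (d k) x\<bar> * ?w x))"
          by (intro integral_mono integrable_norm f_int integrable_mult_right int_d f_le) (simp add:
              space_restrict_space)
        then show "norm (LINT x|I1. norm (?f k x)) \<le> \<bar>B\<bar> * (LINT x|I1. \<bar>poly (d k) x\<bar> * ?w x)"
            by simp
      qed
    qed
    then have "(\<lambda>K. (LINT x|I1. poly (P {..<n 0}) x * ?w x * ?e x) + (\<Sum>k<K. integral\<^sup>L I1 (?f k)))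
       \<longlonglongrightarrow> (LINT x|I1. poly (P {..<n 0}) x * ?w x * ?e x) + (LINT x|I1. (\<Sum>k. ?f k x))"
      unfolding sums_def by (intro tendsto_intros)
    moreover have "(LINT x|I1. poly (P {..<n 0}) x * ?w x * ?e x) + (LINT x|I1. (\<Sum>k. ?f k x))
        = gegenbauer_coeff s v j"
    proof -
      have int_v: "integrable I1 (\<lambda>x. v x * ?w x * ?e x)" by (rule coeff_integrable[OF s vL])
      have int_0: "integrable I1 (\<lambda>x. poly (P {..<n 0}) x * ?w x * ?e x)"
        by (rule integrable_I1_mult_poly[OF integrable_poly_om[OF s(1)]])
      have "(LINT x|I1. (\<Sum>k. ?f k x)) = (LINT x|I1. v x * ?w x * ?e x - poly (P {..<n 0}) x * ?w x
          * ?e x)"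
      proof (rule integral_cong_AE)
        show "AE x in I1. (\<Sum>k. ?f k x) = v x * ?w x * ?e x - poly (P {..<n 0}) x * ?w x * ?e x"
          using AE_sum
        proof eventually_elim
          case (elim x)
          then have "summable (\<lambda>k. poly (d k) x)" by (rule summable_rabs_cancel)
          from suminf_mult2[OF this, of "?w x * ?e x"]
          show ?case by (simp add: v_def algebra_simps)
        qed
      qed measurable
      also have "\<dots> = (LINT x|I1. v x * ?w x * ?e x) - (LINT x|I1. poly (P {..<n 0}) x * ?w x
          * ?e x)"
        by (rule Bochner_Integration.integral_diff[OF int_v int_0])
      finally show ?thesis by (simp add: gegenbauer_coeff_eq)
    qed
    moreover have "(LINT x|I1. poly (P {..<n 0}) x * ?w x * ?e x) + (\<Sum>k<K. integral\<^sup>L I1 (?f k))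
        = omega_integral s (P {..<n K} * gbasis s j)" for K
    proof -
      have W: "(LINT x|I1. poly q x * ?w x * ?e x) = omega_integral s (q * gbasis s j)" for q
        by (simp add: omega_integral_def mult_ac)
      show ?thesis using arg_cong[OF partial[of K], of "\<lambda>p. omega_integral s (p * gbasis s j)"]
        by (simp add: W distrib_right omega_integral_add[OF s(1)] sum_distrib_right
            omega_integral_sum[OF s(1)])
    qed
    moreover have "(\<lambda>K. omega_integral s (P {..<n K} * gbasis s j)) \<longlonglongrightarrow> c j"
    proof (rule tendsto_eventually)
      have "omega_integral s (P {..<n K} * gbasis s j) = c j" if "K > j" for K
      proof -
        have "j < n K" using n_ge(2)[of K] that by simp
        have "omega_integral s (P {..<n K} * gbasis s j) = (\<Sum>i<n K. c i * (if i = j then 1 else 0))"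
          unfolding P_def sum_distrib_right omega_integral_sum[OF s(1)]
          by (simp only: mult_smult_left omega_integral_smult gbasis_orthonormal[OF s(1)])
        also have "\<dots> = c j" using \<open>j < n K\<close> by (simp add: if_distrib cong: if_cong)
        finally show ?thesis .
      qed
      then show "\<forall>\<^sub>F K in sequentially. omega_integral s (P {..<n K} * gbasis s j) = c j"
        using eventually_gt_at_top[of j] by (elim eventually_mono) simp
    qed
    ultimately show ?thesis using LIMSEQ_unique by force
  qed
  with vL show ?thesis by blast
qed

section \<open>The operator on continuously differentiable functions\<close>

text \<open>
  Potentials of polynomials are polynomials, and the uniform bound on the kernel turns uniform
  approximation of the density into uniform approximation of the potential.
\<close>

lemma riesz_pot_continuous_on:
  assumes s: "0 < s" "s < 1" and h: "continuous_on {-1..1} h"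
  shows "continuous_on {-1<..<1} (riesz_pot s h)"
proof -
  obtain M where M: "\<And>x. x \<in> {-1<..<1} \<Longrightarrow> (LINT y|I1. \<bar>riesz_kernel s (x - y) * om (s - 1) y\<bar>) \<le> M"
    using riesz_kernel_abs_integral_bound[OF s] by blast
  obtain A where A: "h \<in> borel_measurable I1" "\<And>y. y \<in> {-1<..<1} \<Longrightarrow> \<bar>h y\<bar> \<le> A"
    using continuous_on_I1_bounded[OF h] by blast
  have "\<forall>n. \<exists>p. \<forall>x\<in>{-1..1}. \<bar>h x - poly p x\<bar> < inverse (real (Suc n))"
    by (intro allI weierstrass_real_poly[OF h]) simp
  then obtain p where p: "\<And>n x. x \<in> {-1..1} \<Longrightarrow> \<bar>h x - poly (p n) x\<bar> < inverse (real (Suc n))"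
      by metis
  have close: "\<bar>riesz_pot s (poly (p n)) x - riesz_pot s h x\<bar> \<le> inverse (real (Suc n)) * M"
      if x: "x \<in> {-1<..<1}" for n x
  proof -
    obtain B where B: "\<forall>y\<in>{-1..1}. \<bar>poly (p n) y\<bar> \<le> B" using poly_bounded_I1 by blast
    let ?k = "\<lambda>y. riesz_kernel s (x - y) * om (s - 1) y"
    have i1: "integrable I1 (\<lambda>y. ?k y * poly (p n) y)"
        by (rule integrable_I1_mult_poly[OF riesz_kernel_integrable[OF s x]])
    have i2: "integrable I1 (\<lambda>y. ?k y * h y)" by (rule riesz_pot_integrable[OF s x A])
    have eq: "riesz_pot s (poly (p n)) x - riesz_pot s h x = (LINT y|I1. ?k y * poly (p n) y - ?k y
        * h y)"
      unfolding riesz_pot_def by (rule Bochner_Integration.integral_diff[symmetric, OF i1 i2])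
    have "\<bar>riesz_pot s (poly (p n)) x - riesz_pot s h x\<bar> \<le> (LINT y|I1. \<bar>?k y * poly (p n) y - ?k y
        * h y\<bar>)"
      unfolding eq by (rule integral_abs_bound)
    also have "\<dots> \<le> (LINT y|I1. inverse (real (Suc n)) * \<bar>?k y\<bar>)"
    proof (rule integral_mono)
      show "integrable I1 (\<lambda>y. \<bar>?k y * poly (p n) y - ?k y * h y\<bar>)"
        by (rule integrable_abs[OF Bochner_Integration.integrable_diff[OF i1 i2]])
      show "integrable I1 (\<lambda>y. inverse (real (Suc n)) * \<bar>?k y\<bar>)"
        by (rule integrable_mult_right[OF integrable_abs[OF riesz_kernel_integrable[OF s x]]])
      fix y assume "y \<in> space I1"
      then have "\<bar>h y - poly (p n) y\<bar> \<le> inverse (real (Suc n))" using p[of y n]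
          by (simp add: space_restrict_space)
      then have "\<bar>?k y\<bar> * \<bar>h y - poly (p n) y\<bar> \<le> \<bar>?k y\<bar> * inverse (real (Suc n))"
          by (rule mult_left_mono) simp
      moreover have "\<bar>?k y * poly (p n) y - ?k y * h y\<bar> = \<bar>?k y\<bar> * \<bar>h y - poly (p n) y\<bar>"
        by (simp only: right_diff_distrib[symmetric] abs_mult abs_minus_commute[of "h y"])
      ultimately show "\<bar>?k y * poly (p n) y - ?k y * h y\<bar> \<le> inverse (real (Suc n)) * \<bar>?k y\<bar>"
        by (simp only: mult.commute)
    qed
    also have "\<dots> = inverse (real (Suc n)) * (LINT y|I1. \<bar>?k y\<bar>)" by simp
    also have "\<dots> \<le> inverse (real (Suc n)) * M" using M[OF x] by (intro mult_left_mono) auto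
    finally show ?thesis .
  qed
  show ?thesis
  proof (rule uniform_limit_theorem[of _ "\<lambda>n. riesz_pot s (poly (p n))" sequentially])
    show "\<forall>\<^sub>F n in sequentially. continuous_on {-1<..<1} (riesz_pot s (poly (p n)))"
    proof (rule always_eventually, rule allI)
      fix n
      have "continuous_on {-1<..<1} (poly (riesz_poly s (p n)))" by (intro continuous_intros)
      then show "continuous_on {-1<..<1} (riesz_pot s (poly (p n)))"
        by (rule continuous_on_eq) (simp add: riesz_poly(3)[OF s])
    qed
    show "uniform_limit {-1<..<1} (\<lambda>n. riesz_pot s (poly (p n))) (riesz_pot s h) sequentially"
    proof (rule uniform_limitI)
      fix e :: real assume "e > 0"
      have "(\<lambda>n. inverse (real (Suc n)) * M) \<longlonglongrightarrow> 0 * M"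
        by (intro tendsto_mult LIMSEQ_inverse_real_of_nat tendsto_const)
      then have "\<forall>\<^sub>F n in sequentially. inverse (real (Suc n)) * M < e"
        using \<open>e > 0\<close> by (intro order_tendstoD) simp_all
      then show "\<forall>\<^sub>F n in sequentially. \<forall>x\<in>{-1<..<1}. dist (riesz_pot s (poly (p n)) x) (riesz_pot s
          h x) < e"
      proof eventually_elim
        case (elim n)
        show ?case using le_less_trans[OF close elim] by (simp add: dist_real_def)
      qed
    qed
  qed simp
qed

lemma riesz_pot_bounded:
  assumes s: "0 < s" "s < 1" and h: "h \<in> borel_measurable I1" "\<And>y. y \<in> {-1<..<1} \<Longrightarrow> \<bar>h y\<bar> \<le> B"
  obtains C where "\<And>x. x \<in> {-1<..<1} \<Longrightarrow> \<bar>riesz_pot s h x\<bar> \<le> C"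
proof -
  obtain M where M: "\<And>x. x \<in> {-1<..<1} \<Longrightarrow> (LINT y|I1. \<bar>riesz_kernel s (x - y) * om (s - 1) y\<bar>) \<le> M"
    using riesz_kernel_abs_integral_bound[OF s] by blast
  have "\<bar>riesz_pot s h x\<bar> \<le> \<bar>B\<bar> * M" if x: "x \<in> {-1<..<1}" for x
  proof -
    let ?k = "\<lambda>y. riesz_kernel s (x - y) * om (s - 1) y"
    have "\<bar>riesz_pot s h x\<bar> \<le> (LINT y|I1. \<bar>?k y * h y\<bar>)" unfolding riesz_pot_def
        by (rule integral_abs_bound)
    also have "\<dots> \<le> (LINT y|I1. \<bar>B\<bar> * \<bar>?k y\<bar>)"
    proof (rule integral_mono)
      show "integrable I1 (\<lambda>y. \<bar>?k y * h y\<bar>)" by (rule integrable_abs[OF riesz_pot_integrable[OF s x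
          h]])
      show "integrable I1 (\<lambda>y. \<bar>B\<bar> * \<bar>?k y\<bar>)" by (rule integrable_mult_right[OF integrable_abs[OF
          riesz_kernel_integrable[OF s x]]])
      fix y assume "y \<in> space I1"
      then have "\<bar>h y\<bar> \<le> \<bar>B\<bar>" using h(2)[of y] by (simp add: space_restrict_space)
      then have "\<bar>?k y\<bar> * \<bar>h y\<bar> \<le> \<bar>?k y\<bar> * \<bar>B\<bar>" by (rule mult_left_mono) simp
      then show "\<bar>?k y * h y\<bar> \<le> \<bar>B\<bar> * \<bar>?k y\<bar>" by (simp only: abs_mult mult.commute)
    qed
    also have "\<dots> = \<bar>B\<bar> * (LINT y|I1. \<bar>?k y\<bar>)" by simp
    also have "\<dots> \<le> \<bar>B\<bar> * M" using M[OF x] by (intro mult_left_mono) auto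
    finally show ?thesis .
  qed
  then show ?thesis using that by blast
qed

lemma wderiv_add: "wderiv s (p + q) = wderiv s p + wderiv s q"
  by (intro poly_eq_poly_eq_iff[THEN iffD1] ext) (simp add: poly_wderiv pderiv_add algebra_simps)

lemma wderiv_smult: "wderiv s (smult c p) = smult c (wderiv s p)"
  by (intro poly_eq_poly_eq_iff[THEN iffD1] ext) (simp add: poly_wderiv pderiv_smult algebra_simps)

lemma wderiv_sum_smult: "wderiv s (\<Sum>j\<in>A. smult (b j) (f j)) = (\<Sum>j\<in>A. smult (b j) (wderiv s (f j)))"
  by (induction A rule: infinite_finite_induct) (simp_all add: wderiv_add wderiv_smult, simp_all
      add: wderiv_def)

text \<open>
  The image of \<open>wderiv\<close> contains a polynomial of every degree \<open>n + 1\<close>, since the leading factor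
  \<open>-(n + 2s)\<close> does not vanish.
\<close>

lemma wderiv_span:
  assumes "s > 0"
  shows "(\<And>i. i \<ge> Suc n \<Longrightarrow> coeff p i = 0) \<Longrightarrow> \<exists>q c. p = wderiv s q + [:c:]"
proof (induction n arbitrary: p)
  case 0
  then have "p = wderiv s 0 + [:coeff p 0:]"
    by (intro poly_eqI) (simp add: wderiv_def coeff_pCons split: nat.split)
  then show ?case by blast
next
  case (Suc n)
  define r where "r = monom (- coeff p (Suc n) / (real n + 2 * s)) n"
  have "degree r \<le> n" by (simp add: r_def degree_monom_le)
  note dr = degree_wderiv[OF this, of s]
  have nz: "real n + 2 * s \<noteq> 0" using assms by (simp add: add_nonneg_eq_0_iff)
  have "coeff (p - wderiv s r) i = 0" if "i \<ge> Suc n" for i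
  proof (cases "i = Suc n")
    case True
    have "coeff r n = - coeff p (Suc n) / (real n + 2 * s)" by (simp add: r_def)
    then have "coeff (wderiv s r) (Suc n) = coeff p (Suc n)" unfolding dr(2) using nz
        by (simp add: field_simps)
    then show ?thesis using True by simp
  next
    case False
    then show ?thesis using Suc.prems[of i] dr(1) that by (simp add: coeff_eq_0)
  qed
  from Suc.IH[OF this] obtain q c where "p - wderiv s r = wderiv s q + [:c:]" by blast
  then have "p = wderiv s q + [:c:] + wderiv s r" by (simp only: diff_eq_eq)
  also have "\<dots> = wderiv s (q + r) + [:c:]" by (simp only: wderiv_add add_ac)
  finally show ?case by blast
qed

lemma integral_wderiv:
  assumes s: "0 < s"
  shows "t \<in> {-1..<1} \<Longrightarrow> (LINT x|I1. indicator {t<..} x * (om (s - 1) x * poly (wderiv s q) x))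
      = - om s t * poly q t"
    and "(LINT x|I1. om (s - 1) x * poly (wderiv s q) x) = 0"
proof -
  obtain B where B: "\<forall>x\<in>{-1..1}. \<bar>poly (wderiv s q) x\<bar> \<le> B" using poly_bounded_I1 by blast
  then have B': "\<bar>poly (wderiv s q) y\<bar> \<le> B" if "y \<in> {-1<..<1}" for y using that by auto
  have c: "continuous_on {-1..1} (poly q)" by (intro continuous_intros)
  show "(LINT x|I1. indicator {t<..} x * (om (s - 1) x * poly (wderiv s q) x))
      = - om s t * poly q t"
    if "t \<in> {-1..<1}"
    by (rule integral_deriv_om_tail[OF s c poly_DERIV poly_measurable_I1 B' poly_wderiv that])
  show "(LINT x|I1. om (s - 1) x * poly (wderiv s q) x) = 0"
    by (rule integral_deriv_om_zero[OF s c poly_DERIV poly_measurable_I1 B' poly_wderiv])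
qed

text \<open>
  The two sides are compared after integration, as potential \<open>F\<close> and primitive \<open>G\<close>, by testing
  against derivatives of \<open>\<omega>\<^sup>s q\<close>. The differentiability of \<open>F\<close> at almost every point is a
  consequence of the identification with \<open>G\<close>, not an input.
\<close>

lemma frac_lap_C1_AE:
  assumes s: "0 < s" "s < 1" and \<phi>: "continuous_on {-1..1} \<phi>" and \<phi>'c: "continuous_on {-1..1} \<phi>'"
    and \<phi>': "\<And>y. y \<in> {-1<..<1} \<Longrightarrow> (\<phi> has_real_derivative \<phi>' y) (at y)"
    and g: "g \<in> L2s s (-1) 1" "\<And>j. gegenbauer_coeff s g j = eigval s j * gegenbauer_coeff s \<phi> j"
  defines "D \<equiv> \<lambda>y. \<phi>' y * (1 - y\<^sup>2) - 2 * s * y * \<phi> y"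
  shows "AE x in I1. ((\<lambda>x. kernel_const s * riesz_pot s D x) has_real_derivative g x) (at x)"
proof -
  let ?w = "om (s - 1)"
  define F where "F x = kernel_const s * riesz_pot s D x" for x
  define G where "G = primitive g"
  note w_int = integrable_om[OF s(1)]
  have gi: "integrable I1 g" by (rule L2s_integrable(2)[OF s g(1)])
  have Dc: "continuous_on {-1..1} D" unfolding D_def by (intro continuous_intros \<phi> \<phi>'c)
  obtain A where A: "D \<in> borel_measurable I1" "\<And>y. y \<in> {-1<..<1} \<Longrightarrow> \<bar>D y\<bar> \<le> A"
    using continuous_on_I1_bounded[OF Dc] by blast
  have Fc: "continuous_on {-1<..<1} F" unfolding F_def
    by (intro continuous_intros riesz_pot_continuous_on[OF s Dc])
  have Gc: "continuous_on {-1..1} G" unfolding G_def by (rule continuous_on_primitive[OF gi])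
  obtain BG where BG: "G \<in> borel_measurable I1" "\<And>y. y \<in> {-1<..<1} \<Longrightarrow> \<bar>G y\<bar> \<le> BG"
    using continuous_on_I1_bounded[OF Gc] by blast
  obtain C where C: "\<And>x. x \<in> {-1<..<1} \<Longrightarrow> \<bar>riesz_pot s D x\<bar> \<le> C" using riesz_pot_bounded[OF s A]
      by blast
  have BF: "F \<in> borel_measurable I1" "\<bar>F y\<bar> \<le> \<bar>kernel_const s\<bar> * C" if "y \<in> {-1<..<1}" for y
    using continuous_on_measurable_I1[OF Fc] C[OF that]
        by (auto simp: F_def abs_mult intro: mult_left_mono)
  have Fw: "integrable I1 (\<lambda>x. ?w x * F x)"
    by (rule om_integrable_mult[OF s(1) _ BF(2)]) (use BF(1)[of 0] in auto)
  have Gw: "integrable I1 (\<lambda>x. ?w x * G x)" by (rule om_integrable_mult[OF s(1) BG])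
  define H where "H x = ?w x * F x - ?w x * G x" for x
  have H_int: "integrable I1 H" unfolding H_def by (rule Bochner_Integration.integrable_diff[OF Fw
      Gw])
  have H_ge: "(LINT x|I1. H x * poly (wderiv s (gbasis s j)) x) = 0" for j
  proof -
    let ?q = "wderiv s (gbasis s j)"
    have F1: "(LINT x|I1. ?w x * F x * poly ?q x) = - (eigval s j * gegenbauer_coeff s \<phi> j)"
    proof -
      have "(LINT x|I1. ?w x * F x * poly ?q x) = kernel_const s * (LINT x|I1. riesz_pot s D x
          * (?w x * poly ?q x))"
        by (simp add: F_def mult_ac)
      also have "\<dots> = - (LINT x|I1. \<phi> x * poly (frac_lap_poly s (gbasis s j)) x * om s x)"
        unfolding D_def by (rule frac_lap_adjoint_C1[OF s \<phi> \<phi>'c \<phi>'])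
      also have "\<dots> = - (LINT x|I1. eigval s j * (\<phi> x * om s x * poly (gbasis s j) x))"
        unfolding frac_lap_poly_gbasis[OF s] by (simp only: poly_smult mult_ac)
      also have "\<dots> = - (eigval s j * gegenbauer_coeff s \<phi> j)" by (simp add: gegenbauer_coeff_eq)
      finally show ?thesis .
    qed
    have q_int: "integrable I1 (\<lambda>x. ?w x * poly ?q x)" by (rule integrable_I1_mult_poly[OF w_int])
    have "(LINT x|I1. ?w x * G x * poly ?q x) = (LINT x|I1. primitive g x * (?w x * poly ?q x))"
      by (simp add: G_def mult_ac)
    also have "\<dots> = (LINT t|I1. g t * (LINT x|I1. indicator {t<..} x * (?w x * poly ?q x)))"
      by (rule integral_primitive_mult[OF gi q_int])
    also have "\<dots> = (LINT t|I1. - (g t * om s t * poly (gbasis s j) t))"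
    proof (rule Bochner_Integration.integral_cong[OF refl])
      fix t assume "t \<in> space I1"
      then have t: "t \<in> {-1..<1}" by (simp add: space_restrict_space)
      have "(LINT x|I1. indicator {t<..} x * (?w x * poly ?q x)) = - om s t * poly (gbasis s j) t"
        by (rule integral_wderiv(1)[OF s(1) t])
      then show "g t * (LINT x|I1. indicator {t<..} x * (?w x * poly ?q x)) = - (g t * om s t
          * poly (gbasis s j) t)"
        by simp
    qed
    also have "\<dots> = - gegenbauer_coeff s g j" by (simp add: gegenbauer_coeff_eq)
    finally have G1: "(LINT x|I1. ?w x * G x * poly ?q x) = - (eigval s j * gegenbauer_coeff s \<phi> j)"
        by (simp add: g(2))
    have "(LINT x|I1. H x * poly ?q x) = (LINT x|I1. ?w x * F x * poly ?q x) - (LINT x|I1. ?w x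
        * G x * poly ?q x)"
      unfolding H_def left_diff_distrib
      by (rule Bochner_Integration.integral_diff; rule integrable_I1_mult_poly; fact)
    then show ?thesis using F1 G1 by simp
  qed
  have H_dw: "(LINT x|I1. H x * poly (wderiv s q) x) = 0" for q
  proof -
    obtain b where b: "q = (\<Sum>j<Suc (degree q). smult (b j) (gbasis s j))"
      using gbasis_span[OF s(1), of "Suc (degree q)" q] by (auto simp: coeff_eq_0)
    define N where "N = Suc (degree q)"
    have "(LINT x|I1. H x * poly (wderiv s (\<Sum>j<N. smult (b j) (gbasis s j))) x)
      = (LINT x|I1. (\<Sum>j<N. b j * (H x * poly (wderiv s (gbasis s j)) x)))"
      by (simp only: wderiv_sum_smult poly_sum poly_smult sum_distrib_left mult_ac)
    also have "\<dots> = (\<Sum>j<N. b j * (LINT x|I1. H x * poly (wderiv s (gbasis s j)) x))"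
      using integrable_I1_mult_poly[OF H_int] by (subst Bochner_Integration.integral_sum) auto
    also have "\<dots> = 0" by (simp add: H_ge)
    finally show ?thesis by (simp only: N_def b[symmetric])
  qed
  define m where "m = (LINT x|I1. ?w x)"
  \<comment> \<open>The value that the constant \<open>F - G\<close> must have.\<close>
  define c0 where "c0 = (LINT x|I1. H x) / m"
  have "omega_integral s (1 * 1) \<le> m" unfolding m_def omega_integral_def
    using w_int integrable_poly_om[OF s(1), of 1] om_antimono[of "s - 1" s]
    by (intro integral_mono) (auto simp: space_restrict_space)
  then have "m > 0" using omega_integral_square_pos[OF s(1), of 1] by simp
  note dw0 = integral_wderiv(2)[OF s(1)]
  define K where "K x = H x - c0 * ?w x" for x
  have K_int: "integrable I1 K" unfolding K_def
    by (intro Bochner_Integration.integrable_diff H_int integrable_mult_right w_int)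
  have K_mom: "(LINT x|I1. K x * poly p x) = 0" for p
  proof -
    obtain q c where p: "p = wderiv s q + [:c:]"
      using wderiv_span[OF s(1), of "degree p" p] by (auto simp: coeff_eq_0)
    have eq: "K x * poly p x = H x * poly (wderiv s q) x + c * H x - c0 * (?w x * poly (wderiv s q)
        x) - c0 * c * ?w x" for x
      by (simp add: p K_def algebra_simps)
    have "(LINT x|I1. K x * poly p x) = (LINT x|I1. H x * poly (wderiv s q) x) + c
        * (LINT x|I1. H x) - c0 * (LINT x|I1. ?w x * poly (wderiv s q) x) - c0 * c * m"
      unfolding eq m_def using integrable_I1_mult_poly[OF H_int] integrable_I1_mult_poly[OF w_int]
          H_int w_int by simp
    also have "\<dots> = 0" using \<open>m > 0\<close> by (simp add: H_dw dw0 c0_def)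
    finally show ?thesis .
  qed
  have "AE x in I1. K x = 0" by (rule AE_zero_if_moments_zero[OF K_int K_mom])
  moreover have inI: "AE x in I1. x \<in> {-1<..<1}" by (rule AE_I1_mem)
  ultimately have "AE x in I1. F x - G x - c0 = 0"
  proof eventually_elim
    case (elim x)
    have "?w x * (F x - G x - c0) = 0" using elim(1) by (simp add: K_def H_def algebra_simps)
    then show ?case using om_pos[OF elim(2), of "s - 1"] by simp
  qed
  then have FG: "F x - G x - c0 = 0" if "x \<in> {-1<..<1}" for x
    by (rule AE_zero_imp_zero_I1) (use that in \<open>auto intro!: continuous_intros Fc
        continuous_on_subset[OF Gc]\<close>)
  from AE_DERIV_primitive[OF gi] inI show ?thesis
  proof eventually_elim
    case (elim x)
    then have "((\<lambda>x. G x + c0) has_real_derivative g x + 0) (at x)" unfolding G_def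
      by (intro DERIV_add DERIV_const)
    then have "((\<lambda>x. G x + c0) has_real_derivative g x) (at x)" by simp
    then have "(F has_real_derivative g x) (at x)"
    proof (rule has_field_derivative_transform_within_open)
      show "G y + c0 = F y" if "y \<in> {-1<..<1}" for y using FG[OF that] by simp
    qed (use elim in auto)
    then show ?case unfolding F_def[abs_def] .
  qed
qed

section \<open>Growth of the eigenvalues\<close>

text \<open>
  After division by \<open>n\<^bsup>2s\<^esup>\<close> the limit is Euler's formula for the Gamma function.
\<close>

lemma eigval_asymptotics:
  assumes s: "0 < s"
  shows "(\<lambda>n. eigval s n / (1 + (real n)\<^sup>2) powr s) \<longlonglongrightarrow> 1"
proof -
  have "Gamma (2 * s) * rGamma (2 * s) = 1"
    using s by (simp add: rGamma_inverse_Gamma Gamma_real_pos less_imp_neq[symmetric] right_inverse)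
  moreover have "(\<lambda>n. Gamma (2 * s) * rGamma_series (2 * s) n) \<longlonglongrightarrow> Gamma (2 * s) * rGamma (2 * s)"
    by (intro tendsto_intros)
  ultimately have lim1: "(\<lambda>n. Gamma (2 * s) * rGamma_series (2 * s) n) \<longlonglongrightarrow> 1" by simp
  have lim2: "(\<lambda>n. (1 + inverse (real n) ^ 2) powr s) \<longlonglongrightarrow> (1 + 0 ^ 2) powr s"
    by (intro tendsto_intros tendsto_inverse_0_at_top[OF filterlim_real_sequentially]) auto
  have "(\<lambda>n. Gamma (2 * s) * rGamma_series (2 * s) n / (1 + inverse (real n) ^ 2) powr s)
      \<longlonglongrightarrow> 1 / (1 + 0 ^ 2) powr s"
    by (rule tendsto_divide[OF lim1 lim2]) simp
  moreover have "\<forall>\<^sub>F n in sequentially. Gamma (2 * s) * rGamma_series (2 * s) n / (1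
      + inverse (real n) ^ 2) powr s
      = eigval s n / (1 + (real n)\<^sup>2) powr s"
    using eventually_gt_at_top[of 0]
  proof eventually_elim
    case (elim n)
    have "1 + (real n)\<^sup>2 = (real n)\<^sup>2 * (1 + inverse (real n) ^ 2)" using elim
        by (simp add: field_simps)
    then have "(1 + (real n)\<^sup>2) powr s = ((real n)\<^sup>2) powr s * (1 + inverse (real n) ^ 2) powr s"
      by (simp add: powr_mult)
    also have "((real n)\<^sup>2) powr s = exp (2 * s * ln (real n))"
      using elim by (simp add: powr_def ln_realpow)
    finally show ?case using elim by (simp add: eigval_def rGamma_series_def field_simps)
  qed
  ultimately show ?thesis by (simp add: tendsto_cong)
qed

lemma eigval_pos: "0 < s \<Longrightarrow> eigval s n > 0"
  by (simp add: eigval_def pochhammer_pos)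

lemma eigval_bounds:
  assumes s: "0 < s"
  obtains A B where "A > 0" "B > 0" "\<And>n. eigval s n \<le> B * (1 + (real n)\<^sup>2) powr s"
    "\<And>n. (1 + (real n)\<^sup>2) powr s \<le> A * eigval s n"
proof -
  let ?q = "\<lambda>n. eigval s n / (1 + (real n)\<^sup>2) powr s"
  have pos: "(1 + (real n)\<^sup>2) powr s > 0" for n
      by (simp add: add_pos_nonneg less_imp_neq[symmetric])
  have "Bseq ?q" using eigval_asymptotics[OF s] by (intro convergent_imp_Bseq) (auto simp:
      convergent_def)
  then obtain B where B: "B > 0" "\<And>n. norm (?q n) \<le> B" by (auto simp: Bseq_def)
  have "(\<lambda>n. 1 / ?q n) \<longlonglongrightarrow> 1 / 1" by (intro tendsto_divide eigval_asymptotics[OF s] tendsto_const)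
      simp
  then have "Bseq (\<lambda>n. 1 / ?q n)" by (intro convergent_imp_Bseq) (auto simp: convergent_def)
  then obtain A where A: "A > 0" "\<And>n. norm (1 / ?q n) \<le> A" by (auto simp: Bseq_def)
  show ?thesis
  proof (rule that[OF A(1) B(1)])
    fix n
    have "?q n \<le> B" using B(2)[of n] eigval_pos[OF s, of n] by simp
    then show "eigval s n \<le> B * (1 + (real n)\<^sup>2) powr s" using pos[of n]
        by (simp only: pos_divide_le_eq)
    have "(1 + (real n)\<^sup>2) powr s / eigval s n \<le> A" using A(2)[of n] eigval_pos[OF s, of n] by simp
    then show "(1 + (real n)\<^sup>2) powr s \<le> A * eigval s n" using eigval_pos[OF s, of n]
        by (simp only: pos_divide_le_eq)
  qed
qed

section \<open>Transport to an arbitrary interval\<close>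

text \<open>
  The inverse of \<open>from_ref\<close>, in the form \<open>t + c x\<close> of the affine substitution rule.
\<close>

definition to_ref :: "real \<Rightarrow> real \<Rightarrow> real \<Rightarrow> real" where
  "to_ref a b x = - (a + b) / (b - a) + 2 / (b - a) * x"

lemma to_ref_inverse:
  assumes "a < b"
  shows "from_ref a b (to_ref a b x) = x" "to_ref a b (from_ref a b \<xi>) = \<xi>"
proof -
  have to: "to_ref a b x = (2 * x - (a + b)) / (b - a)" for x
    by (simp add: to_ref_def diff_divide_distrib add_divide_distrib)
  have "from_ref a b (to_ref a b x) = a + ((b - a) * to_ref a b x + (b - a)) / 2"
    by (simp add: from_ref_def distrib_left)
  also have "(b - a) * to_ref a b x = 2 * x - (a + b)" using assms by (simp add: to)
  finally show "from_ref a b (to_ref a b x) = x" by (simp add: field_simps)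
  have "2 * from_ref a b \<xi> - (a + b) = (b - a) * \<xi>" by (simp add: from_ref_def field_simps)
  then show "to_ref a b (from_ref a b \<xi>) = \<xi>" using assms by (simp add: to)
qed

lemma DERIV_to_ref: "(to_ref a b has_real_derivative 2 / (b - a)) (at x)"
proof -
  have "((\<lambda>x. c + d * x) has_real_derivative d) (at x)" for c d :: real
    by (auto intro!: derivative_eq_intros)
  then show ?thesis unfolding to_ref_def[abs_def] .
qed

lemma to_ref_mem_iff: "a < b \<Longrightarrow> to_ref a b x \<in> {-1<..<1} \<longleftrightarrow> x \<in> {a<..<b}"
  using from_ref_mem_iff[of a b "to_ref a b x"] to_ref_inverse(1) by simp

lemma measurable_comp_to_ref:
  assumes "a < b" and "v \<in> borel_measurable I1"
  shows "v \<circ> to_ref a b \<in> borel_measurable (lebesgue_on {a<..<b})"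
proof -
  have "to_ref a b \<in> lebesgue \<rightarrow>\<^sub>M lebesgue"
    using lebesgue_affine_measurable[of "\<lambda>_. 2 / (b - a)" "- (a + b) / (b - a)"] assms
    by (simp add: to_ref_def[abs_def])
  then have "to_ref a b \<in> lebesgue_on {a<..<b} \<rightarrow>\<^sub>M I1"
    by (rule measurable_restrict_space3) (rule Pi_I, simp only: to_ref_mem_iff[OF assms(1)])
  then show ?thesis using assms(2) by (rule measurable_comp)
qed

lemma AE_lebesgue_affine:
  fixes c t :: real
  assumes c: "c \<noteq> 0" and "AE x in lebesgue. Q x"
  shows "AE x in lebesgue. Q (t + c * x)"
proof -
  obtain N where N: "N \<in> null_sets lebesgue" "{x. \<not> Q x} \<subseteq> N"
    using assms(2) unfolding eventually_ae_filter by auto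
  have N_meas: "indicator N \<in> borel_measurable lebesgue" using N(1) by auto
  have T: "(\<lambda>x. t + c * x) \<in> lebesgue \<rightarrow>\<^sub>M lebesgue"
    using lebesgue_affine_measurable[of "\<lambda>_. c" t] c by simp
  have "(\<integral>\<^sup>+x. indicator N x \<partial>lebesgue) = 0" using N(1) by (simp add: null_setsD1 null_setsD2)
  then have "ennreal \<bar>c\<bar> * (\<integral>\<^sup>+x. indicator N (t + c * x) \<partial>lebesgue) = 0"
    using nn_integral_real_affine_lebesgue[OF N_meas c, of t] by simp
  then have "(\<integral>\<^sup>+x. indicator N (t + c * x) \<partial>lebesgue) = 0" using c by simp
  then have "AE x in lebesgue. indicator N (t + c * x) = (0 :: ennreal)"
    using measurable_compose[OF T N_meas] by (subst (asm) nn_integral_0_iff_AE) auto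
  then show ?thesis
    by eventually_elim (use N(2) in \<open>auto simp: indicator_def split: if_splits\<close>)
qed

lemma AE_comp_to_ref:
  assumes "a < b" and "AE \<xi> in I1. P \<xi>"
  shows "AE x in lebesgue_on {a<..<b}. P (to_ref a b x)"
proof -
  have "AE \<xi> in lebesgue. \<xi> \<in> {-1<..<1} \<longrightarrow> P \<xi>"
    using assms(2) by (subst (asm) AE_restrict_space_iff) auto
  then have "AE x in lebesgue. - (a + b) / (b - a) + 2 / (b - a) * x \<in> {-1<..<1} \<longrightarrow> P (- (a + b) / (b
      - a) + 2 / (b - a) * x)"
    using assms(1) by (intro AE_lebesgue_affine[where Q = "\<lambda>\<xi>. \<xi> \<in> {-1<..<1} \<longrightarrow> P \<xi>"]) auto
  then have "AE x in lebesgue. x \<in> {a<..<b} \<longrightarrow> P (to_ref a b x)"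
    unfolding to_ref_def[symmetric] to_ref_mem_iff[OF assms(1)] .
  then show ?thesis by (subst AE_restrict_space_iff) auto
qed

lemma integral_from_ref:
  fixes f :: "real \<Rightarrow> real"
  assumes "a < b"
  shows "(LINT y|lebesgue_on {a<..<b}. f y) = (b - a) / 2 * (LINT \<eta>|I1. f (from_ref a b \<eta>))"
proof -
  have "(LINT y|lebesgue_on {a<..<b}. f y) = (LINT y|lebesgue. indicator {a<..<b} y *\<^sub>R f y)"
    by (rule integral_restrict_space) simp
  also have "\<dots> = \<bar>(b - a) / 2\<bar> *\<^sub>R (LINT x|lebesgue. indicator {a<..<b} ((a + b) / 2 + (b - a) / 2
      * x) *\<^sub>R f ((a + b) / 2 + (b - a) / 2 * x))"
    by (rule lebesgue_integral_real_affine) (use assms in simp)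
  also have "\<dots> = (b - a) / 2 * (LINT x|lebesgue. indicator {-1<..<1} x *\<^sub>R f (from_ref a b x))"
    unfolding from_ref_alt[symmetric] using assms from_ref_mem_iff[OF assms]
        by (simp add: indicator_def)
  also have "(LINT x|lebesgue. indicator {-1<..<1} x *\<^sub>R f (from_ref a b x))
      = (LINT \<eta>|I1. f (from_ref a b \<eta>))"
    by (rule integral_restrict_space[symmetric]) simp
  finally show ?thesis .
qed

lemma omega_from_ref:
  assumes "a < b"
  shows "omega s a b (from_ref a b \<eta>) = ((b - a) / 2) powr (2 * s) * om s \<eta>"
proof -
  have "from_ref a b \<eta> - a = (b - a) / 2 * (1 + \<eta>)" "b - from_ref a b \<eta> = (b - a) / 2 * (1 - \<eta>)"
    by (simp_all add: from_ref_def field_simps)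
  then have "omega s a b (from_ref a b \<eta>) = ((b - a) / 2 * (1 + \<eta>)) powr s * ((b - a) / 2 * (1
      - \<eta>)) powr s"
    by (simp only: omega_def)
  also have "\<dots> = (((b - a) / 2) powr s * ((b - a) / 2) powr s) * ((1 + \<eta>) powr s * (1 - \<eta>) powr s)"
    by (simp only: powr_mult mult_ac)
  also have "((b - a) / 2) powr s * ((b - a) / 2) powr s = ((b - a) / 2) powr (2 * s)"
    by (simp flip: powr_add)
  finally show ?thesis by (simp only: om_alt)
qed

text \<open>
  The first relation is the functional equation of the Gamma function together with the
  reflection formula hidden in the Beta function.
\<close>

lemma kernel_const_relation:
  assumes s: "0 < s" "s < 1"
  shows "s \<noteq> 1 / 2 \<Longrightarrow> frac_const s * (1 - 2 * s) = kernel_const s" and "kernel_const (1 / 2)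
      = 1 / pi"
proof -
  have k: "kernel_const s = Gamma (2 * s) * sin (pi * s) / pi" if "0 < s" "s < 1" for s
    using Beta_reflection[OF that] by (simp add: kernel_const_def)
  show "frac_const s * (1 - 2 * s) = kernel_const s" if "s \<noteq> 1 / 2"
  proof -
    have "2 * s - 1 \<noteq> 0" using that by simp
    moreover have "2 * s - 1 \<notin> \<int>\<^sub>\<le>\<^sub>0"
    proof
      assume "2 * s - 1 \<in> \<int>\<^sub>\<le>\<^sub>0"
      then obtain n where "2 * s - 1 = - real n" by (auto elim: nonpos_Ints_cases')
      then have "real n < 1" "2 * s - 1 = - real n" using s by auto
      then show False using that by simp
    qed
    ultimately have G: "Gamma (2 * s) = (2 * s - 1) * Gamma (2 * s - 1)"
      using Gamma_plus1[of "2 * s - 1"] by simp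
    have "frac_const s * (1 - 2 * s) = (2 * s - 1) * Gamma (2 * s - 1) * sin (pi * s) / pi"
    proof -
      have e: "1 - 2 * s = - (2 * s - 1)" by simp
      have "(- G * S / p) * (- c) = c * G * S / p" for G S p c :: real by simp
      then show ?thesis unfolding frac_const_def e .
    qed
    then show ?thesis unfolding k[OF s] G .
  qed
  show "kernel_const (1 / 2) = 1 / pi" using k[of "1 / 2"] by simp
qed

text \<open>
  With \<open>h = (b - a) / 2\<close> the weight contributes \<open>h\<^bsup>2s\<^esup>\<close>, the kernel \<open>h\<^bsup>1-2s\<^esup>\<close> (an additive \<open>ln h\<close>
      for
  \<open>s = 1/2\<close>), and the inner derivative cancels against the integration variable. What remains is
  the factor \<open>h\<close>, which the outer derivative removes, and a constant.
\<close>

lemma weighted_frac_lap_from_ref: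
  assumes s: "0 < s" "s < 1" and ab: "a < b"
    and \<phi>': "\<And>y. y \<in> {-1<..<1} \<Longrightarrow> (\<phi> \<circ> from_ref a b has_real_derivative \<phi>' y) (at y)"
    and c: "continuous_on {-1..1} (\<phi> \<circ> from_ref a b)" "continuous_on {-1..1} \<phi>'"
  defines "D \<equiv> \<lambda>y. \<phi>' y * (1 - y\<^sup>2) - 2 * s * y * (\<phi> \<circ> from_ref a b) y"
  assumes \<xi>: "\<xi> \<in> {-1<..<1}" and d: "((\<lambda>x. kernel_const s * riesz_pot s D x)
      has_real_derivative l) (at \<xi>)"
  shows "weighted_frac_lap s a b \<phi> (from_ref a b \<xi>) = l"
proof -
  define h where "h = (b - a) / 2"
  have h: "h > 0" using ab by (simp add: h_def)
  let ?w = "om (s - 1)" and ?u = "\<lambda>y. omega s a b y * \<phi> y"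
  have Dc: "continuous_on {-1..1} D" unfolding D_def by (intro continuous_intros c)
  obtain A where A: "D \<in> borel_measurable I1" "\<And>y. y \<in> {-1<..<1} \<Longrightarrow> \<bar>D y\<bar> \<le> A"
    using continuous_on_I1_bounded[OF Dc] by blast
  have du: "deriv ?u (from_ref a b \<eta>) = h powr (2 * s - 1) * (?w \<eta> * D \<eta>)" if \<eta>: "\<eta> \<in> {-1<..<1}"
      for \<eta>
  proof -
    have d1: "((\<lambda>y. om s y * (\<phi> \<circ> from_ref a b) y) has_real_derivative ?w \<eta> * D \<eta>) (at (to_ref a b
        (from_ref a b \<eta>)))"
      unfolding D_def to_ref_inverse(2)[OF ab] by (rule DERIV_om_mult[OF \<eta> \<phi>'[OF \<eta>]])
    have d2: "(to_ref a b has_real_derivative 1 / h) (at (from_ref a b \<eta>))"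
      using DERIV_to_ref[of a b] by (simp add: h_def)
    have "((\<lambda>x. h powr (2 * s) * (om s (to_ref a b x) * (\<phi> \<circ> from_ref a b) (to_ref a b x)))
        has_real_derivative h powr (2 * s) * ((?w \<eta> * D \<eta>) * (1 / h))) (at (from_ref a b \<eta>))"
      by (rule DERIV_cmult[OF DERIV_chain2[OF d1 d2]])
    moreover have "h powr (2 * s) * (om s (to_ref a b x) * (\<phi> \<circ> from_ref a b) (to_ref a b x))
        = ?u x" for x
      using omega_from_ref[OF ab, of s "to_ref a b x"] by (simp add: to_ref_inverse[OF ab] h_def)
    moreover have "h powr (2 * s) * ((?w \<eta> * D \<eta>) * (1 / h)) = h powr (2 * s - 1) * (?w \<eta> * D \<eta>)"
      using h by (simp add: powr_diff)
    ultimately have "(?u has_real_derivative h powr (2 * s - 1) * (?w \<eta> * D \<eta>)) (at (from_ref a b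
        \<eta>))"
      by simp
    then show ?thesis by (rule DERIV_imp_deriv)
  qed
  define kk where "kk t = (if s = 1 / 2 then ln \<bar>t\<bar> else \<bar>t\<bar> powr (1 - 2 * s))" for t
  define cc where "cc = (if s = 1 / 2 then 1 / pi else frac_const s)"
  define I where "I x = (LINT y|lebesgue_on {a<..<b}. kk (x - y) * deriv ?u y)" for x
  define m where "m = (LINT \<eta>|I1. ?w \<eta> * D \<eta>)"
  \<comment> \<open>The constant that the outer derivative removes.\<close>
  define const where "const = (if s = 1 / 2 then ln h / pi else frac_const s) * m"
  have W: "weighted_frac_lap s a b \<phi> x = cc * deriv I x" for x
    unfolding weighted_frac_lap_def cc_def I_def[abs_def] kk_def
    by (cases "s = 1 / 2", hypsubst) simp_all
  have wD: "integrable I1 (\<lambda>\<eta>. ?w \<eta> * D \<eta>)" by (rule om_integrable_mult[OF s(1) A])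
  \<comment> \<open>Homogeneity of the kernel; for the logarithm, additivity.\<close>
  have scale: "cc * (kk (h * t) * h powr (2 * s - 1)) = (if s = 1 / 2 then ln h / pi else frac_const
      s) + kernel_const s * riesz_kernel s t * 1"
    if "t \<noteq> 0" for t
  proof (cases "s = 1 / 2")
    case True
    have "kernel_const s = 1 / pi" unfolding True by (rule kernel_const_relation(2)[OF s])
    moreover have "2 * s - 1 = 0" using True by simp
    then have "h powr (2 * s - 1) = 1" using h by (simp only: powr_zero_eq_one) simp
    moreover have "cc = 1 / pi" "kk (h * t) = ln h + ln \<bar>t\<bar>" "riesz_kernel s t = ln \<bar>t\<bar>"
      "(if s = 1 / 2 then ln h / pi else frac_const s) = ln h / pi"
      using True that h by (simp_all add: cc_def kk_def riesz_kernel_def abs_mult ln_mult)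
    ultimately show ?thesis by (simp only:) (simp add: add_divide_distrib)
  next
    case False
    have "\<bar>h * t\<bar> powr (1 - 2 * s) * h powr (2 * s - 1) = \<bar>t\<bar> powr (1 - 2 * s)"
    proof -
      have "h powr (1 - 2 * s) * h powr (2 * s - 1) = 1" using h by (simp flip: powr_add)
      then show ?thesis using h by (simp add: abs_mult powr_mult mult_ac)
    qed
    also have "\<dots> = 1 + (1 - 2 * s) * riesz_kernel s t" using riesz_kernel_power[OF that, of s]
        by simp
    finally have "kk (h * t) * h powr (2 * s - 1) = 1 + (1 - 2 * s) * riesz_kernel s t"
      using False by (simp add: kk_def)
    then have "cc * (kk (h * t) * h powr (2 * s - 1)) = cc + cc * (1 - 2 * s) * riesz_kernel s t"
      by (simp only: distrib_left mult.assoc mult_1_right)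
    moreover have "cc = frac_const s" "cc * (1 - 2 * s) = kernel_const s"
      using False kernel_const_relation(1)[OF s False] by (simp_all add: cc_def)
    ultimately show ?thesis using False by simp
  qed
  have I_eq: "cc * I (from_ref a b x) = h * (const + kernel_const s * riesz_pot s D x)"
      if x: "x \<in> {-1<..<1}" for x
  proof -
    have "cc * I (from_ref a b x) = h * (LINT \<eta>|I1. cc * (kk (from_ref a b x - from_ref a b \<eta>)
        * deriv ?u (from_ref a b \<eta>)))"
      unfolding I_def integral_from_ref[OF ab] by (simp add: h_def mult_ac)
    also have "(LINT \<eta>|I1. cc * (kk (from_ref a b x - from_ref a b \<eta>) * deriv ?u (from_ref a b \<eta>)))
      = (LINT \<eta>|I1. (if s = 1 / 2 then ln h / pi else frac_const s) * (?w \<eta> * D \<eta>) + kernel_const s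
          * (riesz_kernel s (x - \<eta>) * ?w \<eta> * D \<eta>))"
    proof (rule Bochner_Integration.integral_cong_AE)
      have inI: "AE \<eta> in I1. \<eta> \<in> {-1<..<1}" by (rule AE_I1_mem)
      have eq: "cc * (kk (from_ref a b x - from_ref a b \<eta>) * deriv ?u (from_ref a b \<eta>))
          = cc * (kk (h * (x - \<eta>)) * (h powr (2 * s - 1) * (?w \<eta> * D \<eta>)))"
        if "\<eta> \<in> {-1<..<1}" for \<eta>
      proof -
        have "from_ref a b x - from_ref a b \<eta> = h * (x - \<eta>)"
          by (simp add: from_ref_alt h_def right_diff_distrib)
        then show ?thesis unfolding du[OF that] by simp
      qed
      show "AE \<eta> in I1. cc * (kk (from_ref a b x - from_ref a b \<eta>) * deriv ?u (from_ref a b \<eta>))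
         = (if s = 1 / 2 then ln h / pi else frac_const s) * (?w \<eta> * D \<eta>) + kernel_const s
             * (riesz_kernel s (x - \<eta>) * ?w \<eta> * D \<eta>)"
        using inI AE_I1_neq[of x]
      proof eventually_elim
        case (elim \<eta>)
        have "cc * (kk (h * (x - \<eta>)) * (h powr (2 * s - 1) * (?w \<eta> * D \<eta>))) = cc * (kk (h * (x - \<eta>))
            * h powr (2 * s - 1)) * (?w \<eta> * D \<eta>)"
          by (simp only: mult_ac)
        also have "cc * (kk (h * (x - \<eta>)) * h powr (2 * s - 1)) = (if s
            = 1 / 2 then ln h / pi else frac_const s) + kernel_const s * riesz_kernel s (x - \<eta>) * 1"
          by (rule scale) (use elim in auto)
        also have "((if s = 1 / 2 then ln h / pi else frac_const s) + kernel_const s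
            * riesz_kernel s (x - \<eta>) * 1) * (?w \<eta> * D \<eta>)
            = (if s = 1 / 2 then ln h / pi else frac_const s) * (?w \<eta> * D \<eta>) + kernel_const s
                * (riesz_kernel s (x - \<eta>) * ?w \<eta> * D \<eta>)"
          by (simp only: distrib_right mult_1_right mult.assoc)
        finally show ?case unfolding eq[OF elim(1)] .
      qed
      have kkm: "kk \<in> borel_measurable borel"
      proof (cases "s = 1 / 2")
        case True
        then show ?thesis by (simp add: kk_def[abs_def])
      next
        case False
        have "(\<lambda>t. \<bar>t\<bar> powr (1 - 2 * s)) \<in> borel_measurable borel" by measurable
        then show ?thesis using False by (simp add: kk_def[abs_def])
      qed
      have [measurable]: "?w \<in> borel_measurable I1" "D \<in> borel_measurable I1"
          by (rule om_measurable_I1) (rule A)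
      have [measurable]: "(\<lambda>\<eta>. kk (h * (x - \<eta>))) \<in> borel_measurable I1"
        by (rule borel_measurable_I1) (rule measurable_compose[OF _ kkm], measurable)
      have [measurable]: "(\<lambda>\<eta>. riesz_kernel s (x - \<eta>)) \<in> borel_measurable I1"
        by (rule borel_measurable_I1) measurable
      have "(\<lambda>\<eta>. cc * (kk (h * (x - \<eta>)) * (h powr (2 * s - 1) * (?w \<eta> * D \<eta>)))) \<in> borel_measurable
          I1" by measurable
      then show "(\<lambda>\<eta>. cc * (kk (from_ref a b x - from_ref a b \<eta>) * deriv ?u (from_ref a b \<eta>)))
          \<in> borel_measurable I1"
        by (rule measurable_cong[THEN iffD2, rotated]) (rule eq, simp add: space_restrict_space)
      show "(\<lambda>\<eta>. (if s = 1 / 2 then ln h / pi else frac_const s) * (?w \<eta> * D \<eta>) + kernel_const s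
          * (riesz_kernel s (x - \<eta>) * ?w \<eta> * D \<eta>)) \<in> borel_measurable I1"
        by measurable
    qed
    also have "\<dots> = const + kernel_const s * riesz_pot s D x"
      unfolding const_def m_def riesz_pot_def using wD riesz_pot_integrable[OF s x A]
      by (subst Bochner_Integration.integral_add) auto
    finally show ?thesis .
  qed
  have kap0: "kernel_const s > 0" unfolding kernel_const_def using s
      by (intro divide_pos_pos Gamma_real_pos Beta_pos_real) auto
  have cc0: "cc \<noteq> 0"
    using kap0 kernel_const_relation(1)[OF s] by (auto simp: cc_def)
  have "(to_ref a b has_real_derivative 1 / h) (at (from_ref a b \<xi>))"
    using DERIV_to_ref[of a b] by (simp add: h_def)
  then have "((\<lambda>x. kernel_const s * riesz_pot s D (to_ref a b x)) has_real_derivative l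
      * (1 / h)) (at (from_ref a b \<xi>))"
    by (rule DERIV_chain2[rotated]) (use d to_ref_inverse(2)[OF ab] in simp)
  then have "((\<lambda>x. h * (const + kernel_const s * riesz_pot s D (to_ref a b x)) / cc)
      has_real_derivative h * (0 + l * (1 / h)) / cc) (at (from_ref a b \<xi>))"
    by (intro DERIV_cdivide DERIV_cmult DERIV_add DERIV_const)
  then have "(I has_real_derivative h * (0 + l * (1 / h)) / cc) (at (from_ref a b \<xi>))"
  proof (rule has_field_derivative_transform_within_open)
    show "open {a<..<b}" by simp
    show "from_ref a b \<xi> \<in> {a<..<b}" using \<xi> from_ref_mem_iff[OF ab] by simp
    fix x assume "x \<in> {a<..<b}"
    then show "h * (const + kernel_const s * riesz_pot s D (to_ref a b x)) / cc = I x"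
      using I_eq[of "to_ref a b x"] to_ref_mem_iff[OF ab, of x] to_ref_inverse(1)[OF ab, of x] cc0
          by (simp add: field_simps)
  qed
  then have "deriv I (from_ref a b \<xi>) = h * (0 + l * (1 / h)) / cc" by (rule DERIV_imp_deriv)
  then show ?thesis unfolding W using cc0 h by simp
qed

lemma weighted_frac_lap_AE:
  assumes s: "0 < s" "s < 1" and ab: "a < b" and \<phi>: "\<phi> \<in> C2_C1 a b"
    and g: "g \<in> L2s s (-1) 1" "\<And>j. gegenbauer_coeff s g j = eigval s j * gegenbauer_coeff s (\<phi> \<circ>
        from_ref a b) j"
  shows "AE x in lebesgue_on {a<..<b}. weighted_frac_lap s a b \<phi> x = (g \<circ> to_ref a b) x"
proof -
  obtain \<phi>1 where \<phi>1: "\<And>x. x \<in> {a..b} \<Longrightarrow> (\<phi> has_real_derivative \<phi>1 x) (at x within {a..b})"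
    and \<phi>1c: "continuous_on {a..b} \<phi>1"
    using \<phi> unfolding C2_C1_def by blast
  have fr: "from_ref a b ` {-1..1} \<subseteq> {a..b}"
  proof
    fix x assume "x \<in> from_ref a b ` {-1..1}"
    then obtain \<eta> where \<eta>: "\<eta> \<in> {-1..1}" "x = from_ref a b \<eta>" by blast
    have "0 \<le> (b - a) * (\<eta> + 1)" "0 \<le> (b - a) * (1 - \<eta>)" using \<eta> ab
        by (auto intro!: mult_nonneg_nonneg)
    then show "x \<in> {a..b}" by (auto simp: \<eta>(2) from_ref_def field_simps)
  qed
  have frc: "continuous_on {-1..1} (from_ref a b)" unfolding from_ref_def[abs_def]
      by (intro continuous_intros) auto
  have \<phi>c: "continuous_on {a..b} \<phi>" using \<phi>1 DERIV_continuous
      by (fastforce simp: continuous_on_eq_continuous_within)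
  define \<psi>1 where "\<psi>1 \<eta> = \<phi>1 (from_ref a b \<eta>) * ((b - a) / 2)" for \<eta>
  have c1: "continuous_on {-1..1} (\<phi> \<circ> from_ref a b)"
    by (rule continuous_on_compose[OF frc continuous_on_subset[OF \<phi>c fr]])
  have c2: "continuous_on {-1..1} \<psi>1" unfolding \<psi>1_def
    by (intro continuous_intros continuous_on_compose2[OF \<phi>1c frc fr]) 
  have d: "(\<phi> \<circ> from_ref a b has_real_derivative \<psi>1 \<eta>) (at \<eta>)" if "\<eta> \<in> {-1<..<1}" for \<eta>
  proof -
    have x: "from_ref a b \<eta> \<in> {a<..<b}" using that from_ref_mem_iff[OF ab] by simp
    then have "(\<phi> has_real_derivative \<phi>1 (from_ref a b \<eta>)) (at (from_ref a b \<eta>))"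
      using \<phi>1[of "from_ref a b \<eta>"] at_within_Icc_at[of a "from_ref a b \<eta>" b] by auto
    moreover have "(from_ref a b has_real_derivative (b - a) / 2) (at \<eta>)"
      unfolding from_ref_def[abs_def] by (auto intro!: derivative_eq_intros)
    ultimately show ?thesis unfolding \<psi>1_def by (rule DERIV_chain)
  qed
  have "AE \<xi> in I1. weighted_frac_lap s a b \<phi> (from_ref a b \<xi>) = g \<xi>"
  proof -
    have inI: "AE \<eta> in I1. \<eta> \<in> {-1<..<1}" by (rule AE_I1_mem)
    have "AE x in I1. ((\<lambda>x. kernel_const s * riesz_pot s (\<lambda>y. \<psi>1 y * (1 - y\<^sup>2) - 2 * s * y
        * (\<phi> \<circ> from_ref a b) y) x)
        has_real_derivative g x) (at x)"
      by (rule frac_lap_C1_AE[OF s c1 c2 _ g]) (rule d)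
    then show ?thesis using inI
    proof eventually_elim
      case (elim \<xi>)
      show ?case by (rule weighted_frac_lap_from_ref[OF s ab d c1 c2 elim(2,1)])
    qed
  qed
  from AE_comp_to_ref[OF ab this] show ?thesis by (simp add: to_ref_inverse[OF ab])
qed

section \<open>Weighted sequence spaces\<close>

definition seq_space :: "real \<Rightarrow> (nat \<Rightarrow> real) set" where
  "seq_space r = {c. summable (\<lambda>j. (1 + (real j)\<^sup>2) powr r * (c j)\<^sup>2)}"

definition seq_norm :: "real \<Rightarrow> (nat \<Rightarrow> real) \<Rightarrow> real" where
  "seq_norm r c = sqrt (\<Sum>j. (1 + (real j)\<^sup>2) powr r * (c j)\<^sup>2)"

lemma seq_norm_nonneg: "c \<in> seq_space r \<Longrightarrow> 0 \<le> seq_norm r c"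
  unfolding seq_norm_def seq_space_def by (intro real_sqrt_ge_zero suminf_nonneg) auto

lemma seq_norm_dominated:
  assumes d: "d \<in> seq_space r2" and K: "0 \<le> K"
    and le: "\<And>j. (1 + (real j)\<^sup>2) powr r1 * (c j)\<^sup>2 \<le> K\<^sup>2 * ((1 + (real j)\<^sup>2) powr r2 * (d j)\<^sup>2)"
  shows "c \<in> seq_space r1" "seq_norm r1 c \<le> K * seq_norm r2 d"
proof -
  have sd: "summable (\<lambda>j. K\<^sup>2 * ((1 + (real j)\<^sup>2) powr r2 * (d j)\<^sup>2))"
    using d unfolding seq_space_def by (intro summable_mult) simp
  have sc: "summable (\<lambda>j. (1 + (real j)\<^sup>2) powr r1 * (c j)\<^sup>2)"
    by (rule summable_comparison_test'[OF sd, of 0]) (use le in simp)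
  then show "c \<in> seq_space r1" by (simp add: seq_space_def)
  have "(\<Sum>j. (1 + (real j)\<^sup>2) powr r1 * (c j)\<^sup>2) \<le> (\<Sum>j. K\<^sup>2 * ((1 + (real j)\<^sup>2) powr r2 * (d j)\<^sup>2))"
    by (rule suminf_le[OF le sc sd])
  also have "\<dots> = K\<^sup>2 * (\<Sum>j. (1 + (real j)\<^sup>2) powr r2 * (d j)\<^sup>2)"
    using d unfolding seq_space_def by (intro suminf_mult) simp
  finally have "seq_norm r1 c \<le> sqrt (K\<^sup>2 * (\<Sum>j. (1 + (real j)\<^sup>2) powr r2 * (d j)\<^sup>2))"
    unfolding seq_norm_def by (rule real_sqrt_le_mono)
  also have "\<dots> = K * seq_norm r2 d" unfolding seq_norm_def real_sqrt_mult using K by simp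
  finally show "seq_norm r1 c \<le> K * seq_norm r2 d" .
qed

text \<open>
  Minkowski's inequality for finite sums, applied to partial sums.
\<close>

lemma seq_norm_triangle:
  assumes c: "c \<in> seq_space r" and d: "d \<in> seq_space r"
  shows "(\<lambda>j. c j + d j) \<in> seq_space r" "seq_norm r (\<lambda>j. c j + d j) \<le> seq_norm r c + seq_norm r d"
proof -
  let ?\<rho> = "\<lambda>j. (1 + (real j)\<^sup>2) powr r"
  have sc: "summable (\<lambda>j. ?\<rho> j * (c j)\<^sup>2)" and sd: "summable (\<lambda>j. ?\<rho> j * (d j)\<^sup>2)"
    using c d by (auto simp: seq_space_def)
  have "summable (\<lambda>j. 2 * (?\<rho> j * (c j)\<^sup>2) + 2 * (?\<rho> j * (d j)\<^sup>2))"
    by (intro summable_add summable_mult sc sd)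
  then have s: "summable (\<lambda>j. ?\<rho> j * (c j + d j)\<^sup>2)"
  proof (rule summable_comparison_test'[of _ 0])
    fix j
    have "(c j + d j)\<^sup>2 \<le> 2 * (c j)\<^sup>2 + 2 * (d j)\<^sup>2" using sum_squares_bound[of "c j" "d j"]
        by (simp add: power2_sum)
    then have "?\<rho> j * (c j + d j)\<^sup>2 \<le> ?\<rho> j * (2 * (c j)\<^sup>2 + 2 * (d j)\<^sup>2)"
        by (intro mult_left_mono) auto
    then show "norm (?\<rho> j * (c j + d j)\<^sup>2) \<le> 2 * (?\<rho> j * (c j)\<^sup>2) + 2 * (?\<rho> j * (d j)\<^sup>2)"
      by (simp add: algebra_simps)
  qed
  then show "(\<lambda>j. c j + d j) \<in> seq_space r" by (simp add: seq_space_def)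
  have L2: "L2_set (\<lambda>j. sqrt (?\<rho> j) * e j) {..<n} = sqrt (\<Sum>j<n. ?\<rho> j * (e j)\<^sup>2)" for e n
    by (simp add: L2_set_def power_mult_distrib)
  have fin: "sqrt (\<Sum>j<n. ?\<rho> j * (e j)\<^sup>2) \<le> seq_norm r e" if "summable (\<lambda>j. ?\<rho> j * (e j)\<^sup>2)" for e n
    unfolding seq_norm_def by (intro real_sqrt_le_mono sum_le_suminf that) auto
  have part: "(\<Sum>j<n. ?\<rho> j * (c j + d j)\<^sup>2) \<le> (seq_norm r c + seq_norm r d)\<^sup>2" for n
  proof -
    have "sqrt (\<Sum>j<n. ?\<rho> j * (c j + d j)\<^sup>2) = L2_set (\<lambda>j. sqrt (?\<rho> j) * c j + sqrt (?\<rho> j)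
        * d j) {..<n}"
      unfolding L2[symmetric] by (simp add: distrib_left)
    also have "\<dots> \<le> L2_set (\<lambda>j. sqrt (?\<rho> j) * c j) {..<n} + L2_set (\<lambda>j. sqrt (?\<rho> j) * d j) {..<n}"
      by (rule L2_set_triangle_ineq)
    also have "\<dots> \<le> seq_norm r c + seq_norm r d" unfolding L2 by (intro add_mono fin sc sd)
    finally show ?thesis by (rule sqrt_le_D)
  qed
  have "(\<Sum>j. ?\<rho> j * (c j + d j)\<^sup>2) \<le> (seq_norm r c + seq_norm r d)\<^sup>2"
    by (rule suminf_le_const[OF s part])
  then show "seq_norm r (\<lambda>j. c j + d j) \<le> seq_norm r c + seq_norm r d"
    using seq_norm_nonneg[OF c] seq_norm_nonneg[OF d] unfolding seq_norm_def[of r "\<lambda>j. c j + d j"]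
    by (intro real_le_lsqrt) auto
qed

lemma seq_norm_scale:
  assumes "c \<in> seq_space r"
  shows "(\<lambda>j. k * c j) \<in> seq_space r"
  using seq_norm_dominated(1)[of c r "\<bar>k\<bar>" r "\<lambda>j. k * c j"] assms
      by (simp add: power_mult_distrib mult_ac)

lemma seq_norm_eq_0:
  assumes "c \<in> seq_space r" "seq_norm r c = 0"
  shows "c j = 0"
proof -
  have "(\<Sum>j. (1 + (real j)\<^sup>2) powr r * (c j)\<^sup>2) = 0" using assms(2) by (simp add: seq_norm_def)
  then have "(1 + (real j)\<^sup>2) powr r * (c j)\<^sup>2 = 0"
    using assms(1) by (subst (asm) suminf_eq_zero_iff) (auto simp: seq_space_def)
  moreover have "1 + (real j)\<^sup>2 \<noteq> 0" by (smt (verit) zero_le_power2)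
  ultimately show ?thesis by simp
qed

lemma seq_space_square_summable:
  assumes "0 \<le> r" "c \<in> seq_space r"
  shows "summable (\<lambda>j. (c j)\<^sup>2)"
proof (rule summable_comparison_test')
  show "summable (\<lambda>j. (1 + (real j)\<^sup>2) powr r * (c j)\<^sup>2)" using assms(2)
      by (simp add: seq_space_def)
  fix j
  have "1 * (c j)\<^sup>2 \<le> (1 + (real j)\<^sup>2) powr r * (c j)\<^sup>2"
    using assms(1) by (intro mult_right_mono ge_one_powr_ge_zero) auto
  then show "norm ((c j)\<^sup>2) \<le> (1 + (real j)\<^sup>2) powr r * (c j)\<^sup>2" by simp
qed

lemma eigval_multiplier:
  assumes s: "0 < s"
  obtains A B where "A > 0" "B > 0"
    "\<And>c r. c \<in> seq_space (r + 2 * s) \<Longrightarrow> (\<lambda>j. eigval s j * c j) \<in> seq_space r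
        \<and> seq_norm r (\<lambda>j. eigval s j * c j) \<le> B * seq_norm (r + 2 * s) c"
    "\<And>c r. (\<lambda>j. eigval s j * c j) \<in> seq_space r \<Longrightarrow> c \<in> seq_space (r + 2 * s) \<and> seq_norm (r + 2 * s) c
        \<le> A * seq_norm r (\<lambda>j. eigval s j * c j)"
proof -
  obtain A B where A: "A > 0" "\<And>n. (1 + (real n)\<^sup>2) powr s \<le> A * eigval s n"
    and B: "B > 0" "\<And>n. eigval s n \<le> B * (1 + (real n)\<^sup>2) powr s"
    using eigval_bounds[OF s] by metis
  have \<rho>: "(1 + (real j)\<^sup>2) powr (r + 2 * s) = (1 + (real j)\<^sup>2) powr r * ((1 + (real j)\<^sup>2) powr
      s)\<^sup>2" for j r
  proof -
    have "r + 2 * s = r + (s + s)" by simp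
    then show ?thesis by (simp only: powr_add power2_eq_square)
  qed
  show ?thesis
  proof (rule that[OF A(1) B(1)])
    fix c r
    show "(\<lambda>j. eigval s j * c j) \<in> seq_space r \<and> seq_norm r (\<lambda>j. eigval s j * c j) \<le> B * seq_norm (r
        + 2 * s) c"
      if c: "c \<in> seq_space (r + 2 * s)"
    proof -
      have le: "(1 + (real j)\<^sup>2) powr r * (eigval s j * c j)\<^sup>2 \<le> B\<^sup>2 * ((1 + (real j)\<^sup>2) powr (r + 2
          * s) * (c j)\<^sup>2)" for j
      proof -
        have "(eigval s j)\<^sup>2 \<le> (B * (1 + (real j)\<^sup>2) powr s)\<^sup>2"
          using B(2) eigval_pos[OF s, of j] by (intro power_mono) auto
        then have "(1 + (real j)\<^sup>2) powr r * (c j)\<^sup>2 * (eigval s j)\<^sup>2 \<le> (1 + (real j)\<^sup>2) powr r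
            * (c j)\<^sup>2 * (B * (1 + (real j)\<^sup>2) powr s)\<^sup>2"
          by (intro mult_left_mono) auto
        then show ?thesis unfolding \<rho> by (simp only: power_mult_distrib mult_ac)
      qed
      show ?thesis using seq_norm_dominated[OF c less_imp_le[OF B(1)] le] by simp
    qed
    show "c \<in> seq_space (r + 2 * s) \<and> seq_norm (r + 2 * s) c \<le> A * seq_norm r (\<lambda>j. eigval s j
        * c j)"
      if c: "(\<lambda>j. eigval s j * c j) \<in> seq_space r"
    proof -
      have le: "(1 + (real j)\<^sup>2) powr (r + 2 * s) * (c j)\<^sup>2 \<le> A\<^sup>2 * ((1 + (real j)\<^sup>2) powr r
          * (eigval s j * c j)\<^sup>2)" for j
      proof -
        have "((1 + (real j)\<^sup>2) powr s)\<^sup>2 \<le> (A * eigval s j)\<^sup>2"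
          using A(2) by (intro power_mono) auto
        then have "(1 + (real j)\<^sup>2) powr r * (c j)\<^sup>2 * ((1 + (real j)\<^sup>2) powr s)\<^sup>2
            \<le> (1 + (real j)\<^sup>2) powr r * (c j)\<^sup>2 * (A * eigval s j)\<^sup>2"
          by (intro mult_left_mono) auto
        then show ?thesis unfolding \<rho> by (simp only: power_mult_distrib mult_ac)
      qed
      show ?thesis using seq_norm_dominated[OF c less_imp_le[OF A(1)] le] by simp
    qed
  qed
qed

section \<open>The weighted spaces as sequence spaces\<close>

text \<open>
  The choice matters only up to null sets, by \<open>L2s_zero_if_coeff_zero\<close>.
\<close>

definition gegenbauer_series :: "real \<Rightarrow> (nat \<Rightarrow> real) \<Rightarrow> real \<Rightarrow> real" where
  "gegenbauer_series s c = (SOME v. v \<in> L2s s (-1) 1 \<and> (\<forall>j. gegenbauer_coeff s v j = c j))"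

lemma gegenbauer_series:
  assumes "0 < s" "s < 1" "summable (\<lambda>j. (c j)\<^sup>2)"
  shows "gegenbauer_series s c \<in> L2s s (-1) 1" "gegenbauer_coeff s (gegenbauer_series s c) j = c j"
proof -
  have "\<exists>v. v \<in> L2s s (-1) 1 \<and> (\<forall>j. gegenbauer_coeff s v j = c j)"
    using Riesz_Fischer_gegenbauer[OF assms] by blast
  from someI_ex[OF this] show "gegenbauer_series s c \<in> L2s s (-1) 1" "gegenbauer_coeff s
      (gegenbauer_series s c) j = c j"
    unfolding gegenbauer_series_def by auto
qed

definition series_class :: "real \<Rightarrow> real \<Rightarrow> real \<Rightarrow> (nat \<Rightarrow> real) \<Rightarrow> (real \<Rightarrow> real) set" where
  "series_class s a b c = ae_class a b (gegenbauer_series s c \<circ> to_ref a b)"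

text \<open>
  The coefficients do not depend on the representative, see \<open>class_coeff_ae_class\<close>.
\<close>

definition class_coeff :: "real \<Rightarrow> real \<Rightarrow> real \<Rightarrow> (real \<Rightarrow> real) set \<Rightarrow> nat \<Rightarrow> real" where
  "class_coeff s a b F = gegenbauer_coeff s ((SOME f. f \<in> F) \<circ> from_ref a b)"

lemma comp_from_to:
  assumes "a < b"
  shows "(v \<circ> to_ref a b) \<circ> from_ref a b = v" "(v \<circ> from_ref a b) \<circ> to_ref a b = v"
  using to_ref_inverse[OF assms] by (auto simp: fun_eq_iff)

lemma Hs_fun_measurable:
  assumes "a < b" "v \<in> Hs_fun s r a b"
  shows "v \<in> borel_measurable (lebesgue_on {a<..<b})"
proof -
  have "v \<circ> from_ref a b \<in> borel_measurable I1" using assms(2)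
      by (auto simp: Hs_fun_def Hs_ref_def L2s_I1)
  from measurable_comp_to_ref[OF assms(1) this] show ?thesis
      by (simp only: comp_from_to[OF assms(1)])
qed

lemma class_coeff_ae_class:
  assumes "a < b" "v \<in> borel_measurable (lebesgue_on {a<..<b})"
  shows "class_coeff s a b (ae_class a b v) j = gegenbauer_coeff s (v \<circ> from_ref a b) j"
proof -
  define f where "f = (SOME f. f \<in> ae_class a b v)"
  have "f \<in> ae_class a b v" unfolding f_def by (rule someI[of "\<lambda>f. f \<in> ae_class a b v", OF
      ae_class_self[OF assms(2)]])
  then have f: "f \<in> borel_measurable (lebesgue_on {a<..<b})" "AE x in lebesgue_on {a<..<b}. f x
      = v x"
    by (auto simp: ae_class_def)
  show ?thesis unfolding class_coeff_def f_def[symmetric]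
    by (rule coeff_cong_AE) (use measurable_comp_from_ref[OF assms(1)] f assms AE_comp_from_ref[OF
        assms(1) f(2)] in auto)
qed

lemma Hs_ref_iff: "v \<in> Hs_ref s r \<longleftrightarrow> v \<in> L2s s (-1) 1 \<and> gegenbauer_coeff s v \<in> seq_space r"
  by (simp add: Hs_ref_def seq_space_def)

lemma Hs_E:
  assumes "a < b" "F \<in> Hs s r a b"
  obtains v where "F = ae_class a b v" "v \<in> borel_measurable (lebesgue_on {a<..<b})"
    "v \<circ> from_ref a b \<in> L2s s (-1) 1" "gegenbauer_coeff s (v \<circ> from_ref a b) \<in> seq_space r"
    "class_coeff s a b F = gegenbauer_coeff s (v \<circ> from_ref a b)"
proof -
  obtain v where v: "v \<in> Hs_fun s r a b" "F = ae_class a b v" using assms(2) by (auto simp: Hs_def)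
  note m = Hs_fun_measurable[OF assms(1) v(1)]
  show ?thesis
    by (rule that[OF v(2) m]) (use v m class_coeff_ae_class[OF assms(1) m] in \<open>auto simp: Hs_fun_def
        Hs_ref_iff fun_eq_iff\<close>)
qed

lemma Hs_I:
  assumes "a < b" "v \<in> L2s s (-1) 1" "gegenbauer_coeff s v \<in> seq_space r"
  shows "ae_class a b (v \<circ> to_ref a b) \<in> Hs s r a b"
    and "class_coeff s a b (ae_class a b (v \<circ> to_ref a b)) = gegenbauer_coeff s v"
proof -
  have m: "v \<circ> to_ref a b \<in> borel_measurable (lebesgue_on {a<..<b})"
    by (rule measurable_comp_to_ref[OF assms(1)]) (use assms in \<open>auto simp: L2s_I1\<close>)
  show "ae_class a b (v \<circ> to_ref a b) \<in> Hs s r a b"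
    unfolding Hs_def Hs_fun_def using assms by (auto simp: comp_from_to Hs_ref_iff)
  show "class_coeff s a b (ae_class a b (v \<circ> to_ref a b)) = gegenbauer_coeff s v"
    using class_coeff_ae_class[OF assms(1) m] by (simp add: comp_from_to[OF assms(1)] fun_eq_iff)
qed

lemma Hs_coeff: "a < b \<Longrightarrow> F \<in> Hs s r a b \<Longrightarrow> class_coeff s a b F \<in> seq_space r"
  by (elim Hs_E) auto

lemma Hs_class_of:
  assumes "0 < s" "s < 1" "a < b" "0 \<le> r" "c \<in> seq_space r"
  shows "series_class s a b c \<in> Hs s r a b" "class_coeff s a b (series_class s a b c) = c"
proof -
  note v = gegenbauer_series[OF assms(1,2) seq_space_square_summable[OF assms(4,5)]]
  have "gegenbauer_coeff s (gegenbauer_series s c) = c" using v(2) by auto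
  then show "series_class s a b c \<in> Hs s r a b" "class_coeff s a b (series_class s a b c) = c"
    unfolding series_class_def using Hs_I[OF assms(3) v(1), of r] assms(5) by simp_all
qed

text \<open>
  The coefficients determine a class. Through this lemma, equations between classes reduce to
  equations between sequences.
\<close>

lemma Hs_eqI:
  assumes s: "0 < s" "s < 1" and ab: "a < b" and FG: "F \<in> Hs s r a b" "G \<in> Hs s r a b"
    and eq: "class_coeff s a b F = class_coeff s a b G"
  shows "F = G"
proof -
  obtain u where u: "F = ae_class a b u" "u \<in> borel_measurable (lebesgue_on {a<..<b})"
    "u \<circ> from_ref a b \<in> L2s s (-1) 1" "class_coeff s a b F = gegenbauer_coeff s (u \<circ> from_ref a b)"
    using Hs_E[OF ab FG(1)] by metis
  obtain v where v: "G = ae_class a b v" "v \<in> borel_measurable (lebesgue_on {a<..<b})"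
    "v \<circ> from_ref a b \<in> L2s s (-1) 1" "class_coeff s a b G = gegenbauer_coeff s (v \<circ> from_ref a b)"
    using Hs_E[OF ab FG(2)] by metis
  define w where "w x = (u \<circ> from_ref a b) x + (-1) * (v \<circ> from_ref a b) x" for x
  note v' = L2s_scale[OF v(3), of "-1"]
  have w: "w \<in> L2s s (-1) 1" unfolding w_def by (rule L2s_add[OF u(3) v'])
  have "gegenbauer_coeff s w j = 0" for j
    unfolding w_def coeff_add[OF s u(3) v'] coeff_scale using eq u(4) v(4) by (simp add: fun_eq_iff)
  then have "AE x in I1. w x = 0" by (rule L2s_zero_if_coeff_zero[OF s w])
  then have "AE x in lebesgue_on {a<..<b}. w (to_ref a b x) = 0" by (rule AE_comp_to_ref[OF ab])
  then have "AE x in lebesgue_on {a<..<b}. u x = v x"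
    by eventually_elim (simp add: w_def to_ref_inverse[OF ab])
  then show ?thesis unfolding u(1) v(1) by (rule ae_class_cong)
qed

lemma Hs_add:
  assumes s: "0 < s" "s < 1" and ab: "a < b" and FG: "F \<in> Hs s r a b" "G \<in> Hs s r a b"
  shows "class_add a b F G \<in> Hs s r a b"
    and "class_coeff s a b (class_add a b F G) = (\<lambda>j. class_coeff s a b F j + class_coeff s a b G
        j)"
proof -
  obtain u where u: "F = ae_class a b u" "u \<in> borel_measurable (lebesgue_on {a<..<b})"
    "u \<circ> from_ref a b \<in> L2s s (-1) 1" "gegenbauer_coeff s (u \<circ> from_ref a b) \<in> seq_space r"
    "class_coeff s a b F = gegenbauer_coeff s (u \<circ> from_ref a b)"
    using Hs_E[OF ab FG(1)] by metis
  obtain v where v: "G = ae_class a b v" "v \<in> borel_measurable (lebesgue_on {a<..<b})"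
    "v \<circ> from_ref a b \<in> L2s s (-1) 1" "gegenbauer_coeff s (v \<circ> from_ref a b) \<in> seq_space r"
    "class_coeff s a b G = gegenbauer_coeff s (v \<circ> from_ref a b)"
    using Hs_E[OF ab FG(2)] by metis
  let ?w = "\<lambda>x. (u \<circ> from_ref a b) x + (v \<circ> from_ref a b) x"
  have w: "?w \<in> L2s s (-1) 1" by (rule L2s_add[OF u(3) v(3)])
  have cw: "gegenbauer_coeff s ?w = (\<lambda>j. class_coeff s a b F j + class_coeff s a b G j)"
    by (rule ext) (simp only: coeff_add[OF s u(3) v(3)] u(5) v(5))
  then have "gegenbauer_coeff s ?w \<in> seq_space r"
    using seq_norm_triangle(1)[OF u(4) v(4)] u(5) v(5) by simp
  note H = Hs_I[OF ab w this]
  have "class_add a b F G = ae_class a b (?w \<circ> to_ref a b)"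
    unfolding u(1) v(1) class_add_ae_class[OF u(2) v(2)] by (simp add: o_def to_ref_inverse[OF ab])
  then show "class_add a b F G \<in> Hs s r a b"
    "class_coeff s a b (class_add a b F G) = (\<lambda>j. class_coeff s a b F j + class_coeff s a b G j)"
    using H cw by simp_all
qed

lemma Hs_scale:
  assumes ab: "a < b" and F: "F \<in> Hs s r a b"
  shows "class_scale a b k F \<in> Hs s r a b"
    and "class_coeff s a b (class_scale a b k F) = (\<lambda>j. k * class_coeff s a b F j)"
proof -
  obtain u where u: "F = ae_class a b u" "u \<in> borel_measurable (lebesgue_on {a<..<b})"
    "u \<circ> from_ref a b \<in> L2s s (-1) 1" "gegenbauer_coeff s (u \<circ> from_ref a b) \<in> seq_space r"
    "class_coeff s a b F = gegenbauer_coeff s (u \<circ> from_ref a b)"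
    using Hs_E[OF ab F] by metis
  let ?w = "\<lambda>x. k * (u \<circ> from_ref a b) x"
  have w: "?w \<in> L2s s (-1) 1" by (rule L2s_scale[OF u(3)])
  have cw: "gegenbauer_coeff s ?w = (\<lambda>j. k * class_coeff s a b F j)"
    by (rule ext) (simp only: coeff_scale u(5))
  then have "gegenbauer_coeff s ?w \<in> seq_space r"
    using seq_norm_scale[OF u(4)] u(5) by simp
  note H = Hs_I[OF ab w this]
  have "class_scale a b k F = ae_class a b (?w \<circ> to_ref a b)"
    unfolding u(1) class_scale_ae_class[OF u(2)] by (simp add: o_def to_ref_inverse[OF ab])
  then show "class_scale a b k F \<in> Hs s r a b"
    "class_coeff s a b (class_scale a b k F) = (\<lambda>j. k * class_coeff s a b F j)"
    using H cw by simp_all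
qed

lemma Hs_dist_eq:
  assumes s: "0 < s" "s < 1" and ab: "a < b" and FG: "F \<in> Hs s r a b" "G \<in> Hs s r a b"
  shows "Hs_dist s r a b F G = seq_norm r (\<lambda>j. class_coeff s a b F j - class_coeff s a b G j)"
proof -
  have norm: "Hs_norm s r a b K = seq_norm r (class_coeff s a b K)" if K: "K \<in> Hs s r a b" for K
  proof -
    obtain u where u: "K = ae_class a b u" "u \<in> borel_measurable (lebesgue_on {a<..<b})"
      "class_coeff s a b K = gegenbauer_coeff s (u \<circ> from_ref a b)"
      using Hs_E[OF ab K] by metis
    show ?thesis unfolding u(3) unfolding u(1) Hs_norm_ae_class[OF ab u(2)]
      by (simp add: Hs_fun_norm_def Hs_ref_norm_def seq_norm_def)
  qed
  note G' = Hs_scale[OF ab FG(2), of "-1"]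
  show ?thesis
    unfolding Hs_dist_def using FG norm[OF Hs_add(1)[OF s ab FG(1) G'(1)]] Hs_add(2)[OF s ab FG(1)
        G'(1)] G'(2)
    by simp
qed

lemma diff_in_seq_space:
  assumes "c \<in> seq_space r" "d \<in> seq_space r"
  shows "(\<lambda>j. c j - d j) \<in> seq_space r"
  using seq_norm_triangle(1)[OF assms(1) seq_norm_scale[OF assms(2), of "-1"]] by simp

lemma Hs_Metric_space:
  assumes s: "0 < s" "s < 1" and ab: "a < b"
  shows "Metric_space (Hs s r a b) (Hs_dist s r a b)"
proof
  note dist = Hs_dist_eq[OF s ab]
  note cf = Hs_coeff[OF ab]
  have comm: "seq_norm r (\<lambda>j. c j - d j) = seq_norm r (\<lambda>j. d j - c j)" for c d
    by (simp add: seq_norm_def power2_commute)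
  fix F G
  show "0 \<le> Hs_dist s r a b F G"
  proof (cases "F \<in> Hs s r a b \<and> G \<in> Hs s r a b")
    case True
    then show ?thesis using dist seq_norm_nonneg[OF diff_in_seq_space[OF cf cf]] by simp
  qed (auto simp: Hs_dist_def)
  show "Hs_dist s r a b F G = Hs_dist s r a b G F"
  proof (cases "F \<in> Hs s r a b \<and> G \<in> Hs s r a b")
    case True
    then show ?thesis using dist[of F r G] dist[of G r F] comm by simp
  qed (auto simp: Hs_dist_def)
  show "Hs_dist s r a b F G = 0 \<longleftrightarrow> F = G" if FG: "F \<in> Hs s r a b" "G \<in> Hs s r a b"
  proof
    assume "Hs_dist s r a b F G = 0"
    then have "seq_norm r (\<lambda>j. class_coeff s a b F j - class_coeff s a b G j) = 0" using dist FG
        by simp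
    then have "class_coeff s a b F j - class_coeff s a b G j = 0" for j
      by (rule seq_norm_eq_0[OF diff_in_seq_space[OF cf[OF FG(1)] cf[OF FG(2)]]])
    then show "F = G" by (intro Hs_eqI[OF s ab FG]) (simp add: fun_eq_iff)
  next
    assume "F = G"
    then show "Hs_dist s r a b F G = 0" using dist[OF FG] by (simp add: seq_norm_def)
  qed
  fix K
  show "Hs_dist s r a b F K \<le> Hs_dist s r a b F G + Hs_dist s r a b G K"
    if "F \<in> Hs s r a b" "G \<in> Hs s r a b" "K \<in> Hs s r a b"
    using seq_norm_triangle(2)[OF diff_in_seq_space[OF cf[OF that(1)] cf[OF that(2)]]
        diff_in_seq_space[OF cf[OF that(2)] cf[OF that(3)]]]
      dist that by simp
qed

lemma Hs_continuous_if_Lipschitz: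
  assumes s: "0 < s" "s < 1" and ab: "a < b" and K: "K > 0"
    and T: "\<And>F. F \<in> Hs s r1 a b \<Longrightarrow> T F \<in> Hs s r2 a b"
    and lip: "\<And>F G. F \<in> Hs s r1 a b \<Longrightarrow> G \<in> Hs s r1 a b \<Longrightarrow> Hs_dist s r2 a b (T F) (T G)
        \<le> K * Hs_dist s r1 a b F G"
  shows "continuous_map (Hs_top s r1 a b) (Hs_top s r2 a b) T"
  unfolding Hs_top_def Metric_space.metric_continuous_map[OF Hs_Metric_space[OF s ab]
      Hs_Metric_space[OF s ab]]
proof (intro conjI ballI allI impI)
  show "T ` Hs s r1 a b \<subseteq> Hs s r2 a b" using T by blast
  fix F and e :: real assume F: "F \<in> Hs s r1 a b" and e: "e > 0"
  have "Hs_dist s r2 a b (T F) (T G) < e" if "G \<in> Hs s r1 a b" "Hs_dist s r1 a b F G < e / K" for G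
  proof -
    have "K * Hs_dist s r1 a b F G < K * (e / K)" using that(2) K by (intro mult_strict_left_mono)
    then show ?thesis using lip[OF F that(1)] K by simp
  qed
  then show "\<exists>\<delta>>0. \<forall>x. x \<in> Hs s r1 a b \<and> Hs_dist s r1 a b F x < \<delta> \<longrightarrow> Hs_dist s r2 a b (T F) (T x)
      < e"
    using e K by (intro exI[of _ "e / K"]) auto
qed

section \<open>The extended operator\<close>

definition multiplier_map :: "real \<Rightarrow> real \<Rightarrow> real \<Rightarrow> (real \<Rightarrow> real) set \<Rightarrow> (real \<Rightarrow> real) set" where
  "multiplier_map s a b F = series_class s a b (\<lambda>j. eigval s j * class_coeff s a b F j)"

lemma poly_comp_to_ref_C2_C1: "poly p \<circ> to_ref a b \<in> C2_C1 a b"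
proof -
  define q where "q = pcompose p [:- (a + b) / (b - a), 2 / (b - a):]"
  have "poly p \<circ> to_ref a b = poly q"
    by (simp add: fun_eq_iff q_def poly_pcompose to_ref_def mult.commute)
  moreover have "poly q \<in> C2_C1 a b"
    unfolding C2_C1_def mem_Collect_eq
    by (rule exI[of _ "poly (pderiv q)"], rule exI[of _ "poly (pderiv (pderiv q))"])
       (auto intro!: continuous_intros poly_DERIV has_field_derivative_at_within)
  ultimately show ?thesis by simp
qed

text \<open>
  The approximants are partial sums of the Gegenbauer expansion.
\<close>

lemma Hs_dense_polynomials:
  assumes s: "0 < s" "s < 1" and ab: "a < b" and F: "F \<in> Hs s r a b" and e: "e > 0"
  shows "\<exists>p. poly p \<circ> to_ref a b \<in> Hs_fun s r a b \<and> Hs_dist s r a b F (ae_class a b (poly p \<circ> to_ref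
      a b)) < e"
proof -
  define c where "c = class_coeff s a b F"
  let ?x = "\<lambda>j. (1 + (real j)\<^sup>2) powr r * (c j)\<^sup>2"
  have sx: "summable ?x" using Hs_coeff[OF ab F] by (simp add: c_def seq_space_def)
  then have "(\<lambda>n. \<Sum>j<n. ?x j) \<longlonglongrightarrow> suminf ?x" by (rule summable_LIMSEQ)
  then have "\<forall>\<^sub>F n in sequentially. suminf ?x - e\<^sup>2 < (\<Sum>j<n. ?x j)" using e
      by (intro order_tendstoD) auto
  then obtain n where n: "suminf ?x - e\<^sup>2 < (\<Sum>j<n. ?x j)" by (auto simp: eventually_sequentially)
  define p where "p = (\<Sum>j<n. smult (c j) (gbasis s j))"
  have cp: "gegenbauer_coeff s (poly p) j = (if j < n then c j else 0)" for j
  proof -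
    have "gegenbauer_coeff s (poly p) j = omega_integral s (p * gbasis s j)"
      by (simp add: gegenbauer_coeff_eq omega_integral_def mult_ac)
    also have "\<dots> = (\<Sum>i<n. c i * (if i = j then 1 else 0))"
      unfolding p_def sum_distrib_right omega_integral_sum[OF s(1)]
          by (simp only: mult_smult_left omega_integral_smult gbasis_orthonormal[OF s(1)])
    also have "\<dots> = (if j < n then c j else 0)" by (simp add: if_distrib cong: if_cong)
    finally show ?thesis .
  qed
  have "summable (\<lambda>j. (1 + (real j)\<^sup>2) powr r * (if j < n then c j else 0)\<^sup>2)"
    by (rule summable_finite[of "{..<n}"]) auto
  then have ps: "gegenbauer_coeff s (poly p) \<in> seq_space r" by (simp add: seq_space_def cp)
  note H = Hs_I[OF ab L2s_poly[OF s(1)] ps]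
  have "Hs_dist s r a b F (ae_class a b (poly p \<circ> to_ref a b)) = seq_norm r (\<lambda>j. c j - (if j
      < n then c j else 0))"
    unfolding Hs_dist_eq[OF s ab F H(1)] H(2) c_def[symmetric] cp ..
  also have "\<dots> = sqrt (\<Sum>j. ?x j - (if j < n then ?x j else 0))"
    unfolding seq_norm_def by (intro arg_cong[of _ _ sqrt] suminf_cong) auto
  also have "(\<Sum>j. ?x j - (if j < n then ?x j else 0)) = suminf ?x - (\<Sum>j. if j < n then ?x j else 0)"
    by (rule suminf_diff[symmetric, OF sx]) (rule summable_finite[of "{..<n}"], auto)
  also have "(\<Sum>j. if j < n then ?x j else 0) = (\<Sum>j<n. ?x j)"
    by (subst suminf_finite[of "{..<n}"]) auto
  also have "sqrt (suminf ?x - (\<Sum>j<n. ?x j)) < sqrt (e\<^sup>2)" using n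
      by (intro real_sqrt_less_mono) simp
  also have "sqrt (e\<^sup>2) = e" using e by simp
  finally have "Hs_dist s r a b F (ae_class a b (poly p \<circ> to_ref a b)) < e" .
  moreover have "poly p \<circ> to_ref a b \<in> Hs_fun s r a b"
    using L2s_poly[OF s(1)] ps by (simp add: Hs_fun_def comp_from_to[OF ab] Hs_ref_iff)
  ultimately show ?thesis by blast
qed

text \<open>
  Two continuous extensions agree on the dense set of classes of polynomials, and the target is
  a metric space.
\<close>

lemma extension_unique:
  assumes s: "0 < s" "s < 1" and ab: "a < b"
    and T: "continuous_linear_extension s r a b T" and T': "continuous_linear_extension s r a b T'"
    and F: "F \<in> Hs s (r + 2 * s) a b"
  shows "T' F = T F"
proof -
  interpret M: Metric_space "Hs s r a b" "Hs_dist s r a b" by (rule Hs_Metric_space[OF s ab])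
  have cont: "\<exists>\<delta>>0. \<forall>G. G \<in> Hs s (r + 2 * s) a b \<and> Hs_dist s (r + 2 * s) a b F G < \<delta>
      \<longrightarrow> Hs_dist s r a b (S F) (S G) < e"
    if "continuous_linear_extension s r a b S" "e > 0" for S e
    using that F unfolding continuous_linear_extension_def Hs_top_def
      Metric_space.metric_continuous_map[OF Hs_Metric_space[OF s ab] Hs_Metric_space[OF s ab]]
          by blast
  have in_Hs: "S G \<in> Hs s r a b" if "continuous_linear_extension s r a b S" "G \<in> Hs s (r + 2
      * s) a b" for S G
    using that unfolding continuous_linear_extension_def by blast
  have "Hs_dist s r a b (T' F) (T F) \<le> 0 + e" if "e > 0" for e
  proof -
    obtain d where d: "d > 0" "\<And>G. G \<in> Hs s (r + 2 * s) a b \<Longrightarrow> Hs_dist s (r + 2 * s) a b F G < d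
        \<Longrightarrow> Hs_dist s r a b (T F) (T G) < e / 2"
      using cont[OF T, of "e / 2"] \<open>e > 0\<close> by auto
    obtain d' where d': "d' > 0" "\<And>G. G \<in> Hs s (r + 2 * s) a b \<Longrightarrow> Hs_dist s (r + 2 * s) a b F G < d'
        \<Longrightarrow> Hs_dist s r a b (T' F) (T' G) < e / 2"
      using cont[OF T', of "e / 2"] \<open>e > 0\<close> by auto
    obtain p where p: "poly p \<circ> to_ref a b \<in> Hs_fun s (r + 2 * s) a b"
      "Hs_dist s (r + 2 * s) a b F (ae_class a b (poly p \<circ> to_ref a b)) < min d d'"
      using Hs_dense_polynomials[OF s ab F, of "min d d'"] d d' by auto
    define G where "G = ae_class a b (poly p \<circ> to_ref a b)"
    have G: "G \<in> Hs s (r + 2 * s) a b" unfolding G_def Hs_def using p(1) by blast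
    have "T G = T' G"
      using T T' p(1) poly_comp_to_ref_C2_C1[of p a b] unfolding continuous_linear_extension_def
          G_def by auto
    moreover have "Hs_dist s r a b (T' F) (T F) \<le> Hs_dist s r a b (T' F) (T' G)
        + Hs_dist s r a b (T' G) (T F)"
      by (rule M.triangle[OF in_Hs[OF T' F] in_Hs[OF T' G] in_Hs[OF T F]])
    moreover have "Hs_dist s r a b (T' G) (T F) = Hs_dist s r a b (T F) (T' G)" by (rule M.commute)
    ultimately show ?thesis using d(2)[OF G] d'(2)[OF G] p(2) by (simp add: G_def)
  qed
  then have "Hs_dist s r a b (T' F) (T F) \<le> 0" by (rule field_le_epsilon)
  then show ?thesis using M.zero[OF in_Hs[OF T' F] in_Hs[OF T F]] M.nonneg[of "T' F" "T F"]
      by linarith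
qed

theorem theorem4p12:
  fixes s a b r :: real
  assumes "0 < s" and "s < 1" and "a < b" and "0 \<le> r"
  shows "\<exists>T. continuous_linear_extension s r a b T \<and>
    (\<forall>T'. continuous_linear_extension s r a b T' \<longrightarrow> (\<forall>F \<in> Hs s (r + 2 * s) a b. T' F = T F)) \<and>
    bij_betw T (Hs s (r + 2 * s) a b) (Hs s r a b) \<and>
    continuous_map (Hs_top s r a b) (Hs_top s (r + 2 * s) a b)
      (inv_into (Hs s (r + 2 * s) a b) T)"
proof -
  note s = assms(1,2) and ab = assms(3) and r = assms(4)
  let ?H = "Hs s (r + 2 * s) a b" and ?K = "Hs s r a b" and ?c = "class_coeff s a b"
  define T where "T = multiplier_map s a b"
  obtain A B where A: "A > 0" and B: "B > 0"
    and mulB: "\<And>c r. c \<in> seq_space (r + 2 * s) \<Longrightarrow> (\<lambda>j. eigval s j * c j) \<in> seq_space r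
        \<and> seq_norm r (\<lambda>j. eigval s j * c j) \<le> B * seq_norm (r + 2 * s) c"
    and mulA: "\<And>c r. (\<lambda>j. eigval s j * c j) \<in> seq_space r \<Longrightarrow> c \<in> seq_space (r + 2 * s)
        \<and> seq_norm (r + 2 * s) c \<le> A * seq_norm r (\<lambda>j. eigval s j * c j)"
    by (rule eigval_multiplier[OF s(1)]) (rule that)
  have r2: "0 \<le> r + 2 * s" using r s by simp
  have TF: "T F \<in> ?K" "?c (T F) = (\<lambda>j. eigval s j * ?c F j)" if "F \<in> ?H" for F
    using Hs_class_of[OF s ab r] mulB[OF Hs_coeff[OF ab that]]
        by (simp_all add: T_def multiplier_map_def)
  have dist_T: "Hs_dist s r a b (T F) (T G) = seq_norm r (\<lambda>j. eigval s j * (?c F j - ?c G j))"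
      if "F \<in> ?H" "G \<in> ?H" for F G
    using Hs_dist_eq[OF s ab TF(1) TF(1)] TF(2) that by (simp add: right_diff_distrib)
  have diff: "(\<lambda>j. ?c F j - ?c G j) \<in> seq_space (r + 2 * s)" if "F \<in> ?H" "G \<in> ?H" for F G
    by (rule diff_in_seq_space; rule Hs_coeff[OF ab]) (use that in auto)
  have ext: "continuous_linear_extension s r a b T"
    unfolding continuous_linear_extension_def
  proof (intro conjI ballI)
    show "T \<in> ?H \<rightarrow> ?K" using TF(1) by blast
    show "continuous_map (Hs_top s (r + 2 * s) a b) (Hs_top s r a b) T"
    proof (rule Hs_continuous_if_Lipschitz[OF s ab B TF(1)])
      fix F G assume FG: "F \<in> ?H" "G \<in> ?H"
      show "Hs_dist s r a b (T F) (T G) \<le> B * Hs_dist s (r + 2 * s) a b F G"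
        unfolding dist_T[OF FG] Hs_dist_eq[OF s ab FG] using mulB[OF diff[OF FG]] by blast
    qed
    show "class_linear_on a b ?H T"
      unfolding class_linear_on_def
    proof (intro conjI ballI allI)
      fix F G assume FG: "F \<in> ?H" "G \<in> ?H"
      note ad = Hs_add[OF s ab FG] and ad' = Hs_add[OF s ab TF(1)[OF FG(1)] TF(1)[OF FG(2)]]
      show "T (class_add a b F G) = class_add a b (T F) (T G)"
        by (rule Hs_eqI[OF s ab TF(1)[OF ad(1)] ad'(1)])
           (simp add: TF(2)[OF ad(1)] ad(2) ad'(2) TF(2)[OF FG(1)] TF(2)[OF FG(2)] distrib_left)
    next
      fix k F assume F: "F \<in> ?H"
      note sc = Hs_scale[OF ab F, of k] and sc' = Hs_scale[OF ab TF(1)[OF F], of k]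
      show "T (class_scale a b k F) = class_scale a b k (T F)"
        by (rule Hs_eqI[OF s ab TF(1)[OF sc(1)] sc'(1)])
           (simp add: TF(2)[OF sc(1)] sc(2) sc'(2) TF(2)[OF F] mult_ac)
    qed
    fix \<phi> assume \<phi>: "\<phi> \<in> C2_C1 a b \<inter> Hs_fun s (r + 2 * s) a b"
    then have m: "\<phi> \<in> borel_measurable (lebesgue_on {a<..<b})" using Hs_fun_measurable[OF ab]
        by blast
    let ?d = "\<lambda>j. eigval s j * gegenbauer_coeff s (\<phi> \<circ> from_ref a b) j"
    have "gegenbauer_coeff s (\<phi> \<circ> from_ref a b) \<in> seq_space (r + 2 * s)"
      using \<phi> by (simp add: Hs_fun_def Hs_ref_iff)
    then have "?d \<in> seq_space r" using mulB by blast
    note g = gegenbauer_series[OF s seq_space_square_summable[OF r this]]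
    have "AE x in lebesgue_on {a<..<b}. weighted_frac_lap s a b \<phi> x
        = (gegenbauer_series s ?d \<circ> to_ref a b) x"
      by (rule weighted_frac_lap_AE[OF s ab _ g]) (use \<phi> in blast)
    then have "ae_class a b (weighted_frac_lap s a b \<phi>) = ae_class a b (gegenbauer_series s ?d \<circ>
        to_ref a b)"
      by (rule ae_class_cong)
    then show "T (ae_class a b \<phi>) = ae_class a b (weighted_frac_lap s a b \<phi>)"
      by (simp add: T_def multiplier_map_def series_class_def class_coeff_ae_class[OF ab m])
  qed
  have bij: "bij_betw T ?H ?K"
  proof (rule bij_betw_imageI)
    show "inj_on T ?H"
    proof (rule inj_onI)
      fix F G assume FG: "F \<in> ?H" "G \<in> ?H" "T F = T G"
      then have "(\<lambda>j. eigval s j * ?c F j) = (\<lambda>j. eigval s j * ?c G j)"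
          using TF(2)[OF FG(1)] TF(2)[OF FG(2)] by simp
      then have "?c F j = ?c G j" for j using eigval_pos[OF s(1), of j]
          by (metis less_irrefl mult_cancel_left)
      then show "F = G" by (intro Hs_eqI[OF s ab FG(1,2)]) auto
    qed
    show "T ` ?H = ?K"
    proof
      show "T ` ?H \<subseteq> ?K" using TF(1) by blast
      show "?K \<subseteq> T ` ?H"
      proof
        fix G assume G: "G \<in> ?K"
        define c where "c j = ?c G j / eigval s j" for j
        have c: "(\<lambda>j. eigval s j * c j) = ?c G" using eigval_pos[OF s(1)]
            by (auto simp: c_def less_imp_neq[symmetric])
        then have "c \<in> seq_space (r + 2 * s)" using mulA[of c r] Hs_coeff[OF ab G] by simp
        note F = Hs_class_of[OF s ab r2 this]
        have "T (series_class s a b c) = G"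
          by (rule Hs_eqI[OF s ab TF(1)[OF F(1)] G]) (simp add: TF(2)[OF F(1)] F(2) c)
        then show "G \<in> T ` ?H" using F(1) by blast
      qed
    qed
  qed
  have inv: "continuous_map (Hs_top s r a b) (Hs_top s (r + 2 * s) a b) (inv_into ?H T)"
  proof (rule Hs_continuous_if_Lipschitz[OF s ab A])
    have sur: "T ` ?H = ?K" using bij by (simp add: bij_betw_def)
    show inH: "inv_into ?H T G \<in> ?H" if "G \<in> ?K" for G using that sur by (simp add: inv_into_into)
    fix G1 G2 assume G: "G1 \<in> ?K" "G2 \<in> ?K"
    define F1 F2 where "F1 = inv_into ?H T G1" "F2 = inv_into ?H T G2"
    have F: "F1 \<in> ?H" "F2 \<in> ?H" "T F1 = G1" "T F2 = G2"
      using G inH sur by (auto simp: F1_F2_def f_inv_into_f)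
    have "Hs_dist s (r + 2 * s) a b F1 F2 \<le> A * Hs_dist s r a b (T F1) (T F2)"
      unfolding dist_T[OF F(1,2)] Hs_dist_eq[OF s ab F(1,2)]
      using mulA[of "\<lambda>j. ?c F1 j - ?c F2 j" r] mulB[OF diff[OF F(1,2)]] by blast
    then show "Hs_dist s (r + 2 * s) a b (inv_into ?H T G1) (inv_into ?H T G2)
        \<le> A * Hs_dist s r a b G1 G2"
      by (simp only: F(3,4)) (simp only: F1_F2_def)
  qed
  show ?thesis using ext bij inv extension_unique[OF s ab ext] by blast
qed

end
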